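(* Let $G=(V,E)$ be an $n$-vertex hypergraph with $n\ge 2$, vertex-weight functions $w_1,\dots,w_t\colon V\to\mathbb{R}_+$, hyperedge-cost function $c\colon E\to\mathbb{R}_+$ and budget-vector $b\in\mathbb{R}^t_+$. Then the algorithm $\mathcal{M}$ described in the context outputs any fixed node-budgeted $b$-multiobjective min-cut of $G$ with probability at least \[Q_n=\begin{cases}1 & \text{if } n=2,\\ \frac13\binom{n-1}{2}^{-1} & \text{if } n\ge 3.\end{cases}\] Moreover, $\mathcal{M}$ can be implemented to run in polynomial time.
   Context: $\delta(U)$ is the set of hyperedges meeting both $U$ and $V\setminus U$; $c(F)=\sum_{e\in F}c(e)$; $w_i(U)=\sum_{u\in U}w_i(u)$. A vertex $v$ is feasible if $w_i(v)\le b_i$ for all $i$; a set $U$ is feasible if $w_i(U)\le b_i$ for all $i$. $F\subseteq E$ is a node-budgeted $b$-multiobjective min-cut if $F=\delta(X)$ for some feasible $X$ with $\emptyset\ne X\subsetneq V$ and $c(F)$ is minimum among all such. Contraction of $U\subseteq V$: replace $U$ by a new vertex $u$ with $w_i(u)=\sum_{v\in U}w_i(v)$; each hyperedge $e\not\subseteq U$ becomes $e$ if disjoint from $U$, else $(e\setminus U)\cup\{u\}$, same cost; hyperedges inside $U$ are deleted; hyperedges are identified with their originals. Subroutine $\mathcal{H}(G,c)$: let $\beta_e=\frac{|V|-|e|}{|V|}c(e)$; if $\beta_e=0$ for all $e$, return $E$; else contract a hyperedge chosen with probability proportional to $\beta_e$ and return $\mathcal{H}$ on the result. Algorithm $\mathcal{M}(G,t,w,c,b)$: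 let $U$ be the set of feasible vertices; if $U=\emptyset$ return INFEASIBLE. Let $\alpha_e=\frac{|U\setminus e|}{|U|}c(e)$. If $\alpha_e=0$ for all $e$: return $\delta(U)$ if $U$ is a feasible set, and $E$ otherwise. Otherwise contract all infeasible vertices together; if $U$ is a feasible set return $\mathcal{H}(G,c)$; else contract a hyperedge chosen with probability proportional to $\alpha_e$ and return $\mathcal{M}$ on the result.
   Formalization: Hyperedge costs are taken strictly positive (with zero costs the bound can fail), and when all α_e vanish M returns δ(U) only if U is feasible and U≠V, otherwise E (for U=V the empty δ(V) need not be a min-cut). *)

theory Defs
  imports "HOL-Probability.Probability" "HOL-Computational_Algebra.Polynomial"
begin

section \<open>Hypergraphs and node-budgeted min-cuts\<close>

text \<open>
  Hyperedges are abstract labels with an incidence map. Contraction can give two hyperedges the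
  same vertex set, and results are reported in terms of the original hyperedges; with labels both
  work without further bookkeeping.
\<close>

record ('v, 'e) hypergraph =
  verts :: "'v set"
  edges :: "'e set"
  inc :: "'e \<Rightarrow> 'v set"

definition hypergraph :: "('v, 'e) hypergraph \<Rightarrow> bool" where
  "hypergraph G \<longleftrightarrow> finite (verts G) \<and> finite (edges G) \<and>
     (\<forall>e\<in>edges G. inc G e \<noteq> {} \<and> inc G e \<subseteq> verts G)"

definition cut :: "('v, 'e) hypergraph \<Rightarrow> 'v set \<Rightarrow> 'e set" where
  "cut G U = {e \<in> edges G. inc G e \<inter> U \<noteq> {} \<and> inc G e \<inter> (verts G - U) \<noteq> {}}"

text \<open>The weight functions and budgets are indexed by \<open>0, \<dots>, t - 1\<close>.\<close>

definition feasible :: "nat \<Rightarrow> (nat \<Rightarrow> 'v \<Rightarrow> real) \<Rightarrow> (nat \<Rightarrow> real) \<Rightarrow> 'v set \<Rightarrow> bool" where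
  "feasible t w b U \<longleftrightarrow> (\<forall>i<t. (\<Sum>u\<in>U. w i u) \<le> b i)"

definition feasible_vertex :: "nat \<Rightarrow> (nat \<Rightarrow> 'v \<Rightarrow> real) \<Rightarrow> (nat \<Rightarrow> real) \<Rightarrow> 'v \<Rightarrow> bool" where
  "feasible_vertex t w b v \<longleftrightarrow> (\<forall>i<t. w i v \<le> b i)"

definition node_budgeted_min_cut ::
  "('v, 'e) hypergraph \<Rightarrow> nat \<Rightarrow> (nat \<Rightarrow> 'v \<Rightarrow> real) \<Rightarrow> ('e \<Rightarrow> real) \<Rightarrow> (nat \<Rightarrow> real) \<Rightarrow> 'e set \<Rightarrow> bool"
  where
  "node_budgeted_min_cut G t w c b F \<longleftrightarrow>
     (\<exists>X. X \<noteq> {} \<and> X \<subset> verts G \<and> feasible t w b X \<and> F = cut G X) \<and>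
     (\<forall>Y. Y \<noteq> {} \<and> Y \<subset> verts G \<and> feasible t w b Y \<longrightarrow> sum c F \<le> sum c (cut G Y))"

text \<open>
  Costs are strictly positive. With zero costs, distinct min-cuts may differ only in hyperedges of
  cost zero, which the algorithm never samples, and the probability bound fails.
\<close>

definition problem_instance ::
  "('v, 'e) hypergraph \<Rightarrow> nat \<Rightarrow> (nat \<Rightarrow> 'v \<Rightarrow> real) \<Rightarrow> ('e \<Rightarrow> real) \<Rightarrow> (nat \<Rightarrow> real) \<Rightarrow> bool" where
  "problem_instance G t w c b \<longleftrightarrow> hypergraph G \<and>
     (\<forall>i<t. \<forall>v\<in>verts G. 0 \<le> w i v) \<and> (\<forall>e\<in>edges G. 0 < c e) \<and> (\<forall>i<t. 0 \<le> b i)"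


section \<open>Contraction\<close>

text \<open>
  The vertex replacing \<open>U\<close> is named by an element of \<open>U\<close>, a name the contraction sets free.
  Contracting the empty set changes nothing. The map \<^const>\<open>inc\<close> is also defined on
  deleted hyperedges (those inside \<open>U\<close>), which become the singleton of the new vertex.
\<close>

definition new_vertex :: "'v set \<Rightarrow> 'v" where
  "new_vertex U = (SOME u. u \<in> U)"

definition contract :: "('v, 'e) hypergraph \<Rightarrow> 'v set \<Rightarrow> ('v, 'e) hypergraph" where
  "contract G U = (if U = {} then G else
     \<lparr> verts = insert (new_vertex U) (verts G - U),
       edges = {e \<in> edges G. \<not> inc G e \<subseteq> U},
       inc = (\<lambda>e. if inc G e \<inter> U = {} then inc G e else insert (new_vertex U) (inc G e - U)) \<rparr>)"

definition contract_weights :: "(nat \<Rightarrow> 'v \<Rightarrow> real) \<Rightarrow> 'v set \<Rightarrow> nat \<Rightarrow> 'v \<Rightarrow> real" where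
  "contract_weights w U = (if U = {} then w else
     (\<lambda>i v. if v = new_vertex U then (\<Sum>u\<in>U. w i u) else w i v))"


section \<open>The algorithms\<close>

text \<open>A distribution when \<open>A\<close> is finite, \<open>f\<close> is nonnegative on \<open>A\<close> and \<open>sum f A > 0\<close>.\<close>

definition proportional_pmf :: "'a set \<Rightarrow> ('a \<Rightarrow> real) \<Rightarrow> 'a pmf" where
  "proportional_pmf A f = embed_pmf (\<lambda>x. if x \<in> A then f x / sum f A else 0)"

partial_function (spmf) alg_H ::
  "('v, 'e) hypergraph \<Rightarrow> ('e \<Rightarrow> real) \<Rightarrow> 'e set spmf" where
  "alg_H G c =
    (let \<beta> = (\<lambda>e. (real (card (verts G)) - real (card (inc G e))) / real (card (verts G)) * c e)
     in if \<forall>e\<in>edges G. \<beta> e = 0 then return_spmf (edges G)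
        else bind_pmf (proportional_pmf (edges G) \<beta>) (\<lambda>e. alg_H (contract G (inc G e)) c))"

datatype 'e outcome = Infeasible | Cut "'e set"

text \<open>
  The hyperedge is drawn from all hyperedges of \<open>G\<close>, the index set of \<open>\<alpha>\<close>. It may thus be one that
  the contraction of the infeasible vertices deletes; contracting its image, a singleton, has no
  further effect. Drawing among the surviving hyperedges only would be undefined whenever \<open>\<alpha>\<close>
  vanishes on all of them.

  When all \<open>\<alpha> e\<close> vanish, \<open>cut G U\<close> is returned only if \<open>U\<close> is also a proper subset of the vertices.
  For \<open>U = verts G\<close> it is empty and need not be the cut of any admissible set: with a single
  hyperedge containing all vertices and large budgets, the only min-cut is that hyperedge.
\<close>

partial_function (spmf) alg_M ::
  "('v, 'e) hypergraph \<Rightarrow> nat \<Rightarrow> (nat \<Rightarrow> 'v \<Rightarrow> real) \<Rightarrow> ('e \<Rightarrow> real) \<Rightarrow> (nat \<Rightarrow> real) \<Rightarrow>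
   'e outcome spmf" where
  "alg_M G t w c b =
    (let U = {v \<in> verts G. feasible_vertex t w b v};
         \<alpha> = (\<lambda>e. real (card (U - inc G e)) / real (card U) * c e);
         G' = contract G (verts G - U);
         w' = contract_weights w (verts G - U)
     in if U = {} then return_spmf Infeasible
        else if \<forall>e\<in>edges G. \<alpha> e = 0 then
          return_spmf (Cut (if feasible t w b U \<and> U \<noteq> verts G then cut G U else edges G))
        else if feasible t w b U then map_spmf Cut (alg_H G' c)
        else bind_pmf (proportional_pmf (edges G) \<alpha>)
          (\<lambda>e. alg_M (contract G' (inc G' e)) t (contract_weights w' (inc G' e)) c b))"

definition Q :: "nat \<Rightarrow> real" where
  "Q n = (if n = 2 then 1 else 1 / 3 * inverse (real ((n - 1) choose 2)))"


section \<open>Randomized real-RAM programs\<close>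

text \<open>
  Running time is measured for structured programs over a real RAM whose inputs are real
  numbers: registers for natural numbers (used as counters and addresses, with addition and
  truncated subtraction only), a two-dimensional array of reals under each name, exact real
  arithmetic and comparison, and a coin with a computed bias. Each assignment, coin toss and
  evaluation of a test is one step; the expressions of a fixed program have bounded size, so this
  is the number of elementary operations up to a constant factor.
\<close>

datatype nexp = NLit nat | NVar string | NAdd nexp nexp | NSub nexp nexp

datatype rexp = RLit int | RGet string nexp nexp
  | RAdd rexp rexp | RSub rexp rexp | RMul rexp rexp | RDiv rexp rexp

datatype bexp = NLess nexp nexp | RLess rexp rexp | Neg bexp | Conj bexp bexp

datatype com =
    Skip
  | SetNat string nexp
  | SetReal string nexp nexp rexp
  | Toss string rexp
  | Seq com com
  | Cond bexp com com
  | While bexp com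

record store =
  nats :: "string \<Rightarrow> nat"
  reals :: "string \<Rightarrow> nat \<Rightarrow> nat \<Rightarrow> real"
  steps :: nat

primrec nval :: "nexp \<Rightarrow> store \<Rightarrow> nat" where
  "nval (NLit k) s = k"
| "nval (NVar x) s = nats s x"
| "nval (NAdd a a') s = nval a s + nval a' s"
| "nval (NSub a a') s = nval a s - nval a' s"

primrec rval :: "rexp \<Rightarrow> store \<Rightarrow> real" where
  "rval (RLit k) s = of_int k"
| "rval (RGet x a a') s = reals s x (nval a s) (nval a' s)"
| "rval (RAdd r r') s = rval r s + rval r' s"
| "rval (RSub r r') s = rval r s - rval r' s"
| "rval (RMul r r') s = rval r s * rval r' s"
| "rval (RDiv r r') s = rval r s / rval r' s"

primrec bval :: "bexp \<Rightarrow> store \<Rightarrow> bool" where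
  "bval (NLess a a') s \<longleftrightarrow> nval a s < nval a' s"
| "bval (RLess r r') s \<longleftrightarrow> rval r s < rval r' s"
| "bval (Neg p) s \<longleftrightarrow> \<not> bval p s"
| "bval (Conj p p') s \<longleftrightarrow> bval p s \<and> bval p' s"

definition tick :: "store \<Rightarrow> store" where
  "tick s = s\<lparr>steps := Suc (steps s)\<rparr>"

definition set_nat :: "string \<Rightarrow> nat \<Rightarrow> store \<Rightarrow> store" where
  "set_nat x k s = s\<lparr>nats := (nats s)(x := k)\<rparr>"

definition set_real :: "string \<Rightarrow> nat \<Rightarrow> nat \<Rightarrow> real \<Rightarrow> store \<Rightarrow> store" where
  "set_real x i j r s = s\<lparr>reals := (reals s)(x := (reals s x)(i := (reals s x i)(j := r)))\<rparr>"

partial_function (spmf) loop ::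
  "(store \<Rightarrow> bool) \<Rightarrow> (store \<Rightarrow> store spmf) \<Rightarrow> store \<Rightarrow> store spmf" where
  "loop p f s = (if p s then bind_spmf (f (tick s)) (\<lambda>s'. loop p f s') else return_spmf (tick s))"

text \<open>
  The missing mass of \<open>exec C s\<close> is the probability of nontermination. The library's
  \<^const>\<open>bernoulli_pmf\<close> clamps its parameter to the unit interval.
\<close>

primrec exec :: "com \<Rightarrow> store \<Rightarrow> store spmf" where
  "exec Skip = (\<lambda>s. return_spmf (tick s))"
| "exec (SetNat x a) = (\<lambda>s. return_spmf (tick (set_nat x (nval a s) s)))"
| "exec (SetReal x a a' r) =
     (\<lambda>s. return_spmf (tick (set_real x (nval a s) (nval a' s) (rval r s) s)))"
| "exec (Toss x r) =
     (\<lambda>s. bind_pmf (bernoulli_pmf (rval r s)) (\<lambda>h. return_spmf (tick (set_nat x (of_bool h) s))))"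
| "exec (Seq C D) = (\<lambda>s. bind_spmf (exec C s) (exec D))"
| "exec (Cond p C D) = (\<lambda>s. if bval p s then exec C (tick s) else exec D (tick s))"
| "exec (While p C) = loop (bval p) (exec C)"

text \<open>
  Instances with vertices \<open>{..<n}\<close> and hyperedges \<open>{..<m}\<close> are stored as the numbers \<open>n\<close>, \<open>m\<close>, \<open>t\<close>,
  the incidence matrix, and the arrays of weights, costs and budgets (the latter two in column 0).
  All other entries, and the step counter, are initially zero. A hyperedge set is output as its
  characteristic vector in column 0 of the array \<open>out\<close>.
\<close>

definition input_store ::
  "(nat, nat) hypergraph \<Rightarrow> nat \<Rightarrow> (nat \<Rightarrow> nat \<Rightarrow> real) \<Rightarrow> (nat \<Rightarrow> real) \<Rightarrow> (nat \<Rightarrow> real) \<Rightarrow> store"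
  where
  "input_store G t w c b =
    \<lparr> nats = (\<lambda>_. 0)(''n'' := card (verts G), ''m'' := card (edges G), ''t'' := t),
      reals = (\<lambda>_ _ _. 0)(
        ''inc'' := (\<lambda>e v. of_bool (e \<in> edges G \<and> v \<in> inc G e)),
        ''w'' := (\<lambda>i v. if i < t \<and> v \<in> verts G then w i v else 0),
        ''c'' := (\<lambda>e j. if e \<in> edges G \<and> j = 0 then c e else 0),
        ''b'' := (\<lambda>i j. if i < t \<and> j = 0 then b i else 0)),
      steps = 0 \<rparr>"

definition result :: "store \<Rightarrow> nat outcome" where
  "result s = (if nats s ''infeasible'' \<noteq> 0 then Infeasible else Cut {e. reals s ''out'' e 0 = 1})"

text \<open>
  The program does not depend on the instance, its output has exactly the distribution of
  \<^const>\<open>alg_M\<close>, and the number of steps is bounded on every run. The input has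
  \<open>n m + t n + m + t\<close> array entries, which is polynomially equivalent to the size \<open>n + m + t\<close>.
\<close>

definition implements_alg_M :: "com \<Rightarrow> (nat \<Rightarrow> nat) \<Rightarrow> bool" where
  "implements_alg_M C T \<longleftrightarrow>
    (\<forall>(G :: (nat, nat) hypergraph) n m t w c b.
       problem_instance G t w c b \<and> verts G = {..<n} \<and> edges G = {..<m} \<and> 2 \<le> n \<longrightarrow>
       lossless_spmf (exec C (input_store G t w c b)) \<and>
       map_spmf result (exec C (input_store G t w c b)) = alg_M G t w c b \<and>
       (\<forall>s \<in> set_spmf (exec C (input_store G t w c b)). steps s \<le> T (n + m + t)))"

end

(* Let r be the number of feasible vertices and F = delta(X) a min-cut. Every feasible vertex has a
   degree cut of cost at least c(F), so averaging gives r c(F) <= sum_e c(e) |e \<inter> U|, where e ranges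
   over the hyperedges of size at least two. Weighting a hyperedge by r - |e \<inter> U| therefore makes
   hyperedges of F unlikely to be drawn. Any other drawn hyperedge of size at least two leaves an
   instance in which F is still a min-cut, with so few vertices n' that
   (r - |e \<inter> U|) Q(n') >= r Q(n), and a singleton does no harm; induction on the number of hyperedges
   gives the bound. Once U itself is feasible and the infeasible vertices are contracted, every
   vertex set or its complement is feasible, so F is an ordinary min-cut, and the same averaging
   shows that H finds it.

   For the running time, the selection of U, the weights alpha, the candidate output and the
   contraction are written as array assignments with one summation each, at most cubic in
   n + m + t. A hyperedge is drawn by successive coin tosses whose biases are ratios of weights to
   suffix sums. Every round but the last deletes a hyperedge or switches to H, which gives a
   quartic number of steps. *)

theory Submission
  imports Defs
begin

section \<open>Contraction and minimum cuts\<close>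

text \<open>The factor 1/3 in \<open>Q\<close> is what three vertices allow: there the guarantee 2 /
  (m * (m - 1)) of \<open>alg_H\<close> equals \<open>Q 3\<close>, and when all three vertices are
  feasible, the estimate for a draw that leaves one of them outside the hyperedge is an equality as
  well. The induction is over hyperedges rather than vertices because contracting a singleton may
  leave the vertex count unchanged, whereas the drawn label always disappears, even one that merging
  the infeasible vertices has already deleted. The obstacle on the program side is that
  \<open>new_vertex\<close> is an unspecified choice, so the arrays can match an instance only up to
  a renaming of vertices. Program and recursion are compared by couplings with
  \<open>rel_spmf\<close>: one relation carries the output and the step bound together, so one
  induction gives both the exact distribution and the running time. A coupling also preserves total
  mass, hence almost sure termination has to be shown only for the abstract recursion.\<close>

lemma pmf_proportional_pmf:
  assumes "finite A" "\<And>x. x \<in> A \<Longrightarrow> 0 \<le> f x" "0 < sum f A"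
  shows "pmf (proportional_pmf A f) x = (if x \<in> A then f x / sum f A else 0)"
  unfolding proportional_pmf_def
proof (rule pmf_embed_pmf)
  show "0 \<le> (if x \<in> A then f x / sum f A else 0)" for x
    using assms by auto
  have "(\<integral>\<^sup>+x. ennreal (if x \<in> A then f x / sum f A else 0) \<partial>count_space UNIV) =
        (\<Sum>x\<in>A. ennreal (f x / sum f A))"
    using assms(1) by (subst nn_integral_count_space'[of A]) auto
  also have "\<dots> = ennreal (\<Sum>x\<in>A. f x / sum f A)"
    using assms by (intro sum_ennreal) auto
  also have "(\<Sum>x\<in>A. f x / sum f A) = 1"
    using assms(3) by (simp flip: sum_divide_distrib)
  finally show "(\<integral>\<^sup>+x. ennreal (if x \<in> A then f x / sum f A else 0) \<partial>count_space UNIV) = 1"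
    by simp
qed

lemma set_proportional_pmf:
  assumes "finite A" "\<And>x. x \<in> A \<Longrightarrow> 0 \<le> f x" "0 < sum f A"
  shows "set_pmf (proportional_pmf A f) = {x \<in> A. 0 < f x}"
  using assms by (auto simp: set_pmf_eq pmf_proportional_pmf order_less_le)

lemma spmf_bind_proportional_pmf:
  assumes "finite A" "\<And>x. x \<in> A \<Longrightarrow> 0 \<le> f x" "0 < sum f A"
  shows "spmf (bind_pmf (proportional_pmf A f) g) y = (\<Sum>x\<in>A. f x * spmf (g x) y) / sum f A"
proof -
  have "spmf (bind_pmf (proportional_pmf A f) g) y =
      (\<Sum>x\<in>A. spmf (g x) y * pmf (proportional_pmf A f) x)"
    unfolding pmf_bind using assms
    by (subst integral_measure_pmf_real[of A]) (auto simp: set_proportional_pmf)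
  also have "\<dots> = (\<Sum>x\<in>A. f x * spmf (g x) y / sum f A)"
    using assms by (intro sum.cong) (auto simp: pmf_proportional_pmf)
  finally show ?thesis by (simp add: sum_divide_distrib)
qed

section \<open>Contraction: vertices, cuts, weights and feasibility\<close>

lemma hypergraphD:
  assumes "hypergraph G"
  shows "finite (verts G)" "finite (edges G)"
    "e \<in> edges G \<Longrightarrow> inc G e \<noteq> {}" "e \<in> edges G \<Longrightarrow> inc G e \<subseteq> verts G"
  using assms by (auto simp: hypergraph_def)

lemma new_vertex_in: "S \<noteq> {} \<Longrightarrow> new_vertex S \<in> S"
  by (auto simp: new_vertex_def intro: someI)

lemma contract_empty [simp]: "contract G {} = G" "contract_weights w {} = w"
  by (simp_all add: contract_def contract_weights_def)

lemma contract_simps: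
  assumes "S \<noteq> {}"
  shows "verts (contract G S) = insert (new_vertex S) (verts G - S)"
    "edges (contract G S) = {e \<in> edges G. \<not> inc G e \<subseteq> S}"
    "inc (contract G S) e =
       (if inc G e \<inter> S = {} then inc G e else insert (new_vertex S) (inc G e - S))"
  using assms by (simp_all add: contract_def)

lemma edges_contract_subset: "edges (contract G S) \<subseteq> edges G"
  by (cases "S = {}") (auto simp: contract_simps)

lemma ball_edges_contract: "\<forall>e\<in>edges G. P e \<Longrightarrow> \<forall>e\<in>edges (contract G S). P e"
  using edges_contract_subset[of G S] by blast

lemma verts_contract_subset: "S \<subseteq> verts G \<Longrightarrow> verts (contract G S) \<subseteq> verts G"
  using new_vertex_in[of S] by (cases "S = {}") (auto simp: contract_simps)

lemma hypergraph_contract: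
  assumes "hypergraph G" "S \<subseteq> verts G"
  shows "hypergraph (contract G S)"
proof (cases "S = {}")
  case False
  then show ?thesis
    using assms new_vertex_in[of S]
    by (auto simp: hypergraph_def contract_simps)
qed (use assms in simp)

lemma problem_instance_contract:
  assumes "problem_instance G t w c b" "S \<subseteq> verts G"
  shows "problem_instance (contract G S) t (contract_weights w S) c b"
proof (cases "S = {}")
  case False
  have "0 \<le> contract_weights w S i v" if "i < t" "v \<in> verts (contract G S)" for i v
    using assms that False
    by (auto simp: problem_instance_def contract_weights_def contract_simps intro!: sum_nonneg)
  then show ?thesis
    using assms hypergraph_contract[of G S] edges_contract_subset[of G S]
    by (auto simp: problem_instance_def)
qed (use assms in simp)

lemma card_verts_contract:
  assumes "finite (verts G)" "S \<subseteq> verts G" "S \<noteq> {}"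
  shows "card (verts (contract G S)) + card S = card (verts G) + 1"
proof -
  have "card (verts (contract G S)) = card (verts G - S) + 1"
    using assms new_vertex_in[of S] by (simp add: contract_simps)
  moreover have "card (verts G - S) = card (verts G) - card S"
    using assms by (meson card_Diff_subset finite_subset)
  moreover have "card S \<le> card (verts G)"
    using assms card_mono by blast
  ultimately show ?thesis by simp
qed

text \<open>Pulling vertex sets back along the contraction expresses cuts and weights of the
  contracted instance in the original one. The sets obtained this way from subsets of the contracted
  vertex set are those that contain \<open>S\<close> or avoid it.\<close>

definition uncontract :: "'v set \<Rightarrow> 'v set \<Rightarrow> 'v set" where
  "uncontract S Y = (if new_vertex S \<in> Y then Y \<union> S else Y)"

lemma cut_contract:
  assumes "hypergraph G" "S \<subseteq> verts G" "S \<noteq> {}" "Y \<subseteq> verts (contract G S)"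
  shows "cut (contract G S) Y = cut G (uncontract S Y)"
proof -
  have u: "new_vertex S \<in> S" using assms(3) by (rule new_vertex_in)
  have Y: "Y \<subseteq> insert (new_vertex S) (verts G - S)" using assms by (simp add: contract_simps)
  have "e \<in> cut (contract G S) Y \<longleftrightarrow> e \<in> cut G (uncontract S Y)" if e: "e \<in> edges G" for e
  proof -
    have inc: "inc G e \<subseteq> verts G" using assms(1) e by (auto simp: hypergraph_def)
    \<comment> \<open>A hyperedge inside \<open>S\<close> is deleted, and a pulled-back set contains
      or avoids \<open>S\<close>, so neither side cuts it. Only in the third case does the new
      vertex stand for members of the hyperedge.\<close>
    consider "inc G e \<subseteq> S" | "inc G e \<inter> S = {}" | "\<not> inc G e \<subseteq> S" "inc G e \<inter> S \<noteq> {}"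
      by blast
    then show ?thesis
    proof cases
      case 1
      then show ?thesis using Y u by (auto simp: cut_def contract_simps[OF assms(3)] uncontract_def)
    next
      case 2
      then show ?thesis using Y u inc e
        by (auto simp: cut_def contract_simps[OF assms(3)] uncontract_def)
    next
      case 3
      then obtain x where "x \<in> inc G e" "x \<in> S" by blast
      then show ?thesis using Y u inc e assms(2) 3
        by (cases "new_vertex S \<in> Y") (auto simp: cut_def contract_simps[OF assms(3)] uncontract_def)
    qed
  qed
  then show ?thesis
    using edges_contract_subset[of G S] by (auto simp: cut_def)
qed

lemma sum_contract_weights:
  assumes "finite (verts G)" "S \<subseteq> verts G" "S \<noteq> {}" "Y \<subseteq> verts (contract G S)"
  shows "(\<Sum>v\<in>Y. contract_weights w S i v) = (\<Sum>v\<in>uncontract S Y. w i v)"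
proof -
  let ?u = "new_vertex S"
  have u: "?u \<in> S" using assms(3) by (rule new_vertex_in)
  have Y: "Y \<subseteq> insert ?u (verts G - S)" using assms by (simp add: contract_simps)
  have fin: "finite Y" "finite S" using Y assms by (auto intro: finite_subset)
  show ?thesis
  proof (cases "?u \<in> Y")
    case True
    have "(\<Sum>v\<in>Y. contract_weights w S i v) =
        contract_weights w S i ?u + (\<Sum>v\<in>Y - {?u}. contract_weights w S i v)"
      using True fin by (simp add: sum.remove)
    also have "\<dots> = (\<Sum>v\<in>S. w i v) + (\<Sum>v\<in>Y - {?u}. w i v)"
      using assms(3) by (simp add: contract_weights_def)
    also have "\<dots> = (\<Sum>v\<in>S \<union> (Y - {?u}). w i v)"
      using fin Y by (subst sum.union_disjoint) auto
    also have "S \<union> (Y - {?u}) = uncontract S Y"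
      using u True by (auto simp: uncontract_def)
    finally show ?thesis .
  next
    case False
    then show ?thesis
      using assms(3) by (auto simp: contract_weights_def uncontract_def intro!: sum.cong split: if_splits)
  qed
qed

lemma feasible_contract:
  assumes "finite (verts G)" "S \<subseteq> verts G" "S \<noteq> {}" "Y \<subseteq> verts (contract G S)"
  shows "feasible t (contract_weights w S) b Y \<longleftrightarrow> feasible t w b (uncontract S Y)"
  using sum_contract_weights[OF assms] by (simp add: feasible_def)

text \<open>Pulling back turns every competitor of the contracted instance into an original
  competitor of the same cost, so the minimum cannot drop. It is still attained because
  \<open>S\<close> lies on one side of \<open>X\<close>.\<close>

lemma min_cut_contract:
  assumes G: "hypergraph G"
    and min: "node_budgeted_min_cut G t w c b (cut G X)"
    and X: "X \<noteq> {}" "X \<subset> verts G" "feasible t w b X"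
    and S: "S \<subseteq> verts G" "S \<subseteq> X \<or> S \<inter> X = {}"
  shows "node_budgeted_min_cut (contract G S) t (contract_weights w S) c b (cut G X)"
proof (cases "S = {}")
  case True
  then show ?thesis using min by simp
next
  case False
  let ?u = "new_vertex S" and ?G = "contract G S"
  have u: "?u \<in> S" using False by (rule new_vertex_in)
  have fin: "finite (verts G)" using G by (simp add: hypergraph_def)
  define Y where "Y = (if S \<subseteq> X then insert ?u (X - S) else X)"
  have Y: "Y \<noteq> {}" "Y \<subset> verts ?G" "uncontract S Y = X"
  proof -
    \<comment> \<open>Properness of \<open>Y\<close>: if \<open>x\<close> lies in \<open>S\<close>,
      then \<open>S\<close> avoids \<open>X\<close> and the new vertex is the witness; otherwise
      \<open>x\<close> itself survives.\<close>
    obtain x where "x \<in> verts G - X" using X by blast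
    then have "x \<in> verts ?G - Y \<or> ?u \<in> verts ?G - Y"
      using S u by (auto simp: Y_def contract_simps[OF False])
    moreover have "Y \<subseteq> verts ?G"
      using X S u by (auto simp: Y_def contract_simps[OF False])
    ultimately show "Y \<subset> verts ?G" by blast
  qed (use X S u in \<open>auto simp: Y_def uncontract_def\<close>)
  have "cut ?G Y = cut G X" "feasible t (contract_weights w S) b Y"
    using Y X cut_contract[OF G S(1) False, of Y] feasible_contract[OF fin S(1) False, of Y]
    by auto
  moreover have "sum c (cut G X) \<le> sum c (cut ?G Z)"
    if Z: "Z \<noteq> {}" "Z \<subset> verts ?G" "feasible t (contract_weights w S) b Z" for Z
  proof -
    have ne: "uncontract S Z \<noteq> {}"
      using Z by (auto simp: uncontract_def)
    obtain x where "x \<in> verts ?G" "x \<notin> Z" using Z by blast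
    then have "x \<in> verts G - uncontract S Z" using Z S u
      by (auto simp: uncontract_def contract_simps[OF False])
    moreover have "uncontract S Z \<subseteq> verts G"
      using Z S u by (auto simp: uncontract_def contract_simps[OF False])
    ultimately have "uncontract S Z \<subset> verts G" by blast
    note ne this
    moreover have "feasible t w b (uncontract S Z)"
      using Z feasible_contract[OF fin S(1) False, of Z] by auto
    moreover have "cut ?G Z = cut G (uncontract S Z)"
      using Z cut_contract[OF G S(1) False, of Z] by auto
    ultimately show ?thesis using min by (simp add: node_budgeted_min_cut_def)
  qed
  ultimately show ?thesis
    unfolding node_budgeted_min_cut_def using Y(1,2) by metis
qed

text \<open>The second alternative in the last hypothesis also admits labels outside
  \<open>edges G\<close>. These arise in \<open>alg_M\<close> when the drawn hyperedge was deleted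
  by merging the infeasible vertices.\<close>

lemma min_cut_contract_edge:
  assumes G: "hypergraph G" and min: "node_budgeted_min_cut G t w c b F"
    and e: "inc G e \<subseteq> verts G" "e \<in> edges G - F \<or> card (inc G e) = 1"
  shows "node_budgeted_min_cut (contract G (inc G e)) t (contract_weights w (inc G e)) c b F"
proof -
  obtain X where X: "X \<noteq> {}" "X \<subset> verts G" "feasible t w b X" "F = cut G X"
    using min unfolding node_budgeted_min_cut_def by metis
  have "inc G e \<subseteq> X \<or> inc G e \<inter> X = {}"
  proof (cases "card (inc G e) = 1")
    case True
    then obtain v where "inc G e = {v}" by (auto simp: card_1_singleton_iff)
    then show ?thesis by auto
  next
    case False
    then have "e \<in> edges G" "e \<notin> cut G X" using e X(4) by auto
    then show ?thesis using e(1) by (auto simp: cut_def)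
  qed
  with min_cut_contract[OF G min[unfolded X(4)] X(1-3) e(1)] show ?thesis
    unfolding X(4) .
qed

section \<open>Averaging over degree cuts\<close>

text \<open>A feasible singleton cut costs at least \<open>c(F)\<close>; summing over \<open>U\<close> counts each hyperedge of
  size at least two once per vertex in \<open>U\<close>.\<close>

lemma min_cut_le_average_degree:
  fixes c :: "'e \<Rightarrow> real"
  assumes G: "hypergraph G" and c: "\<And>e. e \<in> edges G \<Longrightarrow> 0 < c e" and U: "U \<subseteq> verts G"
    and F: "\<And>v. v \<in> U \<Longrightarrow> sum c F \<le> sum c (cut G {v})"
  shows "card U * sum c F \<le> (\<Sum>e\<in>{e \<in> edges G. card (inc G e) \<noteq> 1}. c e * card (U \<inter> inc G e))"
proof -
  let ?E = "{e \<in> edges G. card (inc G e) \<noteq> 1}"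
  have fin: "finite U" "finite ?E" using G U by (auto simp: hypergraph_def intro: finite_subset)
  have "sum c F \<le> (\<Sum>e\<in>?E. if v \<in> inc G e then c e else 0)" if "v \<in> U" for v
  proof -
    have "sum c F \<le> sum c (cut G {v})" using F that by blast
    also have "\<dots> \<le> sum c {e \<in> ?E. v \<in> inc G e}"
    proof (rule sum_mono2)
      show "finite {e \<in> ?E. v \<in> inc G e}" by (rule finite_subset[OF _ fin(2)]) auto
    qed (auto simp: cut_def card_1_singleton_iff intro!: less_imp_le[OF c])
    also have "\<dots> = (\<Sum>e\<in>?E. if v \<in> inc G e then c e else 0)"
      by (rule sum.inter_filter[OF fin(2)])
    finally show ?thesis .
  qed
  then have "card U * sum c F \<le> (\<Sum>v\<in>U. \<Sum>e\<in>?E. if v \<in> inc G e then c e else 0)"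
    by (rule sum_bounded_below)
  also have "\<dots> = (\<Sum>e\<in>?E. \<Sum>v\<in>U. if v \<in> inc G e then c e else 0)"
    by (rule sum.swap)
  also have "\<dots> = (\<Sum>e\<in>?E. c e * card (U \<inter> inc G e))"
    using fin by (intro sum.cong) (simp_all flip: sum.inter_restrict add: mult.commute)
  finally show ?thesis .
qed

text \<open>Averaging step shared by both algorithms, with \<open>p e\<close> the success
  probability after drawing \<open>e\<close> and \<open>E2\<close> the hyperedges of size at least
  two. Up to the common factor 1 / r, \<open>avg\<close> bounds the total weight of
  \<open>E2\<close> by r * c(E2 - F), and \<open>large\<close> makes each hyperedge of
  \<open>E2 - F\<close> contribute at least r * q times its cost. This pays for all of
  \<open>E2\<close>, including the members of \<open>F\<close>, for which only nonnegativity of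
  \<open>p e\<close> is available. Outside \<open>E2\<close> the bound holds term by term.\<close>

lemma weighted_success_bound:
  fixes c k p :: "'e \<Rightarrow> real"
  assumes fin: "finite E" and c: "\<And>e. e \<in> E \<Longrightarrow> 0 < c e"
    and k: "\<And>e. e \<in> E \<Longrightarrow> 0 \<le> k e \<and> k e \<le> r" and p: "\<And>e. e \<in> E \<Longrightarrow> 0 \<le> p e"
    and r: "0 < r" and q: "0 \<le> q" and E2: "F \<subseteq> E2" "E2 \<subseteq> E"
    and avg: "r * sum c F \<le> (\<Sum>e\<in>E2. c e * k e)"
    and small: "\<And>e. e \<in> E - E2 \<Longrightarrow> k e < r \<Longrightarrow> q \<le> p e"
    and large: "\<And>e. e \<in> E2 - F \<Longrightarrow> r * q \<le> (r - k e) * p e"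
    and pos: "0 < (\<Sum>e\<in>E. (r - k e) / r * c e)"
  shows "q \<le> (\<Sum>e\<in>E. (r - k e) / r * c e * p e) / (\<Sum>e\<in>E. (r - k e) / r * c e)"
proof -
  have finE2: "finite E2" using E2 fin by (auto intro: finite_subset)
  have "q * (\<Sum>e\<in>E2. (r - k e) * c e) = q * (r * sum c E2 - (\<Sum>e\<in>E2. c e * k e))"
    by (simp add: sum_subtractf sum_distrib_left algebra_simps)
  also have "\<dots> \<le> q * (r * sum c E2 - r * sum c F)"
    using avg q by (intro mult_left_mono) auto
  also have "\<dots> = (\<Sum>e\<in>E2 - F. c e * (r * q))"
    using E2 finE2 by (simp add: sum_diff flip: sum_distrib_right) (simp add: algebra_simps)
  also have "\<dots> \<le> (\<Sum>e\<in>E2 - F. c e * ((r - k e) * p e))"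
    using E2 large by (intro sum_mono mult_left_mono) (auto intro!: less_imp_le[OF c])
  also have "\<dots> \<le> (\<Sum>e\<in>E2. c e * ((r - k e) * p e))"
    using finE2 E2 k p by (intro sum_mono2) (auto intro!: mult_nonneg_nonneg less_imp_le[OF c])
  finally have 1: "q * (\<Sum>e\<in>E2. (r - k e) * c e) \<le> (\<Sum>e\<in>E2. (r - k e) * c e * p e)"
    by (simp add: mult_ac)
  have "q * ((r - k e) * c e) \<le> (r - k e) * c e * p e" if "e \<in> E - E2" for e
  proof (cases "k e = r")
    case False
    then show ?thesis using small[OF that] k[of e] c[of e] that
      by (subst mult.commute, intro mult_left_mono) auto
  qed simp
  then have 2: "q * (\<Sum>e\<in>E - E2. (r - k e) * c e) \<le> (\<Sum>e\<in>E - E2. (r - k e) * c e * p e)"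
    unfolding sum_distrib_left by (rule sum_mono)
  have "q * (\<Sum>e\<in>E. (r - k e) * c e) \<le> (\<Sum>e\<in>E. (r - k e) * c e * p e)"
    using 1 2 sum.subset_diff[OF E2(2) fin, of "\<lambda>e. (r - k e) * c e"]
      sum.subset_diff[OF E2(2) fin, of "\<lambda>e. (r - k e) * c e * p e"]
    by (simp add: distrib_left)
  then have "q * (\<Sum>e\<in>E. (r - k e) / r * c e) \<le> (\<Sum>e\<in>E. (r - k e) / r * c e * p e)"
    using r by (simp add: divide_right_mono flip: sum_divide_distrib)
  then show ?thesis using pos by (simp add: pos_le_divide_eq)
qed

lemma two_le_card_verts:
  assumes "finite (verts G)" "node_budgeted_min_cut G t w c b F"
  shows "2 \<le> card (verts G)"
proof -
  obtain X where X: "X \<noteq> {}" "X \<subset> verts G"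
    using assms(2) unfolding node_budgeted_min_cut_def by metis
  then have "0 < card X" "card X < card (verts G)"
    using assms(1) by (auto simp: card_gt_0_iff intro: finite_subset psubset_card_mono)
  then show ?thesis by simp
qed

text \<open>Stated for arbitrary labels with a nonempty incidence set, because a label that the
  contraction deletes may still be the one whose image is contracted next.\<close>

lemma inc_contract:
  assumes "S \<subseteq> verts G" "inc G e \<subseteq> verts G" "inc G e \<noteq> {}"
  shows "inc (contract G S) e \<noteq> {}" "inc (contract G S) e \<subseteq> verts (contract G S)"
  using assms by (cases "S = {}"; auto simp: contract_simps split: if_splits)+

text \<open>The image of \<open>e\<close> is nonempty and is contained in the set contracted last,
  so \<open>e\<close> is gone even if \<open>S\<close> did not already absorb it. This is the
  termination measure of all inductions below; \<open>S = {}\<close> gives the recursion of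
  \<open>alg_H\<close>.\<close>

lemma card_edges_contract_less:
  assumes G: "hypergraph G" and e: "e \<in> edges G"
  shows "card (edges (contract (contract G S) (inc (contract G S) e))) < card (edges G)"
proof (rule psubset_card_mono)
  have ne: "inc (contract G S) e \<noteq> {}"
    using hypergraphD(3)[OF G e] by (cases "S = {}") (auto simp: contract_simps)
  then have "e \<notin> edges (contract (contract G S) (inc (contract G S) e))"
    by (simp add: contract_simps)
  moreover have "edges (contract (contract G S) (inc (contract G S) e)) \<subseteq> edges G"
    by (meson edges_contract_subset subset_trans)
  ultimately show "edges (contract (contract G S) (inc (contract G S) e)) \<subset> edges G"
    using e by blast
qed (use G in \<open>simp add: hypergraph_def\<close>)

section \<open>Ordinary min-cuts by random contraction\<close>

text \<open>With \<open>t = 0\<close> every vertex set is feasible, so unconstrained min-cuts reuse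
  the budgeted notions and contraction lemmas. The bound is the classical 1 / (n choose 2): a
  hyperedge of size k outside \<open>F\<close> leaves n - k + 1 vertices, and its weight factor n -
  k cancels in the induction hypothesis, leaving 2 / (n - k + 1), which is at least 2 / (n - 1) for
  k at least two.\<close>

lemma alg_H_min_cut:
  fixes G :: "('v, 'e) hypergraph"
  assumes "problem_instance G 0 w c b" "node_budgeted_min_cut G 0 w c b F"
  shows "2 / (real (card (verts G)) * (real (card (verts G)) - 1)) \<le> spmf (alg_H G c) F"
  using assms
proof (induction "card (edges G)" arbitrary: G w rule: less_induct)
  case less
  note inst = less.prems(1) and min = less.prems(2)
  have G: "hypergraph G" and c: "\<And>e. e \<in> edges G \<Longrightarrow> 0 < c e"
    using inst by (auto simp: problem_instance_def)
  note fin = hypergraphD(1,2)[OF G]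
  define n where "n = card (verts G)"
  have n2: "2 \<le> n" using two_le_card_verts[OF fin(1) min] by (simp add: n_def)
  obtain X where X: "X \<noteq> {}" "X \<subset> verts G" "F = cut G X"
    using min unfolding node_budgeted_min_cut_def by metis
  have k: "card (inc G e) \<le> n" if "e \<in> edges G" for e
    unfolding n_def using hypergraphD(4)[OF G that] fin by (simp add: card_mono)
  \<comment> \<open>A hyperedge containing all vertices is cut by every nonempty proper subset.
    Hence at termination \<open>F\<close> is the whole edge set, and for hyperedges outside
    \<open>F\<close> the factor to be cancelled is nonzero.\<close>
  have spanning: "e \<in> F" if "e \<in> edges G" "card (inc G e) = n" for e
  proof -
    have "inc G e = verts G"
      using that hypergraphD(4)[OF G that(1)] fin by (simp add: card_subset_eq n_def)
    then show ?thesis using X that by (auto simp: cut_def)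
  qed
  define \<beta> where "\<beta> = (\<lambda>e. (real n - real (card (inc G e))) / real n * c e)"
  have alg: "alg_H G c = (if \<forall>e\<in>edges G. \<beta> e = 0 then return_spmf (edges G)
      else bind_pmf (proportional_pmf (edges G) \<beta>) (\<lambda>e. alg_H (contract G (inc G e)) c))"
    by (subst alg_H.simps) (simp only: Let_def \<beta>_def n_def)
  show ?case
  proof (cases "\<forall>e\<in>edges G. \<beta> e = 0")
    case True
    then have "card (inc G e) = n" if "e \<in> edges G" for e
      using that c[OF that] n2 by (fastforce simp: \<beta>_def)
    then have "F = edges G" using spanning X(3) by (auto simp: cut_def)
    moreover have "alg_H G c = return_spmf (edges G)"
      using True by (simp add: alg)
    moreover have "2 / (real n * (real n - 1)) \<le> 1"
      using n2 mult_mono[of 2 "real n" 1 "real n - 1"] by simp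
    ultimately show ?thesis by (simp add: n_def)
  next
    case False
    let ?p = "\<lambda>e. spmf (alg_H (contract G (inc G e)) c) F"
    have \<beta>0: "0 \<le> \<beta> e" if "e \<in> edges G" for e
      using k[OF that] c[OF that] by (simp add: \<beta>_def)
    have pos: "0 < sum \<beta> (edges G)"
      using False sum_nonneg_eq_0_iff[OF fin(2) \<beta>0] sum_nonneg[of "edges G" \<beta>] \<beta>0 by fastforce
    have "spmf (alg_H G c) F = (\<Sum>e\<in>edges G. \<beta> e * ?p e) / sum \<beta> (edges G)"
      using spmf_bind_proportional_pmf[OF fin(2) \<beta>0 pos] False by (simp add: alg if_not_P)
    moreover have IH: "2 / ((real n - card (inc G e) + 1) * (real n - card (inc G e))) \<le> ?p e"
      if e: "e \<in> edges G" "card (inc G e) = 1 \<or> e \<notin> F" for e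
    proof -
      let ?G = "contract G (inc G e)"
      have inc: "inc G e \<subseteq> verts G" "inc G e \<noteq> {}" using hypergraphD[OF G] e by auto
      have "card (edges ?G) < card (edges G)"
        using card_edges_contract_less[OF G e(1), of "{}"] by simp
      moreover have "problem_instance ?G 0 (contract_weights w (inc G e)) c b"
        using problem_instance_contract[OF inst inc(1)] .
      moreover have "node_budgeted_min_cut ?G 0 (contract_weights w (inc G e)) c b F"
        using min_cut_contract_edge[OF G min inc(1)] e by blast
      ultimately have "2 / (real (card (verts ?G)) * (real (card (verts ?G)) - 1)) \<le> ?p e"
        by (rule less.hyps)
      moreover have "real (card (verts ?G)) = real n - card (inc G e) + 1"
        using card_verts_contract[OF fin(1) inc] unfolding n_def by linarith
      ultimately show ?thesis by simp
    qed
    moreover have "2 / (real n * (real n - 1)) \<le>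
        (\<Sum>e\<in>edges G. \<beta> e * ?p e) / sum \<beta> (edges G)"
      unfolding \<beta>_def
    proof (rule weighted_success_bound[where F = F and ?E2.0 = "{e \<in> edges G. card (inc G e) \<noteq> 1}"])
      show "F \<subseteq> {e \<in> edges G. card (inc G e) \<noteq> 1}"
        unfolding X(3) by (auto simp: cut_def card_1_singleton_iff)
      have "sum c F \<le> sum c (cut G {v})" if "v \<in> verts G" for v
      proof -
        have "{v} \<noteq> verts G"
        proof
          assume "{v} = verts G"
          from this[symmetric] n2 show False by (simp add: n_def)
        qed
        then have "{v} \<subset> verts G" using that by blast
        then show ?thesis using min by (simp add: node_budgeted_min_cut_def feasible_def)
      qed
      from min_cut_le_average_degree[OF G c subset_refl this]
      have "n * sum c F \<le> (\<Sum>e\<in>{e \<in> edges G. card (inc G e) \<noteq> 1}. c e * card (verts G \<inter> inc G e))"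
        by (simp add: n_def)
      also have "\<dots> = (\<Sum>e\<in>{e \<in> edges G. card (inc G e) \<noteq> 1}. c e * card (inc G e))"
        using hypergraphD(4)[OF G] by (intro sum.cong) (auto simp: Int_absorb1)
      finally show "n * sum c F \<le> (\<Sum>e\<in>{e \<in> edges G. card (inc G e) \<noteq> 1}. c e * card (inc G e))" .
      show "2 / (real n * (real n - 1)) \<le> ?p e"
        if "e \<in> edges G - {e \<in> edges G. card (inc G e) \<noteq> 1}" for e
        using IH[of e] that by simp
      show "real n * (2 / (real n * (real n - 1))) \<le> (real n - card (inc G e)) * ?p e"
        if e: "e \<in> {e \<in> edges G. card (inc G e) \<noteq> 1} - F" for e
      proof -
        have "finite (inc G e)" "inc G e \<noteq> {}"
          using e hypergraphD(3,4)[OF G, of e] fin by (auto intro: finite_subset)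
        then have "card (inc G e) \<noteq> 0" by simp
        then have k2: "2 \<le> card (inc G e)" "card (inc G e) < n"
        proof -
          have "e \<in> edges G" "e \<notin> F" "card (inc G e) \<noteq> 1" using e by simp_all
          moreover from this have "card (inc G e) \<noteq> n" using spanning by blast
          ultimately show "2 \<le> card (inc G e)" "card (inc G e) < n"
            using k[of e] \<open>card (inc G e) \<noteq> 0\<close> by linarith+
        qed
        have "real n * (2 / (real n * (real n - 1))) \<le> 2 / (real n - card (inc G e) + 1)"
          using k2 by (simp add: frac_le)
        also have "\<dots> = (real n - card (inc G e)) *
            (2 / ((real n - card (inc G e) + 1) * (real n - card (inc G e))))"
        proof -
          have "2 / (x + 1) = x * (2 / ((x + 1) * x))" if "0 < x" for x :: real
            using that by (simp add: divide_simps)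
          then show ?thesis using k2 by (metis diff_gt_0_iff_gt of_nat_less_iff)
        qed
        also have "\<dots> \<le> (real n - card (inc G e)) * ?p e"
          using k2 IH[of e] e by (intro mult_left_mono) auto
        finally show ?thesis .
      qed
      show "0 < (\<Sum>e\<in>edges G. (real n - card (inc G e)) / real n * c e)"
        using pos by (simp add: \<beta>_def)
    qed (use n2 fin c k in auto)
    ultimately show ?thesis by (simp add: n_def)
  qed
qed

section \<open>Estimates for the success bound\<close>

lemma Q_eq:
  assumes "3 \<le> n"
  shows "Q n = 2 / (3 * ((real n - 1) * (real n - 2)))"
proof -
  obtain m where n: "n = m + 3" using assms by (metis add.commute le_Suc_ex)
  have "real ((m + 2) choose 2) = (real m + 2) * (real m + 1) / 2"
    by (simp add: choose_two real_of_nat_div algebra_simps)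
  then show ?thesis by (simp add: Q_def n divide_simps) (simp add: algebra_simps)
qed

lemma Q_nonneg: "0 \<le> Q n"
  by (simp add: Q_def)

lemma Q_antimono:
  assumes "2 \<le> m" "m \<le> n"
  shows "Q n \<le> Q m"
proof -
  consider "n = 2" | "m = 2" "3 \<le> n" | "3 \<le> m" "3 \<le> n" using assms by linarith
  then show ?thesis
  proof cases
    case 2
    have "2 / (3 * ((real n - 1) * (real n - 2))) \<le> 1"
      using 2 mult_mono[of 2 "real n - 1" 1 "real n - 2"] by simp
    then show ?thesis using 2 by (simp add: Q_eq Q_def[of 2])
  next
    case 3
    then show ?thesis using assms(2) unfolding Q_eq[OF 3(1)] Q_eq[OF 3(2)]
      by (intro divide_left_mono mult_left_mono mult_mono mult_pos_pos) auto
  qed (use assms in simp)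
qed

lemma Q_le_1: "2 \<le> n \<Longrightarrow> Q n \<le> 1"
  using Q_antimono[of 2 n] by (simp add: Q_def[of 2])

text \<open>Pays for the switch to \<open>alg_H\<close> on \<open>m\<close> vertices. For n at least
  3 it comes down to n <= 3 * (n - 2), with equality at n = 3.\<close>

lemma Q_le_alg_H_bound:
  assumes "2 \<le> m" "m \<le> n"
  shows "Q n \<le> 2 / (real m * (real m - 1))"
proof (cases "3 \<le> n")
  case True
  have "real m * (real m - 1) \<le> real n * (real n - 1)"
    using assms by (intro mult_mono) auto
  also have "\<dots> \<le> (3 * (real n - 2)) * (real n - 1)"
    using True by (intro mult_right_mono) auto
  finally have "real m * (real m - 1) \<le> 3 * ((real n - 1) * (real n - 2))"
    by (simp add: algebra_simps)
  then show ?thesis using True assms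
    by (simp add: Q_eq) (intro divide_left_mono mult_pos_pos; simp)
next
  case False
  then have "n = 2" "m = 2" using assms by auto
  then show ?thesis by (simp add: Q_def)
qed

text \<open>\<open>r\<close> feasible vertices and one vertex for the merged infeasible ones make r
  + 1; the factor r then cancels against n - 1.\<close>

lemma mult_Q_Suc:
  assumes "2 \<le> r"
  shows "real r * Q (r + 1) = 2 / (3 * (real r - 1))"
  using assms by (simp add: Q_eq)

text \<open>Case of a hyperedge that meets the infeasible vertices and leaves \<open>j\<close>
  feasible ones outside: it is merged with the infeasible vertex, so j + 1 vertices remain. For j =
  1 the value \<open>Q 2 = 1\<close> is used; otherwise both sides have the form 2 / (3 * (x -
  1)).\<close>

lemma mult_Q_bound_outside:
  assumes "1 \<le> j" "j \<le> r" "2 \<le> r" "r + 1 \<le> n"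
  shows "real r * Q n \<le> real j * Q (j + 1)"
proof -
  have "real r * Q n \<le> 2 / (3 * (real r - 1))"
    using assms mult_Q_Suc[of r] Q_antimono[of "r + 1" n] mult_left_mono[of "Q n" "Q (r + 1)" r]
    by simp
  also have "\<dots> \<le> real j * Q (j + 1)"
  proof (cases "j = 1")
    case True
    then show ?thesis using assms by (simp add: Q_def)
  next
    case False
    then show ?thesis using assms unfolding mult_Q_Suc[of j]
      by (subst mult_Q_Suc) (auto intro!: divide_left_mono)
  qed
  finally show ?thesis .
qed

text \<open>Case of a hyperedge of at least two feasible vertices only, in the presence of
  infeasible ones: its contraction and the merged infeasible vertex stay distinct, so j + 2 vertices
  remain.\<close>

lemma mult_Q_bound_inside:
  assumes "1 \<le> j" "j + 2 \<le> r" "r + 1 \<le> n"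
  shows "real r * Q n \<le> real j * Q (j + 2)"
proof -
  have "real r * Q n \<le> 2 / (3 * (real r - 1))"
    using assms mult_Q_Suc[of r] Q_antimono[of "r + 1" n] mult_left_mono[of "Q n" "Q (r + 1)" r]
    by simp
  also have "\<dots> \<le> 2 / (3 * (real j + 1))"
    using assms by (intro divide_left_mono) auto
  also have "\<dots> = real j * Q (j + 2)"
    using assms by (simp add: Q_eq)
  finally show ?thesis .
qed

text \<open>Case without infeasible vertices: n = r, and contracting a hyperedge of size at least
  two leaves j + 1 vertices. The spare factor gained from an infeasible vertex is missing here,
  which makes this the tightest of the three estimates.\<close>

lemma mult_Q_bound_all_feasible:
  assumes "1 \<le> j" "j + 2 \<le> r"
  shows "real r * Q r \<le> real j * Q (j + 1)"
proof (cases "j = 1")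
  case True
  have "2 * real r \<le> 3 * ((real r - 1) * (real r - 2))"
  proof -
    \<comment> \<open>The product is exactly \<open>3 * (r - 1) * (r - 2) - 2 * r\<close>; its root
      r = 3 is the smallest admissible value and the case of equality.\<close>
    have "0 \<le> (real r - 3) * (3 * real r - 2)"
      using assms by (intro mult_nonneg_nonneg) auto
    then show ?thesis by (simp add: algebra_simps)
  qed
  then show ?thesis using True assms by (simp add: Q_eq Q_def[of "Suc (Suc 0)"] divide_simps)
next
  case False
  have "real r * (real j - 1) \<le> real r * (real r - 3)"
    using assms by (intro mult_left_mono) auto
  also have "\<dots> \<le> (real r - 1) * (real r - 2)"
    by (simp add: algebra_simps)
  finally have "2 * real r / (3 * ((real r - 1) * (real r - 2))) \<le> 2 / (3 * (real j - 1))"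
    using False assms by (simp add: divide_simps) (simp add: algebra_simps)
  then show ?thesis using False assms by (subst mult_Q_Suc) (auto simp: Q_eq)
qed

section \<open>Node-budgeted min-cuts by random contraction\<close>

lemma alg_M_min_cut:
  fixes G :: "('v, 'e) hypergraph"
  assumes "problem_instance G t w c b" "node_budgeted_min_cut G t w c b F"
  shows "Q (card (verts G)) \<le> spmf (alg_M G t w c b) (Cut F)"
  using assms
proof (induction "card (edges G)" arbitrary: G w rule: less_induct)
  case less
  note inst = less.prems(1) and min = less.prems(2)
  have G: "hypergraph G" and c: "\<And>e. e \<in> edges G \<Longrightarrow> 0 < c e"
    and w: "\<And>i v. i < t \<Longrightarrow> v \<in> verts G \<Longrightarrow> 0 \<le> w i v"
    using inst by (auto simp: problem_instance_def)
  note fin = hypergraphD(1,2)[OF G]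
  define n where "n = card (verts G)"
  have n2: "2 \<le> n" using two_le_card_verts[OF fin(1) min] by (simp add: n_def)
  obtain X where X: "X \<noteq> {}" "X \<subset> verts G" "feasible t w b X" "F = cut G X"
    using min unfolding node_budgeted_min_cut_def by metis
  define U where "U = {v \<in> verts G. feasible_vertex t w b v}"
  define W where "W = verts G - U"
  define \<alpha> where "\<alpha> = (\<lambda>e. real (card (U - inc G e)) / real (card U) * c e)"
  let ?G = "contract G W" and ?w = "contract_weights w W"
  let ?G2 = "\<lambda>e. contract ?G (inc ?G e)" and ?w2 = "\<lambda>e. contract_weights ?w (inc ?G e)"
  let ?p = "\<lambda>e. spmf (alg_M (?G2 e) t (?w2 e) c b) (Cut F)"
  have UV: "U \<subseteq> verts G" and WV: "W \<subseteq> verts G" by (auto simp: U_def W_def)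
  have finU: "finite U" and finX: "finite X" using UV X(2) fin by (auto intro: finite_subset)
  have XU: "X \<subseteq> U"
  proof
    fix v assume v: "v \<in> X"
    have "w i v \<le> b i" if "i < t" for i
    proof -
      have "w i v \<le> (\<Sum>u\<in>X. w i u)"
        using v finX X(2) w[OF that] by (intro member_le_sum) auto
      also have "\<dots> \<le> b i" using X(3) that by (simp add: feasible_def)
      finally show ?thesis .
    qed
    then show "v \<in> U" using v X(2) by (auto simp: U_def feasible_vertex_def)
  qed
  then have U: "U \<noteq> {}" and cardU: "0 < card U" using X(1) finU by (auto simp: card_gt_0_iff)
  have alg: "alg_M G t w c b =
      (if \<forall>e\<in>edges G. \<alpha> e = 0 then
          return_spmf (Cut (if feasible t w b U \<and> U \<noteq> verts G then cut G U else edges G))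
        else if feasible t w b U then map_spmf Cut (alg_H ?G c)
        else bind_pmf (proportional_pmf (edges G) \<alpha>) (\<lambda>e. alg_M (?G2 e) t (?w2 e) c b))"
    using U by (subst alg_M.simps) (simp only: Let_def \<alpha>_def U_def[symmetric] W_def if_False)
  have inst': "problem_instance ?G t ?w c b" using problem_instance_contract[OF inst WV] .
  then have G': "hypergraph ?G" by (simp add: problem_instance_def)
  have min': "node_budgeted_min_cut ?G t ?w c b F"
    using min_cut_contract[OF G min[unfolded X(4)] X(1-3) WV] XU unfolding X(4) W_def by blast
  \<comment> \<open>If \<open>X\<close> is a nonempty proper subset of \<open>U\<close>, a hyperedge
    covering \<open>U\<close> has vertices on both sides of \<open>X\<close>.\<close>
  have in_F: "e \<in> F" if "e \<in> edges G" "U \<subseteq> inc G e" "X \<noteq> U" for e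
  proof -
    have "inc G e \<inter> X \<noteq> {}" "inc G e \<inter> (verts G - X) \<noteq> {}" using that X(1) XU UV by blast+
    then show ?thesis using that(1) unfolding X(4) cut_def by blast
  qed
  show ?case
  proof (cases "\<forall>e\<in>edges G. \<alpha> e = 0")
    case True
    \<comment> \<open>Costs are positive, so a vanishing \<alpha> can only come from a hyperedge
      that covers \<open>U\<close>.\<close>
    have covered: "U \<subseteq> inc G e" if "e \<in> edges G" for e
      using True that c[OF that] cardU finU by (fastforce simp: \<alpha>_def)
    have "F = (if feasible t w b U \<and> U \<noteq> verts G then cut G U else edges G)"
    proof (cases "X = U")
      case True
      then show ?thesis using X by auto
    next
      case False
      then have F: "F = edges G" using covered in_F unfolding X(4) cut_def by blast
      \<comment> \<open>Here \<open>F\<close> consists of all hyperedges, and \<open>cut G U\<close>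
        is a competitor that costs no less; with positive costs it cannot omit any
        hyperedge.\<close>
      have "cut G U = edges G" if "feasible t w b U" "U \<noteq> verts G"
      proof (rule ccontr)
        assume "cut G U \<noteq> edges G"
        then obtain e where "e \<in> edges G - cut G U" by (auto simp: cut_def)
        then have "sum c (cut G U) < sum c (edges G)"
          using fin(2) c by (intro sum_strict_mono2) (auto simp: cut_def less_imp_le)
        moreover have "sum c F \<le> sum c (cut G U)"
          using min that U UV by (auto simp: node_budgeted_min_cut_def)
        ultimately show False using F by simp
      qed
      then show ?thesis using F by simp
    qed
    then show ?thesis using True Q_le_1[OF n2] by (simp add: alg n_def)
  next
    case not_all_0: False
    show ?thesis
    proof (cases "feasible t w b U")
      case True
      have feas: "feasible t ?w b Y" if "Y \<subseteq> U" for Y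
      proof -
        have "?w i v = w i v" if "v \<in> U" for i v
          using that new_vertex_in[of W] by (auto simp: contract_weights_def W_def)
        then have "sum (?w i) Y = sum (w i) Y" for i using that by (intro sum.cong) auto
        moreover have "sum (w i) Y \<le> sum (w i) U" if "i < t" for i
          using \<open>Y \<subseteq> U\<close> finU UV w[OF that] by (intro sum_mono2) auto
        ultimately show ?thesis using True by (fastforce simp: feasible_def)
      qed
      have "sum c F \<le> sum c (cut ?G Y)" if Y: "Y \<noteq> {}" "Y \<subset> verts ?G" for Y
      proof -
        \<comment> \<open>At most one vertex of \<open>?G\<close> lies outside \<open>U\<close>, so
          it belongs to only one of the two sides.\<close>
        have "Y \<subseteq> U \<or> verts ?G - Y \<subseteq> U"
        proof (cases "W = {}")
          case True
          then show ?thesis using Y UV by (auto simp: W_def)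
        next
          case False
          then have "verts ?G = insert (new_vertex W) U"
            using UV by (auto simp: contract_simps W_def)
          then show ?thesis using Y(2) by (cases "new_vertex W \<in> Y") auto
        qed
        then consider "feasible t ?w b Y" | "feasible t ?w b (verts ?G - Y)" using feas by blast
        then show ?thesis
        proof cases
          case 1
          then show ?thesis using min' Y by (simp add: node_budgeted_min_cut_def)
        next
          case 2
          have "verts ?G - Y \<noteq> {}" "verts ?G - Y \<subset> verts ?G" using Y by blast+
          then have "sum c F \<le> sum c (cut ?G (verts ?G - Y))"
            using min' 2 by (simp add: node_budgeted_min_cut_def)
          also have "cut ?G (verts ?G - Y) = cut ?G Y"
            using Y hypergraphD(4)[OF G'] by (auto simp: cut_def)
          finally show ?thesis .
        qed
      qed
      moreover obtain X' where "X' \<noteq> {}" "X' \<subset> verts ?G" "F = cut ?G X'"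
        using min' unfolding node_budgeted_min_cut_def by metis
      ultimately have "node_budgeted_min_cut ?G 0 ?w c b F"
        unfolding node_budgeted_min_cut_def feasible_def by auto
      moreover have "problem_instance ?G 0 ?w c b"
        using inst' by (simp add: problem_instance_def)
      ultimately have
        "2 / (real (card (verts ?G)) * (real (card (verts ?G)) - 1)) \<le> spmf (alg_H ?G c) F"
        by (intro alg_H_min_cut)
      moreover have "2 \<le> card (verts ?G)"
        using two_le_card_verts[OF hypergraphD(1)[OF G'] min'] .
      moreover have "card (verts ?G) \<le> n"
        unfolding n_def using verts_contract_subset[OF WV] fin by (simp add: card_mono)
      ultimately have "Q n \<le> spmf (alg_H ?G c) F"
        using Q_le_alg_H_bound order_trans by blast
      moreover have "spmf (map_spmf Cut (alg_H ?G c)) (Cut F) = spmf (alg_H ?G c) F"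
        by (rule spmf_map_inj') (simp add: inj_def)
      moreover have "alg_M G t w c b = map_spmf Cut (alg_H ?G c)"
        unfolding alg if_not_P[OF not_all_0] using True by simp
      ultimately show ?thesis by (simp add: n_def)
    next
      case False
      define r where "r = card U"
      define k where "k = (\<lambda>e. card (U \<inter> inc G e))"
      have XU': "X \<noteq> U" using False X(3) by blast
      have r2: "2 \<le> r"
      proof (rule ccontr)
        assume "\<not> 2 \<le> r"
        then have "card U = 1" using cardU by (simp add: r_def)
        then obtain v where "U = {v}" by (auto simp: card_1_singleton_iff)
        then show False using False by (auto simp: U_def feasible_def feasible_vertex_def)
      qed
      have kr: "k e \<le> r" for e unfolding k_def r_def using finU by (simp add: card_mono)
      have \<alpha>_eq: "\<alpha> = (\<lambda>e. (real r - real (k e)) / real r * c e)"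
      proof
        fix e
        have "card (U - inc G e) = r - k e"
          unfolding r_def k_def using finU by (simp add: card_Diff_subset_Int)
        then show "\<alpha> e = (real r - real (k e)) / real r * c e"
          using kr[of e] by (simp add: \<alpha>_def r_def of_nat_diff)
      qed
      have \<alpha>0: "0 \<le> \<alpha> e" if "e \<in> edges G" for e
        using c[OF that] by (simp add: \<alpha>_def)
      have pos: "0 < sum \<alpha> (edges G)"
        using not_all_0 sum_nonneg_eq_0_iff[OF fin(2) \<alpha>0] sum_nonneg[of "edges G" \<alpha>] \<alpha>0 by fastforce
      have "alg_M G t w c b =
          bind_pmf (proportional_pmf (edges G) \<alpha>) (\<lambda>e. alg_M (?G2 e) t (?w2 e) c b)"
        unfolding alg if_not_P[OF not_all_0] if_not_P[OF False] ..
      then have "spmf (alg_M G t w c b) (Cut F) =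
          (\<Sum>e\<in>edges G. \<alpha> e * ?p e) / sum \<alpha> (edges G)"
        using spmf_bind_proportional_pmf[OF fin(2) \<alpha>0 pos] by simp
      moreover have IH: "Q (card (verts (?G2 e))) \<le> ?p e \<and> 2 \<le> card (verts (?G2 e)) \<and>
          card (verts (?G2 e)) + card (inc ?G e) = card (verts ?G) + 1"
        if e: "e \<in> edges G" "card (inc G e) = 1 \<or> e \<notin> F" for e
      proof -
        have incG: "inc G e \<subseteq> verts G" "inc G e \<noteq> {}" using hypergraphD[OF G] e by auto
        note inc = inc_contract[OF WV incG]
        have "card (edges (?G2 e)) < card (edges G)"
          by (rule card_edges_contract_less[OF G e(1)])
        moreover have inst2: "problem_instance (?G2 e) t (?w2 e) c b"
          using problem_instance_contract[OF inst' inc(2)] .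
        \<comment> \<open>A hyperedge inside \<open>W\<close> is deleted, its image being the new
          vertex alone, and a singleton stays a singleton. In both cases contracting the image
          merges nothing, which keeps \<open>F\<close> a min-cut.\<close>
        moreover have "card (inc ?G e) = 1" if "e \<notin> edges ?G \<or> card (inc G e) = 1"
        proof -
          have "W \<noteq> {} \<and> inc G e \<subseteq> W \<or> (\<exists>v. inc G e = {v})"
            using that e(1) by (cases "W = {}") (auto simp: contract_simps card_1_singleton_iff)
          then show ?thesis using incG(2)
            by (cases "W = {}") (auto simp: contract_simps card_1_singleton_iff)
        qed
        then have min2: "node_budgeted_min_cut (?G2 e) t (?w2 e) c b F"
          using min_cut_contract_edge[OF G' min' inc(2)] e(2) by blast
        ultimately have "Q (card (verts (?G2 e))) \<le> ?p e"
          by (intro less.hyps)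
        moreover have "2 \<le> card (verts (?G2 e))"
          using two_le_card_verts[OF _ min2] inst2 by (auto simp: problem_instance_def hypergraph_def)
        moreover have "card (verts (?G2 e)) + card (inc ?G e) = card (verts ?G) + 1"
          using card_verts_contract[OF hypergraphD(1)[OF G'] inc(2,1)] .
        ultimately show ?thesis by blast
      qed
      moreover have "Q n \<le> (\<Sum>e\<in>edges G. \<alpha> e * ?p e) / sum \<alpha> (edges G)"
        unfolding \<alpha>_eq
      proof (rule weighted_success_bound[where F = F and ?E2.0 = "{e \<in> edges G. card (inc G e) \<noteq> 1}"])
        show "F \<subseteq> {e \<in> edges G. card (inc G e) \<noteq> 1}"
          unfolding X(4) by (auto simp: cut_def card_1_singleton_iff)
        have "sum c F \<le> sum c (cut G {v})" if v: "v \<in> U" for v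
        proof -
          have "{v} \<noteq> verts G"
          proof
            assume "{v} = verts G"
            from this[symmetric] n2 show False by (simp add: n_def)
          qed
          then have "{v} \<subset> verts G" using v UV by blast
          moreover have "feasible t w b {v}"
            using v by (simp add: U_def feasible_def feasible_vertex_def)
          ultimately show ?thesis using min by (simp add: node_budgeted_min_cut_def)
        qed
        from min_cut_le_average_degree[OF G c UV this]
        show "real r * sum c F \<le> (\<Sum>e\<in>{e \<in> edges G. card (inc G e) \<noteq> 1}. c e * real (k e))"
          by (simp add: r_def k_def)
        show "Q n \<le> ?p e" if "e \<in> edges G - {e \<in> edges G. card (inc G e) \<noteq> 1}" for e
        proof -
          have e: "e \<in> edges G" "card (inc G e) = 1" using that by auto
          have "card (verts (?G2 e)) \<le> n"
            unfolding n_def using e(1) hypergraphD(3,4)[OF G e(1)]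
            by (intro card_mono fin order_trans[OF verts_contract_subset[OF inc_contract(2)]]
                verts_contract_subset WV)
          then show ?thesis using IH[of e] e Q_antimono[of "card (verts (?G2 e))" n] by linarith
        qed
        show "real r * Q n \<le> (real r - real (k e)) * ?p e"
          if "e \<in> {e \<in> edges G. card (inc G e) \<noteq> 1} - F" for e
        proof -
          have e: "e \<in> edges G" "card (inc G e) \<noteq> 1" "e \<notin> F" using that by auto
          have inc: "inc G e \<subseteq> verts G" "inc G e \<noteq> {}" using hypergraphD[OF G] e by auto
          have fin_inc: "finite (inc G e)" using inc fin by (auto intro: finite_subset)
          have "card (inc G e) \<noteq> 0" using inc fin_inc by simp
          then have inc2: "2 \<le> card (inc G e)" using e(2) by linarith
          \<comment> \<open>\<open>j\<close> counts the feasible vertices outside \<open>e\<close>,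
            the factor by which the hyperedge is weighted. The cases below differ in what remains
            beside them: the contracted hyperedge, the merged infeasible vertices, or both fused
            into one.\<close>
          define j where "j = r - k e"
          have j: "real r - real (k e) = real j" using kr[of e] by (simp add: j_def)
          have "k e \<noteq> r"
          proof
            assume "k e = r"
            then have "U \<inter> inc G e = U" using finU by (simp add: k_def r_def card_subset_eq)
            then show False using in_F[OF e(1) _ XU'] e(3) by blast
          qed
          then have j1: "1 \<le> j" using kr[of e] by (simp add: j_def)
          note IH = IH[of e]
          have "real r * Q n \<le> real j * Q (card (verts (?G2 e)))"
          proof (cases "W = {}")
            case True
            then have VU: "verts G = U" using UV by (auto simp: W_def)
            then have "k e = card (inc G e)" using inc by (simp add: k_def Int_absorb1)
            then have "card (verts (?G2 e)) = j + 1" "j + 2 \<le> r" "n = r"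
              using IH e True VU inc2 kr[of e] j1 by (auto simp: j_def r_def n_def)
            then show ?thesis using mult_Q_bound_all_feasible[of j r] j1 by simp
          next
            case W: False
            have "verts ?G = insert (new_vertex W) U" "new_vertex W \<notin> U"
              unfolding contract_simps[OF W] using UV new_vertex_in[OF W] by (auto simp: W_def)
            then have cV: "card (verts ?G) = r + 1" using finU by (simp add: r_def)
            have rn: "r + 1 \<le> n"
            proof -
              have "card (verts ?G) \<le> n"
                unfolding n_def using verts_contract_subset[OF WV] fin by (simp add: card_mono)
              then show ?thesis using cV by simp
            qed
            show ?thesis
            proof (cases "inc G e \<inter> W = {}")
              case True
              then have "inc G e \<subseteq> U" using inc by (auto simp: W_def)
              then have "k e = card (inc G e)" by (simp add: k_def Int_absorb1)
              moreover have "inc ?G e = inc G e" using True W by (simp add: contract_simps)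
              ultimately have "card (verts (?G2 e)) = j + 2" "j + 2 \<le> r"
                using IH e cV inc2 kr[of e] j1 by (auto simp: j_def)
              then show ?thesis using mult_Q_bound_inside[of j r n] j1 rn by simp
            next
              case False
              then have "inc ?G e = insert (new_vertex W) (U \<inter> inc G e)"
                using W inc by (auto simp: contract_simps W_def)
              then have "card (inc ?G e) = k e + 1"
                using finU \<open>new_vertex W \<notin> U\<close> by (simp add: k_def)
              then have "card (verts (?G2 e)) = j + 1" "j \<le> r"
                using IH e cV kr[of e] by (auto simp: j_def)
              then show ?thesis using mult_Q_bound_outside[of j r n] j1 rn r2 by simp
            qed
          qed
          also have "\<dots> \<le> real j * ?p e"
            using IH e by (intro mult_left_mono) auto
          finally show ?thesis using j by simp
        qed
        show "0 < (\<Sum>e\<in>edges G. (real r - real (k e)) / real r * c e)"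
          using pos by (simp add: \<alpha>_eq)
      qed (use r2 fin c kr Q_nonneg in auto)
      ultimately show ?thesis by (simp add: n_def)
    qed
  qed
qed

section \<open>Array assignments\<close>

text \<open>Triples for the toss-free fragment: the outcome is a point mass, so correctness and cost
  concern a single final store. Tosses are treated by couplings instead.\<close>

definition runs_to :: "com \<Rightarrow> store \<Rightarrow> nat \<Rightarrow> (store \<Rightarrow> bool) \<Rightarrow> bool" where
  "runs_to C s B P \<longleftrightarrow> (\<exists>s'. exec C s = return_spmf s' \<and> steps s' \<le> steps s + B \<and> P s')"

lemma store_simps [simp]:
  "nats (tick s) = nats s" "reals (tick s) = reals s" "steps (tick s) = Suc (steps s)"
  "nats (set_nat x a s) = (nats s)(x := a)" "reals (set_nat x a s) = reals s"
  "steps (set_nat x a s) = steps s"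
  "nats (set_real y a b r s) = nats s"
  "reals (set_real y a b r s) = (reals s)(y := (reals s y)(a := (reals s y a)(b := r)))"
  "steps (set_real y a b r s) = steps s"
  by (simp_all add: tick_def set_nat_def set_real_def)

lemma runs_to_Skip: "P (tick s) \<Longrightarrow> runs_to Skip s 1 P"
  by (simp add: runs_to_def)

lemma runs_to_SetNat: "P (tick (set_nat x (nval a s) s)) \<Longrightarrow> runs_to (SetNat x a) s 1 P"
  by (simp add: runs_to_def)

lemma runs_to_SetReal:
  "P (tick (set_real x (nval a s) (nval a' s) (rval r s) s)) \<Longrightarrow> runs_to (SetReal x a a' r) s 1 P"
  by (simp add: runs_to_def)

lemma runs_to_Seq:
  "runs_to C s B (\<lambda>s'. runs_to D s' B' P) \<Longrightarrow> runs_to (Seq C D) s (B + B') P"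
  by (force simp: runs_to_def)

lemma runs_to_Cond:
  "(bval p s \<Longrightarrow> runs_to C (tick s) B P) \<Longrightarrow> (\<not> bval p s \<Longrightarrow> runs_to D (tick s) B P) \<Longrightarrow>
    runs_to (Cond p C D) s (Suc B) P"
  by (auto simp: runs_to_def)

lemma runs_to_mono:
  "runs_to C s B P \<Longrightarrow> B \<le> B' \<Longrightarrow> (\<And>s'. P s' \<Longrightarrow> P' s') \<Longrightarrow> runs_to C s B' P'"
  by (fastforce simp: runs_to_def)

definition For :: "string \<Rightarrow> nexp \<Rightarrow> com \<Rightarrow> com" where
  "For x L C = Seq (SetNat x (NLit 0))
     (While (NLess (NVar x) L) (Seq C (SetNat x (NAdd (NVar x) (NLit 1)))))"

text \<open>Each round costs one test and one increment on top of the body, which explains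
  \<open>B + 2\<close>; the last summand 2 is the initialization and the failing test.\<close>

lemma runs_to_For:
  assumes init: "I 0 (tick (set_nat x 0 s))"
    and step: "\<And>k s. k < N \<Longrightarrow> I k s \<Longrightarrow>
      runs_to C (tick s) B (\<lambda>s'. I (Suc k) (tick (set_nat x (Suc (nats s' x)) s')))"
    and counter: "\<And>k s. k \<le> N \<Longrightarrow> I k s \<Longrightarrow> nats s x = k \<and> nval L s = N"
    and final: "\<And>s. I N s \<Longrightarrow> P (tick s)"
  shows "runs_to (For x L C) s (N * (B + 2) + 2) P"
proof -
  let ?C = "Seq C (SetNat x (NAdd (NVar x) (NLit 1)))"
  have loop: "runs_to (While (NLess (NVar x) L) ?C) s ((N - k) * (B + 2) + 1) P"
    if "k \<le> N" "I k s" for k s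
    using that
  proof (induction "N - k" arbitrary: k s)
    case 0
    then have "k = N" by simp
    then show ?case
      using counter[of k s] final[of s] 0 by (simp add: runs_to_def loop.simps)
  next
    case (Suc d)
    then have k: "k < N" by simp
    from step[OF k Suc.prems(2)] obtain s' where s': "exec C (tick s) = return_spmf s'"
      "steps s' \<le> Suc (steps s) + B" "I (Suc k) (tick (set_nat x (Suc (nats s' x)) s'))"
      by (auto simp: runs_to_def)
    let ?s = "tick (set_nat x (Suc (nats s' x)) s')"
    have "runs_to (While (NLess (NVar x) L) ?C) ?s ((N - Suc k) * (B + 2) + 1) P"
      using Suc k s' by (intro Suc.hyps(1)) auto
    moreover have "exec (While (NLess (NVar x) L) ?C) s = exec (While (NLess (NVar x) L) ?C) ?s"
      using counter[of k s] Suc.prems k s'(1) by (simp add: loop.simps[of _ _ s])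
    moreover have "N - k = Suc (N - Suc k)" using k by simp
    ultimately show ?case using s'(2) by (auto simp: runs_to_def)
  qed
  have "runs_to (For x L C) s (1 + (N * (B + 2) + 1)) P"
    unfolding For_def using loop[OF _ init] by (intro runs_to_Seq runs_to_SetNat) simp
  then show ?thesis by simp
qed

text \<open>The registers \<open>i\<close>, \<open>j\<close>, \<open>k\<close> are the loop counters of array assignments and carry no
  information between them.\<close>

definition models :: "(string \<Rightarrow> nat) \<Rightarrow> (string \<Rightarrow> nat \<Rightarrow> nat \<Rightarrow> real) \<Rightarrow> store \<Rightarrow> bool" where
  "models N M s \<longleftrightarrow> reals s = M \<and> (\<forall>x. x \<notin> {''i'', ''j'', ''k''} \<longrightarrow> nats s x = N x)"

lemma models_tick [simp]: "models N M (tick s) \<longleftrightarrow> models N M s"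
  by (simp add: models_def)

lemma models_set_nat: "models N M s \<Longrightarrow> models (N(x := a)) M (set_nat x a s)"
  by (auto simp: models_def)

type_synonym assignment = "string \<times> string \<times> string \<times> string \<times> bexp \<times> rexp"

text \<open>The assignment \<open>(A, I, J, K, p, r)\<close> sets \<open>A[i][j]\<close>, for \<open>i < I\<close> and \<open>j < J\<close>, to the sum of
  \<open>r\<close> over those \<open>k < K\<close> that satisfy \<open>p\<close>; the bounds are names of registers.\<close>

fun assign_com :: "assignment \<Rightarrow> com" where
  "assign_com (A, I, J, K, p, r) =
    For ''i'' (NVar I) (For ''j'' (NVar J)
      (Seq (SetReal A (NVar ''i'') (NVar ''j'') (RLit 0))
        (For ''k'' (NVar K)
          (Cond p (SetReal A (NVar ''i'') (NVar ''j'') (RAdd (RGet A (NVar ''i'') (NVar ''j'')) r))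
            Skip))))"

text \<open>A canonical store for evaluating guards and summands at given indices. Their values do
  not depend on the step counter, which is set to 0.\<close>

definition index_store ::
  "(string \<Rightarrow> nat) \<Rightarrow> (string \<Rightarrow> nat \<Rightarrow> nat \<Rightarrow> real) \<Rightarrow> nat \<Rightarrow> nat \<Rightarrow> nat \<Rightarrow> store" where
  "index_store N M i j k =
     \<lparr>nats = N(''i'' := i, ''j'' := j, ''k'' := k), reals = M, steps = 0\<rparr>"

lemma index_store_simps [simp]:
  "nats (index_store N M i j k) ''i'' = i" "nats (index_store N M i j k) ''j'' = j"
  "nats (index_store N M i j k) ''k'' = k"
  "x \<notin> {''i'', ''j'', ''k''} \<Longrightarrow> nats (index_store N M i j k) x = N x"
  "reals (index_store N M i j k) = M"
  by (simp_all add: index_store_def)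

text \<open>The right-hand side is evaluated in the arrays before the assignment, whereas the loops
  accumulate into \<open>A\<close> as they run. The two agree under \<open>assign_ok\<close>, which
  forbids guard and summand to read \<open>A\<close>.\<close>

fun assign_sem ::
  "(string \<Rightarrow> nat) \<Rightarrow> assignment \<Rightarrow> (string \<Rightarrow> nat \<Rightarrow> nat \<Rightarrow> real) \<Rightarrow>
    string \<Rightarrow> nat \<Rightarrow> nat \<Rightarrow> real" where
  "assign_sem N (A, I, J, K, p, r) M = M(A := \<lambda>i j. if i < N I \<and> j < N J
     then \<Sum>k<N K. if bval p (index_store N M i j k) then rval r (index_store N M i j k) else 0
     else M A i j)"

primrec arrays_rexp :: "rexp \<Rightarrow> string set" where
  "arrays_rexp (RLit k) = {}"
| "arrays_rexp (RGet x a a') = {x}"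
| "arrays_rexp (RAdd r r') = arrays_rexp r \<union> arrays_rexp r'"
| "arrays_rexp (RSub r r') = arrays_rexp r \<union> arrays_rexp r'"
| "arrays_rexp (RMul r r') = arrays_rexp r \<union> arrays_rexp r'"
| "arrays_rexp (RDiv r r') = arrays_rexp r \<union> arrays_rexp r'"

primrec arrays_bexp :: "bexp \<Rightarrow> string set" where
  "arrays_bexp (NLess a a') = {}"
| "arrays_bexp (RLess r r') = arrays_rexp r \<union> arrays_rexp r'"
| "arrays_bexp (Neg p) = arrays_bexp p"
| "arrays_bexp (Conj p p') = arrays_bexp p \<union> arrays_bexp p'"

fun assign_ok :: "assignment \<Rightarrow> bool" where
  "assign_ok (A, I, J, K, p, r) \<longleftrightarrow> A \<notin> arrays_bexp p \<union> arrays_rexp r \<and>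
     I \<notin> {''i'', ''j'', ''k''} \<and> J \<notin> {''i'', ''j'', ''k''} \<and> K \<notin> {''i'', ''j'', ''k''}"

lemma nval_cong: "nats s = nats s' \<Longrightarrow> nval a s = nval a s'"
  by (induction a) auto

lemma rval_cong:
  "nats s = nats s' \<Longrightarrow> (\<And>x. x \<in> arrays_rexp r \<Longrightarrow> reals s x = reals s' x) \<Longrightarrow> rval r s = rval r s'"
  by (induction r) (auto cong: nval_cong)

lemma bval_cong:
  "nats s = nats s' \<Longrightarrow> (\<And>x. x \<in> arrays_bexp p \<Longrightarrow> reals s x = reals s' x) \<Longrightarrow>
    bval p s \<longleftrightarrow> bval p s'"
proof (induction p)
  case (NLess a a')
  then show ?case using nval_cong[of s s'] by simp
next
  case (RLess r r')
  then show ?case using rval_cong[of s s' r] rval_cong[of s s' r'] by simp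
qed auto

lemma runs_to_assign:
  assumes ok: "assign_ok a" and a: "a = (A, I, J, K, p, r)" and s: "models N M s"
    and L: "N I \<le> L" "N J \<le> L" "N K \<le> L" "1 \<le> L"
  shows "runs_to (assign_com a) s (15 * L ^ 3) (models N (assign_sem N a M))"
proof -
  (* Hiding the literals keeps the classical reasoner from splitting strings into characters. *)
  define ri rj rk where counters: "ri = ''i''" "rj = ''j''" "rk = ''k''"
  have distinct: "ri \<noteq> rj" "ri \<noteq> rk" "rj \<noteq> rk" "rj \<noteq> ri" "rk \<noteq> ri" "rk \<noteq> rj"
    by (simp_all add: counters)
  note models_iff = models_def[folded counters]
  note index_store = index_store_def[folded counters]
  define f where "f = (\<lambda>i j k. if bval p (index_store N M i j k)
    then rval r (index_store N M i j k) else 0)"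
  define g where "g = (\<lambda>i j. \<Sum>k<N K. f i j k)"
  have regs: "I \<noteq> ri" "I \<noteq> rj" "I \<noteq> rk" "J \<noteq> ri" "J \<noteq> rj" "J \<noteq> rk" "K \<noteq> ri" "K \<noteq> rj" "K \<noteq> rk"
    and A: "A \<notin> arrays_bexp p" "A \<notin> arrays_rexp r"
    using ok unfolding a counters by simp_all
  \<comment> \<open>All stores reached differ from the original arrays only in \<open>A\<close>, so
    every evaluation can be moved back to \<open>M\<close>.\<close>
  have eval: "(bval p s' \<longleftrightarrow> bval p (index_store N M i j k)) \<and>
      rval r s' = rval r (index_store N M i j k)"
    if s': "models N (M(A := h)) s'" "nats s' ri = i" "nats s' rj = j" "nats s' rk = k"
    for s' h i j k
  proof -
    have "nats s' = nats (index_store N M i j k)"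
      using s' by (auto simp: models_iff index_store)
    moreover have "reals s' x = reals (index_store N M i j k) x" if "x \<noteq> A" for x
      using s'(1) that by (simp add: models_iff index_store)
    ultimately show ?thesis using A
      bval_cong[of s' "index_store N M i j k" p] rval_cong[of s' "index_store N M i j k" r] by metis
  qed
  \<comment> \<open>The array in mid-computation: entries before (i, j) in lexicographic order are
    final, the entry (i, j) holds the partial sum \<open>u\<close>, and later entries are
    original.\<close>
  define h where "h = (\<lambda>i j u i' j'. if i' = i \<and> j' = j then u else
    if (i' < i \<and> j' < N J) \<or> (i' = i \<and> j' < j) then g i' j' else M A i' j')"
  have upd: "(h i j u)(i := (h i j u i)(j := v)) = h i j v" for i j u v
    by (auto simp: h_def fun_eq_iff)
  let ?T = "\<lambda>i j u s'. models N (M(A := h i j u)) s' \<and> nats s' ri = i \<and> nats s' rj = j"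
  let ?set = "SetReal A (NVar ri) (NVar rj) (RAdd (RGet A (NVar ri) (NVar rj)) r)"
  have inner: "runs_to (For rk (NVar K) (Cond p ?set Skip)) s' (N K * (2 + 2) + 2) (?T i j (g i j))"
    if "?T i j 0 s'" for i j s'
  proof (rule runs_to_For[where I = "\<lambda>k s'. ?T i j (\<Sum>k'<k. f i j k') s' \<and> nats s' rk = k"])
    show "?T i j (\<Sum>k'<0. f i j k') (tick (set_nat rk 0 s')) \<and> nats (tick (set_nat rk 0 s')) rk = 0"
      using that by (auto simp: models_iff distinct)
    fix k s' assume "k < N K" and s': "?T i j (\<Sum>k'<k. f i j k') s' \<and> nats s' rk = k"
    have ev: "(bval p s' \<longleftrightarrow> bval p (index_store N M i j k))"
      "rval r (tick s') = rval r (index_store N M i j k)"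
      using eval[of "h i j (\<Sum>k'<k. f i j k')" s' i j k]
        eval[of "h i j (\<Sum>k'<k. f i j k')" "tick (tick s')" i j k]
        eval[of "h i j (\<Sum>k'<k. f i j k')" "tick s'" i j k] s' by auto
    let ?P = "\<lambda>s'. ?T i j (\<Sum>k'<Suc k. f i j k') (tick (set_nat rk (Suc (nats s' rk)) s')) \<and>
      nats (tick (set_nat rk (Suc (nats s' rk)) s')) rk = Suc k"
    have hij: "h i j u i j = u" for u by (simp add: h_def)
    have ev': "bval p (tick s') \<longleftrightarrow> bval p (index_store N M i j k)"
      "rval r (tick (tick s')) = rval r (index_store N M i j k)"
      using eval[of "h i j (\<Sum>k'<k. f i j k')" "tick s'" i j k]
        eval[of "h i j (\<Sum>k'<k. f i j k')" "tick (tick s')" i j k] s' by auto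
    have "runs_to (Cond p ?set Skip) (tick s') (Suc 1) ?P"
    proof (rule runs_to_Cond)
      assume "bval p (tick s')"
      then have f: "f i j k = rval r (tick (tick s'))" using ev' by (simp add: f_def)
      show "runs_to ?set (tick (tick s')) 1 ?P"
        using s' f by (intro runs_to_SetReal) (auto simp: models_iff distinct hij upd)
    next
      assume "\<not> bval p (tick s')"
      then have f: "f i j k = 0" using ev' by (simp add: f_def)
      show "runs_to Skip (tick (tick s')) 1 ?P"
        using s' f by (intro runs_to_Skip) (auto simp: models_iff distinct)
    qed
    then show "runs_to (Cond p ?set Skip) (tick s') 2 ?P" by (simp add: numeral_2_eq_2)
  qed (use regs in \<open>auto simp: models_iff distinct g_def\<close>)
  \<comment> \<open>With entry (i, j) still untouched, completing an entry or a row becomes a mere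
    change of indices.\<close>
  let ?H = "\<lambda>i j. h i j (M A i j)"
  have init: "(?H i j)(i := (?H i j i)(j := 0)) = h i j 0" for i j
    by (auto simp: h_def fun_eq_iff)
  have next_col: "h i j (g i j) = ?H i (Suc j)" for i j
    by (auto simp: h_def fun_eq_iff less_Suc_eq)
  have next_row: "?H i (N J) = ?H (Suc i) 0" for i
    by (auto simp: h_def fun_eq_iff less_Suc_eq)
  let ?C = "Seq (SetReal A (NVar ri) (NVar rj) (RLit 0)) (For rk (NVar K) (Cond p ?set Skip))"
  have middle: "runs_to (For rj (NVar J) ?C) s' (N J * (1 + (N K * (2 + 2) + 2) + 2) + 2)
      (\<lambda>s'. models N (M(A := ?H (Suc i) 0)) s' \<and> nats s' ri = i)"
    if "models N (M(A := ?H i 0)) s'" "nats s' ri = i" for i s'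
  proof (rule runs_to_For[where I = "\<lambda>j. ?T i j (M A i j)"])
    fix j s' assume "j < N J" and s': "?T i j (M A i j) s'"
    show "runs_to ?C (tick s') (1 + (N K * (2 + 2) + 2))
      (\<lambda>s'. ?T i (Suc j) (M A i (Suc j)) (tick (set_nat rj (Suc (nats s' rj)) s')))"
    proof (intro runs_to_Seq runs_to_SetReal, rule runs_to_mono[OF inner[of i j]])
      show "?T i j 0 (tick (set_real A (nval (NVar ri) (tick s')) (nval (NVar rj) (tick s'))
          (rval (RLit 0) (tick s')) (tick s')))"
        using s' by (auto simp: models_iff distinct init)
      show "?T i (Suc j) (M A i (Suc j)) (tick (set_nat rj (Suc (nats s' rj)) s'))"
        if "?T i j (g i j) s'" for s'
        using that by (auto simp: models_iff distinct next_col)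
    qed simp
  qed (use that regs in \<open>auto simp: models_iff distinct next_row\<close>)
  have final: "M(A := ?H (N I) 0) = assign_sem N a M"
    unfolding a by (auto simp: h_def g_def f_def fun_eq_iff)
  have "runs_to (assign_com a) s (N I * (N J * (1 + (N K * (2 + 2) + 2) + 2) + 2 + 2) + 2)
      (models N (assign_sem N a M))"
    unfolding a assign_com.simps counters[symmetric]
  proof (rule runs_to_For[where I = "\<lambda>i s'. models N (M(A := ?H i 0)) s' \<and> nats s' ri = i"])
    have "?H 0 0 = M A" by (auto simp: h_def fun_eq_iff)
    then show "models N (M(A := ?H 0 0)) (tick (set_nat ri 0 s)) \<and>
        nats (tick (set_nat ri 0 s)) ri = 0"
      using s by (auto simp: models_iff distinct)
    fix i s' assume "i < N I" "models N (M(A := ?H i 0)) s' \<and> nats s' ri = i"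
    then show "runs_to (For rj (NVar J) ?C) (tick s') (N J * (1 + (N K * (2 + 2) + 2) + 2) + 2)
        (\<lambda>s'. models N (M(A := ?H (Suc i) 0)) (tick (set_nat ri (Suc (nats s' ri)) s')) \<and>
          nats (tick (set_nat ri (Suc (nats s' ri)) s')) ri = Suc i)"
      by (intro runs_to_mono[OF middle[of i]]) (auto simp: models_iff distinct)
  qed (use regs final a in \<open>auto simp: models_iff distinct\<close>)
  moreover have "N I * (N J * (1 + (N K * (2 + 2) + 2) + 2) + 2 + 2) + 2 \<le> 15 * L ^ 3"
  proof -
    have "N I * (N J * (1 + (N K * (2 + 2) + 2) + 2) + 2 + 2) + 2 \<le>
        L * (L * (1 + (L * (2 + 2) + 2) + 2) + 2 + 2) + 2"
      using L by (intro add_mono mult_mono) auto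
    also have "\<dots> = 4 * (L * L * L) + 5 * (L * L) + 4 * L + 2"
      by (simp add: algebra_simps)
    \<comment> \<open>15 = 4 + 5 + 4 + 2, each lower power being bounded by the cube.\<close>
    also have "\<dots> \<le> 15 * (L * L * L)"
    proof -
      have "L * L \<le> L * L * L" "L \<le> L * L" "1 \<le> L" using L(4) by auto
      then show ?thesis by linarith
    qed
    finally show ?thesis by (simp add: power3_eq_cube)
  qed
  ultimately show ?thesis by (rule runs_to_mono)
qed

primrec assigns_com :: "assignment list \<Rightarrow> com" where
  "assigns_com [] = Skip"
| "assigns_com (a # as) = Seq (assign_com a) (assigns_com as)"

fun assign_bounds :: "assignment \<Rightarrow> string set" where
  "assign_bounds (A, I, J, K, p, r) = {I, J, K}"

lemma runs_to_assigns:
  assumes "\<forall>a\<in>set as. assign_ok a \<and> (\<forall>x\<in>assign_bounds a. N x \<le> L)" "1 \<le> L" "models N M s"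
  shows "runs_to (assigns_com as) s (15 * length as * L ^ 3 + 1) (models N (fold (assign_sem N) as M))"
  using assms
proof (induction as arbitrary: M s)
  case Nil
  then show ?case using runs_to_Skip[of "models N M" s] by simp
next
  case (Cons a as)
  obtain A I J K p r where a: "a = (A, I, J, K, p, r)" by (cases a)
  have "runs_to (assign_com a) s (15 * L ^ 3) (models N (assign_sem N a M))"
    using Cons.prems a by (intro runs_to_assign[OF _ a]) auto
  then have "runs_to (assign_com a) s (15 * L ^ 3)
      (\<lambda>s'. runs_to (assigns_com as) s' (15 * length as * L ^ 3 + 1)
        (models N (fold (assign_sem N) (a # as) M)))"
    by (rule runs_to_mono) (use Cons in auto)
  from runs_to_Seq[OF this] show ?case by (simp add: algebra_simps)
qed

section \<open>Sampling by coin tosses\<close>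

text \<open>Accept index \<open>i\<close> with its share of the suffix sum; conditioned on
  rejection, the remaining indices keep their proportions.\<close>

lemma proportional_pmf_split:
  fixes a :: "nat \<Rightarrow> real"
  assumes a: "\<And>e. e < m \<Longrightarrow> 0 \<le> a e" and i: "i < m" and pos: "0 < sum a {i..<m}"
  shows "proportional_pmf {i..<m} a = bind_pmf (bernoulli_pmf (a i / sum a {i..<m}))
    (\<lambda>h. if h then return_pmf i else proportional_pmf {Suc i..<m} a)"
proof (rule pmf_eqI)
  fix e
  have sum: "sum a {i..<m} = a i + sum a {Suc i..<m}"
    using i by (simp add: sum.atLeast_Suc_lessThan)
  have rest: "0 \<le> sum a {Suc i..<m}" using a by (intro sum_nonneg) auto
  let ?p = "a i / sum a {i..<m}"
  have p: "0 \<le> ?p" "?p \<le> 1" using a[OF i] pos sum rest by (auto simp: divide_simps)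
  have lhs: "pmf (proportional_pmf {i..<m} a) e = (if e \<in> {i..<m} then a e / sum a {i..<m} else 0)"
    using a pos by (intro pmf_proportional_pmf) auto
  have rhs: "pmf (bind_pmf (bernoulli_pmf ?p)
      (\<lambda>h. if h then return_pmf i else proportional_pmf {Suc i..<m} a)) e =
      ?p * indicator {i} e + (1 - ?p) * pmf (proportional_pmf {Suc i..<m} a) e"
    using p by (simp add: pmf_bind mult.commute indicator_def)
  \<comment> \<open>If the remaining weights sum to zero, the inner \<open>proportional_pmf\<close>
    has no meaningful value, but then the bias is 1 and that branch has weight 0.\<close>
  have tail: "(1 - ?p) * pmf (proportional_pmf {Suc i..<m} a) e =
      (if e \<in> {Suc i..<m} then a e / sum a {i..<m} else 0)"
  proof (cases "sum a {Suc i..<m} = 0")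
    case True
    then have "a e = 0" if "e \<in> {Suc i..<m}"
      using that a sum_nonneg_eq_0_iff[of "{Suc i..<m}" a] by auto
    then show ?thesis using True sum pos by simp
  next
    case False
    then have "pmf (proportional_pmf {Suc i..<m} a) e =
        (if e \<in> {Suc i..<m} then a e / sum a {Suc i..<m} else 0)"
      using a rest by (intro pmf_proportional_pmf) auto
    moreover have "1 - ?p = sum a {Suc i..<m} / sum a {i..<m}"
      using sum pos by (simp add: divide_simps)
    ultimately show ?thesis using False by simp
  qed
  show "pmf (proportional_pmf {i..<m} a) e = pmf (bind_pmf (bernoulli_pmf ?p)
      (\<lambda>h. if h then return_pmf i else proportional_pmf {Suc i..<m} a)) e"
    unfolding lhs rhs tail using i by (cases "e = i") (auto simp: indicator_def)
qed

abbreviation arr1 :: "string \<Rightarrow> string \<Rightarrow> rexp" where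
  "arr1 X x \<equiv> RGet X (NVar x) (NLit 0)"

abbreviation arr2 :: "string \<Rightarrow> string \<Rightarrow> string \<Rightarrow> rexp" where
  "arr2 X x y \<equiv> RGet X (NVar x) (NVar y)"

abbreviation scalar :: "string \<Rightarrow> rexp" where
  "scalar X \<equiv> RGet X (NLit 0) (NLit 0)"

abbreviation always :: bexp where
  "always \<equiv> NLess (NLit 0) (NLit 1)"

abbreviation is_pos :: "rexp \<Rightarrow> bexp" where
  "is_pos r \<equiv> RLess (RLit 0) r"

text \<open>The increment \<open>1 - h\<close> leaves \<open>x\<close> in place after heads, so at
  exit \<open>x\<close> names the drawn hyperedge. The loop ends because at the last positive weight
  the suffix sum equals the weight and the bias is 1.\<close>

definition draw_com :: com where
  "draw_com = Seq (SetNat ''h'' (NLit 0)) (Seq (SetNat ''x'' (NLit 0))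
     (While (NLess (NVar ''h'') (NLit 1))
       (Seq (Toss ''h'' (RDiv (arr1 ''alpha'' ''x'') (arr1 ''suf'' ''x'')))
         (SetNat ''x'' (NAdd (NVar ''x'') (NSub (NLit 1) (NVar ''h'')))))))"

text \<open>Positivity of the current suffix sum is the invariant that makes the bias meaningful. A
  round takes three steps: test, toss and update.\<close>

lemma draw_loop:
  fixes M :: "string \<Rightarrow> nat \<Rightarrow> nat \<Rightarrow> real"
  defines "a \<equiv> \<lambda>e. M ''alpha'' e 0"
  assumes a: "\<And>e. e < m \<Longrightarrow> 0 \<le> a e"
    and suf: "\<And>e. e < m \<Longrightarrow> M ''suf'' e 0 = sum a {e..<m}"
    and pos: "0 < sum a {i..<m}"
    and s: "models (N(''x'' := i, ''h'' := 0)) M s"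
  shows "rel_spmf (\<lambda>e s'. e < m \<and> 0 < a e \<and> models (N(''x'' := e, ''h'' := 1)) M s' \<and>
      steps s' \<le> steps s + 3 * (m - i) + 1)
    (spmf_of_pmf (proportional_pmf {i..<m} a))
    (exec (While (NLess (NVar ''h'') (NLit 1))
       (Seq (Toss ''h'' (RDiv (arr1 ''alpha'' ''x'') (arr1 ''suf'' ''x'')))
         (SetNat ''x'' (NAdd (NVar ''x'') (NSub (NLit 1) (NVar ''h'')))))) s)"
  using pos s
proof (induction "m - i" arbitrary: i s)
  case 0
  then show ?case by simp
next
  case (Suc d)
  let ?body = "Seq (Toss ''h'' (RDiv (arr1 ''alpha'' ''x'') (arr1 ''suf'' ''x'')))
         (SetNat ''x'' (NAdd (NVar ''x'') (NSub (NLit 1) (NVar ''h''))))"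
  let ?W = "While (NLess (NVar ''h'') (NLit 1)) ?body"
  from Suc have i: "i < m" by simp
  have s: "nats s ''h'' = 0" "nats s ''x'' = i" "reals s = M"
    using Suc.prems(2) by (simp_all add: models_def)
  let ?p = "a i / sum a {i..<m}"
  define next_store where "next_store = (\<lambda>h. tick (set_nat ''x'' (i + (1 - of_bool h))
    (tick (set_nat ''h'' (of_bool h) (tick s)))))"
  have "exec ?W s = bind_pmf (bernoulli_pmf ?p) (\<lambda>h. exec ?W (next_store h))"
    using s suf[OF i] by (simp add: loop.simps[of _ _ s] bind_spmf_def bind_assoc_pmf bind_return_pmf next_store_def a_def)
  moreover have "spmf_of_pmf (proportional_pmf {i..<m} a) = bind_pmf (bernoulli_pmf ?p)
      (\<lambda>h. if h then return_spmf i else spmf_of_pmf (proportional_pmf {Suc i..<m} a))"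
    unfolding spmf_of_pmf_def
    by (subst proportional_pmf_split[of m a i, OF a i Suc.prems(1)])
      (auto simp: map_bind_pmf intro!: bind_pmf_cong)
  moreover have p: "0 \<le> ?p" "?p \<le> 1" "sum a {i..<m} = a i + sum a {Suc i..<m}"
  proof -
    show sum: "sum a {i..<m} = a i + sum a {Suc i..<m}"
      using i by (simp add: sum.atLeast_Suc_lessThan)
    have "0 \<le> sum a {Suc i..<m}" using a by (intro sum_nonneg) auto
    then show "0 \<le> ?p" "?p \<le> 1" using a[OF i] Suc.prems(1) sum by (auto simp: divide_simps)
  qed
  have "rel_spmf (\<lambda>e s'. e < m \<and> 0 < a e \<and> models (N(''x'' := e, ''h'' := 1)) M s' \<and>
      steps s' \<le> steps s + 3 * (m - i) + 1)
      (if h then return_spmf i else spmf_of_pmf (proportional_pmf {Suc i..<m} a))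
      (exec ?W (next_store h))" if h: "h \<in> set_pmf (bernoulli_pmf ?p)" for h
  proof (cases h)
    case True
    then have "0 < ?p" using h p by (auto simp: set_pmf_iff less_le split: if_splits)
    then have "0 < a i" using Suc.prems(1) by (simp add: zero_less_divide_iff)
    moreover have "models (N(''x'' := i, ''h'' := 1)) M (next_store True)"
      using Suc.prems(2) by (simp add: next_store_def models_def)
    moreover have "steps (next_store True) = steps s + 3" by (simp add: next_store_def)
    moreover have "nats (next_store True) ''h'' = 1" by (simp add: next_store_def)
    ultimately show ?thesis using True i by (simp add: loop.simps[of _ _ "next_store True"])
  next
    case False
    \<comment> \<open>Tails is possible only if \<open>a i\<close> is not the whole suffix sum, so
      the invariant survives.\<close>
    then have "?p \<noteq> 1" using h p by (auto simp: set_pmf_iff)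
    then have "0 < sum a {Suc i..<m}"
      using p(3) Suc.prems(1) a sum_nonneg[of "{Suc i..<m}" a] by (fastforce simp: less_le)
    moreover have "models (N(''x'' := Suc i, ''h'' := 0)) M (next_store False)"
      using Suc.prems(2) by (simp add: next_store_def models_def)
    moreover have "d = m - Suc i" using Suc.hyps(2) by simp
    ultimately have "rel_spmf (\<lambda>e s'. e < m \<and> 0 < a e \<and> models (N(''x'' := e, ''h'' := 1)) M s' \<and>
        steps s' \<le> steps (next_store False) + 3 * (m - Suc i) + 1)
        (spmf_of_pmf (proportional_pmf {Suc i..<m} a)) (exec ?W (next_store False))"
      using Suc.hyps(1) by blast
    moreover have "steps (next_store False) = steps s + 3" by (simp add: next_store_def)
    moreover have "m - i = Suc (m - Suc i)" using i by simp
    ultimately show ?thesis using False by (simp add: add.assoc)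
  qed
  ultimately show ?case
    \<comment> \<open>Both sides share the toss. Recording that the outcome lies in the support is
      what justifies the positivity arguments in the two branches.\<close>
    by (simp only:) (rule rel_pmf_bindI[where R = "\<lambda>x y. x = y \<and> x \<in> set_pmf (bernoulli_pmf ?p)"];
      auto intro!: rel_pmf_reflI)
qed

lemma rel_spmf_draw:
  fixes M :: "string \<Rightarrow> nat \<Rightarrow> nat \<Rightarrow> real"
  assumes E: "E \<subseteq> {..<m}" and a: "\<And>e. e \<in> E \<Longrightarrow> 0 \<le> a e" and pos: "0 < sum a E"
    and alpha: "\<And>e. e < m \<Longrightarrow> M ''alpha'' e 0 = (if e \<in> E then a e else 0)"
    and suf: "\<And>e. e < m \<Longrightarrow> M ''suf'' e 0 = (\<Sum>k\<in>{e..<m}. M ''alpha'' k 0)"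
    and s: "models N M s"
  shows "rel_spmf (\<lambda>e s'. e \<in> E \<and> models (N(''x'' := e, ''h'' := 1)) M s' \<and>
      steps s' \<le> steps s + 3 * m + 3)
    (spmf_of_pmf (proportional_pmf E a)) (exec draw_com s)"
proof -
  let ?a = "\<lambda>e. M ''alpha'' e 0"
  have "sum ?a {..<m} = (\<Sum>e<m. if e \<in> E then a e else 0)"
    using alpha by (intro sum.cong) auto
  also have "\<dots> = sum a E"
    using E by (simp add: sum.inter_restrict[symmetric] Int_absorb1)
  finally have sum: "sum ?a {..<m} = sum a E" .
  \<comment> \<open>Rows of deleted hyperedges carry weight zero, so sampling over all
    \<open>m\<close> rows uses the same density as sampling over \<open>E\<close>.\<close>
  have "proportional_pmf E a = proportional_pmf {0..<m} ?a"
    unfolding proportional_pmf_def atLeast0LessThan sum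
    by (intro arg_cong[where f = embed_pmf] ext) (use E alpha in auto)
  moreover have "models (N(''x'' := 0, ''h'' := 0)) M
      (tick (set_nat ''x'' 0 (tick (set_nat ''h'' 0 s))))"
    using s by (simp add: models_def)
  then have "rel_spmf (\<lambda>e s'. e < m \<and> 0 < ?a e \<and> models (N(''x'' := e, ''h'' := 1)) M s' \<and>
      steps s' \<le> steps (tick (set_nat ''x'' 0 (tick (set_nat ''h'' 0 s)))) + 3 * (m - 0) + 1)
    (spmf_of_pmf (proportional_pmf {0..<m} ?a)) (exec draw_com s)"
    unfolding draw_com_def
    using draw_loop[of m M 0 N "tick (set_nat ''x'' 0 (tick (set_nat ''h'' 0 s)))"]
      a alpha suf pos sum by (simp add: lessThan_atLeast0)
  ultimately show ?thesis
    by (simp only:) (erule rel_spmf_mono, use alpha in \<open>auto split: if_splits\<close>)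
qed

section \<open>Contraction on arrays\<close>

fun assign_equation ::
  "(string \<Rightarrow> nat) \<Rightarrow> (string \<Rightarrow> nat \<Rightarrow> nat \<Rightarrow> real) \<Rightarrow> assignment \<Rightarrow> bool" where
  "assign_equation N M (A, I, J, K, p, r) \<longleftrightarrow> (\<forall>i<N I. \<forall>j<N J. M A i j =
     (\<Sum>k<N K. if bval p (index_store N M i j k) then rval r (index_store N M i j k) else 0))"

fun assign_reads :: "assignment \<Rightarrow> string set" where
  "assign_reads (A, I, J, K, p, r) = arrays_bexp p \<union> arrays_rexp r"

text \<open>No array is read before or during its own assignment, so whatever is read already has
  its final value.\<close>

primrec single_assignment :: "assignment list \<Rightarrow> bool" where
  "single_assignment [] \<longleftrightarrow> True"
| "single_assignment (a # as) \<longleftrightarrow> single_assignment as \<and> fst a \<notin> set (map fst as) \<and>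
     (\<forall>X \<in> assign_reads a. X \<notin> set (map fst (a # as)))"

lemma fold_assign_sem_other:
  "X \<notin> set (map fst as) \<Longrightarrow> fold (assign_sem N) as M X = M X"
  by (induction as arbitrary: M) auto

text \<open>In single-assignment form the final values of the arrays satisfy all assignments as
  simultaneous equations.\<close>

lemma assign_equation_fold:
  assumes "single_assignment as" "a \<in> set as"
  shows "assign_equation N (fold (assign_sem N) as M) a"
  using assms
proof (induction as arbitrary: M)
  case (Cons a' as)
  show ?case
  proof (cases "a = a'")
    case True
    obtain A I J K p r where a: "a = (A, I, J, K, p, r)" by (cases a)
    let ?M1 = "assign_sem N a M" and ?M = "fold (assign_sem N) as (assign_sem N a M)"
    have A: "?M A = ?M1 A"
      using Cons.prems(1) a unfolding True[symmetric] by (intro fold_assign_sem_other) simp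
    have reads: "?M X = M X" if "X \<in> assign_reads a" for X
      using Cons.prems(1) True that a
        fold_assign_sem_other[of X as N ?M1] by force
    have "bval p (index_store N ?M i j k) = bval p (index_store N M i j k)"
      "rval r (index_store N ?M i j k) = rval r (index_store N M i j k)" for i j k
      using reads a by (auto intro!: bval_cong rval_cong simp: index_store_def)
    then show ?thesis using A unfolding True[symmetric] by (simp add: a cong: if_cong)
  qed (use Cons in auto)
qed simp

text \<open>Needed for the rows of \<open>out\<close> from \<open>m\<close> on:
  \<open>result\<close> inspects every row, so these must keep their zeros.\<close>

lemma fold_assign_sem_outside:
  assumes "single_assignment as" "(A, I, J, K, p, r) \<in> set as" "\<not> (i < N I \<and> j < N J)"
  shows "fold (assign_sem N) as M A i j = M A i j"
  using assms
proof (induction as arbitrary: M)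
  case (Cons a as)
  show ?case
  proof (cases "a = (A, I, J, K, p, r)")
    case True
    then have "A \<notin> set (map fst as)" using Cons.prems(1) by (metis fst_conv single_assignment.simps(2))
    from fold_assign_sem_other[OF this] True Cons.prems(3) show ?thesis by auto
  next
    case False
    then have "A \<noteq> fst a" using Cons.prems by (force simp: image_iff)
    moreover have "assign_sem N a M A = M A" if "A \<noteq> fst a" using that by (cases a) auto
    ultimately show ?thesis using Cons False by simp
  qed
qed simp

section \<open>Array representation of an instance and its contraction\<close>

definition sizes :: "nat \<Rightarrow> nat \<Rightarrow> nat \<Rightarrow> (string \<Rightarrow> nat) \<Rightarrow> bool" where
  "sizes n m t N \<longleftrightarrow> N ''n'' = n \<and> N ''m'' = m \<and> N ''t'' = t \<and> N ''one'' = 1"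

text \<open>Row \<open>v\<close> of the arrays stands for the vertex \<open>\<psi> v\<close>. A renaming is needed since the name
  \<^const>\<open>new_vertex\<close> of a contracted set is unspecified, and the program keeps the least row.\<close>

definition represents ::
  "nat \<Rightarrow> nat \<Rightarrow> nat \<Rightarrow> (nat \<Rightarrow> real) \<Rightarrow> (nat \<Rightarrow> real) \<Rightarrow> (string \<Rightarrow> nat \<Rightarrow> nat \<Rightarrow> real) \<Rightarrow>
   nat set \<Rightarrow> (nat \<Rightarrow> nat) \<Rightarrow> (nat, nat) hypergraph \<Rightarrow> (nat \<Rightarrow> nat \<Rightarrow> real) \<Rightarrow> bool" where
  "represents n m t c b M A \<psi> G w \<longleftrightarrow>
     A \<subseteq> {..<n} \<and> bij_betw \<psi> A (verts G) \<and> edges G \<subseteq> {..<m} \<and>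
     (\<forall>v<n. M ''av'' v 0 = of_bool (v \<in> A)) \<and>
     (\<forall>e<m. M ''ae'' e 0 = of_bool (e \<in> edges G)) \<and>
     (\<forall>e<m. inc G e \<noteq> {} \<and> inc G e \<subseteq> verts G) \<and>
     (\<forall>e<m. \<forall>v<n. M ''inc'' e v = of_bool (v \<in> A \<and> \<psi> v \<in> inc G e)) \<and>
     (\<forall>i<t. \<forall>v\<in>A. M ''w'' i v = w i (\<psi> v)) \<and>
     (\<forall>e<m. M ''c'' e 0 = c e) \<and> (\<forall>i<t. M ''b'' i 0 = b i) \<and> (\<forall>e\<ge>m. M ''out'' e 0 = 0)"

lemma sum_marked:
  fixes x g :: "nat \<Rightarrow> real" and h :: "'v \<Rightarrow> real"
  assumes "A \<subseteq> {..<n}" "bij_betw \<psi> A V" "S \<subseteq> V"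
    and x: "\<And>v. v < n \<Longrightarrow> x v = of_bool (v \<in> A \<and> \<psi> v \<in> S)"
    and g: "\<And>v. v \<in> A \<Longrightarrow> g v = h (\<psi> v)"
  shows "(\<Sum>v<n. x v * g v) = sum h S"
proof -
  let ?B = "{v \<in> A. \<psi> v \<in> S}"
  have "(\<Sum>v<n. x v * g v) = (\<Sum>v<n. if v \<in> ?B then g v else 0)"
    using x by (intro sum.cong) auto
  also have "\<dots> = sum g ?B"
  proof -
    have "{..<n} \<inter> ?B = ?B" using assms(1) by auto
    then show ?thesis using sum.inter_restrict[of "{..<n}" g ?B] by simp
  qed
  also have "\<dots> = (\<Sum>v\<in>?B. h (\<psi> v))"
    using g by (intro sum.cong) auto
  also have "\<dots> = sum h S"
    using assms(2,3) by (intro sum.reindex_bij_betw) (fastforce simp: bij_betw_def inj_on_def)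
  finally show ?thesis .
qed

text \<open>\<open>S\<close> is the characteristic column of the set to contract. \<open>pre\<close>
  counts its earlier members, so \<open>rep\<close> marks the least one, the row that will stand for
  the new vertex. \<open>hit\<close> and \<open>rest\<close> count the vertices of a hyperedge
  inside and outside the set, and \<open>sw\<close> is the weight of the set. An empty set marks no
  row, so no case distinction is needed. All \<open>m\<close> incidence rows are updated, including
  those of deleted hyperedges, because such a row may be contracted next.\<close>

definition contract_calc :: "assignment list" where
  "contract_calc =
    [(''pre'', ''n'', ''one'', ''n'', NLess (NVar ''k'') (NVar ''i''), arr1 ''S'' ''k''),
     (''rep'', ''n'', ''one'', ''one'', Neg (is_pos (arr1 ''pre'' ''i'')), arr1 ''S'' ''i''),
     (''hit'', ''m'', ''one'', ''n'', always, RMul (arr1 ''S'' ''k'') (arr2 ''inc'' ''i'' ''k'')),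
     (''meets'', ''m'', ''one'', ''one'', is_pos (arr1 ''hit'' ''i''), RLit 1),
     (''rest'', ''m'', ''one'', ''n'', always,
        RMul (RSub (RLit 1) (arr1 ''S'' ''k'')) (arr2 ''inc'' ''i'' ''k'')),
     (''sw'', ''t'', ''one'', ''n'', always, RMul (arr1 ''S'' ''k'') (arr2 ''w'' ''i'' ''k'')),
     (''av2'', ''n'', ''one'', ''one'', always,
        RAdd (RSub (arr1 ''av'' ''i'') (arr1 ''S'' ''i'')) (arr1 ''rep'' ''i'')),
     (''ae2'', ''m'', ''one'', ''one'', is_pos (arr1 ''rest'' ''i''), arr1 ''ae'' ''i''),
     (''inc2'', ''m'', ''n'', ''one'', always,
        RAdd (RMul (arr2 ''inc'' ''i'' ''j'') (RSub (RLit 1) (arr1 ''S'' ''j'')))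
          (RMul (arr1 ''rep'' ''j'') (arr1 ''meets'' ''i''))),
     (''w2'', ''t'', ''n'', ''one'', always,
        RAdd (RMul (arr2 ''w'' ''i'' ''j'') (RSub (RLit 1) (arr1 ''rep'' ''j'')))
          (RMul (arr1 ''rep'' ''j'') (arr1 ''sw'' ''i'')))]"

text \<open>Kept apart from \<open>contract_calc\<close> because it overwrites arrays read there:
  each list is in single-assignment form, their concatenation is not.\<close>

definition contract_copy :: "assignment list" where
  "contract_copy =
    [(''av'', ''n'', ''one'', ''one'', always, arr1 ''av2'' ''i''),
     (''ae'', ''m'', ''one'', ''one'', always, arr1 ''ae2'' ''i''),
     (''inc'', ''m'', ''n'', ''one'', always, arr2 ''inc2'' ''i'' ''j''),
     (''w'', ''t'', ''n'', ''one'', always, arr2 ''w2'' ''i'' ''j'')]"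

lemma represents_contract:
  assumes N: "sizes n m t N" and rep: "represents n m t c b M A \<psi> G w"
    and S: "S \<subseteq> verts G" "\<And>v. v < n \<Longrightarrow> M ''S'' v 0 = of_bool (v \<in> A \<and> \<psi> v \<in> S)"
  shows "\<exists>A' \<psi>'. represents n m t c b (fold (assign_sem N) (contract_calc @ contract_copy) M)
    A' \<psi>' (contract G S) (contract_weights w S)"
proof -
  define M1 where "M1 = fold (assign_sem N) contract_calc M"
  define M2 where "M2 = fold (assign_sem N) contract_copy M1"
  note N = N[unfolded sizes_def]
  have ssa: "single_assignment contract_calc" "single_assignment contract_copy"
    by (simp_all add: contract_calc_def contract_copy_def)
  have frame1: "M1 X = M X" if "X \<in> {''S'', ''av'', ''ae'', ''inc'', ''w'', ''c'', ''b'', ''out''}" for X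
    unfolding M1_def using that by (intro fold_assign_sem_other) (elim insertE emptyE; simp add: contract_calc_def)
  have frame2: "M2 X = M1 X" if "X \<in> {''c'', ''b'', ''out''}" for X
    unfolding M2_def using that by (intro fold_assign_sem_other) (elim insertE emptyE; simp add: contract_copy_def)
  have A: "A \<subseteq> {..<n}" and bij: "bij_betw \<psi> A (verts G)" and E: "edges G \<subseteq> {..<m}"
    and av: "\<And>v. v < n \<Longrightarrow> M ''av'' v 0 = of_bool (v \<in> A)"
    and ae: "\<And>e. e < m \<Longrightarrow> M ''ae'' e 0 = of_bool (e \<in> edges G)"
    and inc: "\<And>e. e < m \<Longrightarrow> inc G e \<noteq> {}" "\<And>e. e < m \<Longrightarrow> inc G e \<subseteq> verts G"
    and minc: "\<And>e v. e < m \<Longrightarrow> v < n \<Longrightarrow> M ''inc'' e v = of_bool (v \<in> A \<and> \<psi> v \<in> inc G e)"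
    and mw: "\<And>i v. i < t \<Longrightarrow> v \<in> A \<Longrightarrow> M ''w'' i v = w i (\<psi> v)"
    and mc: "\<And>e. e < m \<Longrightarrow> M ''c'' e 0 = c e" and mb: "\<And>i. i < t \<Longrightarrow> M ''b'' i 0 = b i"
    and out: "\<And>e. m \<le> e \<Longrightarrow> M ''out'' e 0 = 0"
    using rep unfolding represents_def by blast+
  have eqs: "k < length contract_calc \<Longrightarrow> assign_equation N M1 (contract_calc ! k)" for k
    unfolding M1_def by (intro assign_equation_fold ssa nth_mem)
  have frame: "M1 ''S'' = M ''S''" "M1 ''av'' = M ''av''" "M1 ''ae'' = M ''ae''"
    "M1 ''inc'' = M ''inc''" "M1 ''w'' = M ''w''"
    by (simp_all add: frame1)
  note [cong] = if_cong
  have pre: "M1 ''pre'' v 0 = (\<Sum>k<n. if k < v then M ''S'' k 0 else 0)" if "v < n" for v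
    using eqs[of 0] that N frame by (simp add: contract_calc_def)
  have rep: "M1 ''rep'' v 0 = (if 0 < M1 ''pre'' v 0 then 0 else M ''S'' v 0)" if "v < n" for v
    using eqs[of 1] that N frame by (simp add: contract_calc_def)
  have hit: "M1 ''hit'' e 0 = (\<Sum>v<n. M ''S'' v 0 * M ''inc'' e v)" if "e < m" for e
    using eqs[of 2] that N frame by (simp add: contract_calc_def)
  have meets: "M1 ''meets'' e 0 = of_bool (0 < M1 ''hit'' e 0)" if "e < m" for e
    using eqs[of 3] that N frame by (simp add: contract_calc_def)
  have rest: "M1 ''rest'' e 0 = (\<Sum>v<n. (1 - M ''S'' v 0) * M ''inc'' e v)" if "e < m" for e
    using eqs[of 4] that N frame by (simp add: contract_calc_def)
  have sw: "M1 ''sw'' i 0 = (\<Sum>v<n. M ''S'' v 0 * M ''w'' i v)" if "i < t" for i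
    using eqs[of 5] that N frame by (simp add: contract_calc_def)
  have av2: "M1 ''av2'' v 0 = M ''av'' v 0 - M ''S'' v 0 + M1 ''rep'' v 0" if "v < n" for v
    using eqs[of 6] that N frame by (simp add: contract_calc_def)
  have ae2: "M1 ''ae2'' e 0 = (if 0 < M1 ''rest'' e 0 then M ''ae'' e 0 else 0)" if "e < m" for e
    using eqs[of 7] that N frame by (simp add: contract_calc_def)
  have inc2: "M1 ''inc2'' e v =
      M ''inc'' e v * (1 - M ''S'' v 0) + M1 ''rep'' v 0 * M1 ''meets'' e 0"
    if "e < m" "v < n" for e v
    using eqs[of 8] that N frame by (simp add: contract_calc_def)
  have w2: "M1 ''w2'' i v =
      M ''w'' i v * (1 - M1 ''rep'' v 0) + M1 ''rep'' v 0 * M1 ''sw'' i 0"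
    if "i < t" "v < n" for i v
    using eqs[of 9] that N frame by (simp add: contract_calc_def)
  have eqs2: "k < length contract_copy \<Longrightarrow> assign_equation N M2 (contract_copy ! k)" for k
    unfolding M2_def by (intro assign_equation_fold ssa nth_mem)
  have frame3: "M2 X = M1 X" if "X \<in> {''av2'', ''ae2'', ''inc2'', ''w2''}" for X
    unfolding M2_def using that by (intro fold_assign_sem_other) (elim insertE emptyE; simp add: contract_copy_def)
  have copy: "v < n \<Longrightarrow> M2 ''av'' v 0 = M1 ''av2'' v 0"
    "e < m \<Longrightarrow> M2 ''ae'' e 0 = M1 ''ae2'' e 0"
    "e < m \<Longrightarrow> v < n \<Longrightarrow> M2 ''inc'' e v = M1 ''inc2'' e v"
    "i < t \<Longrightarrow> v < n \<Longrightarrow> M2 ''w'' i v = M1 ''w2'' i v" for v e i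
    using eqs2[of 0] eqs2[of 1] eqs2[of 2] eqs2[of 3] N frame3[of "''av2''"] frame3[of "''ae2''"]
      frame3[of "''inc2''"] frame3[of "''w2''"]
    by (simp_all add: contract_copy_def)
  define B where "B = {v \<in> A. \<psi> v \<in> S}"
  have B: "B \<subseteq> A" "B \<subseteq> {..<n}" using A by (auto simp: B_def)
  have mS: "M ''S'' v 0 = of_bool (v \<in> B)" if "v < n" for v
    using S(2)[OF that] by (simp add: B_def)
  have img: "\<psi> ` A = verts G" and inj: "inj_on \<psi> A" using bij by (auto simp: bij_betw_def)
  have rep_iff: "M1 ''rep'' v 0 = of_bool (v \<in> B \<and> (\<forall>k<v. k \<notin> B))" if "v < n" for v
  proof -
    have "M1 ''pre'' v 0 = (\<Sum>k<n. of_bool (k < v \<and> k \<in> B))"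
      unfolding pre[OF that] using mS by (intro sum.cong) auto
    also have "\<dots> = card {k. k < v \<and> k \<in> B}"
    proof -
      have "{..<n} \<inter> {k. k < v \<and> k \<in> B} = {k. k < v \<and> k \<in> B}" using that by auto
      then show ?thesis by (simp add: sum_of_bool_eq)
    qed
    finally have "0 < M1 ''pre'' v 0 \<longleftrightarrow> (\<exists>k<v. k \<in> B)"
      by (auto simp: card_gt_0_iff)
    then show ?thesis using rep[OF that] mS[OF that] by auto
  qed
  have hit_iff: "0 < M1 ''hit'' e 0 \<longleftrightarrow> inc G e \<inter> S \<noteq> {}" if e: "e < m" for e
  proof -
    have "M1 ''hit'' e 0 = (\<Sum>v<n. of_bool (v \<in> B \<and> \<psi> v \<in> inc G e))"
      unfolding hit[OF e] using mS minc e B by (intro sum.cong) auto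
    also have "0 < \<dots> \<longleftrightarrow> (\<exists>v<n. v \<in> B \<and> \<psi> v \<in> inc G e)"
      by (auto simp: sum_of_bool_eq card_gt_0_iff)
    also have "\<dots> \<longleftrightarrow> (\<exists>v\<in>A. \<psi> v \<in> S \<and> \<psi> v \<in> inc G e)"
      using B(2) by (auto simp: B_def)
    also have "\<dots> \<longleftrightarrow> inc G e \<inter> S \<noteq> {}"
      using S(1) unfolding img[symmetric] by auto
    finally show ?thesis .
  qed
  have rest_iff: "0 < M1 ''rest'' e 0 \<longleftrightarrow> \<not> inc G e \<subseteq> S" if e: "e < m" for e
  proof -
    have "M1 ''rest'' e 0 = (\<Sum>v<n. of_bool (v \<in> A - B \<and> \<psi> v \<in> inc G e))"
      unfolding rest[OF e] using mS minc e B by (intro sum.cong) auto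
    also have "0 < \<dots> \<longleftrightarrow> (\<exists>v<n. v \<in> A - B \<and> \<psi> v \<in> inc G e)"
      by (auto simp: sum_of_bool_eq card_gt_0_iff)
    also have "\<dots> \<longleftrightarrow> (\<exists>v\<in>A. \<psi> v \<notin> S \<and> \<psi> v \<in> inc G e)"
      using A by (auto simp: B_def)
    also have "\<dots> \<longleftrightarrow> \<not> inc G e \<subseteq> S"
      using inc(2)[OF e] unfolding img[symmetric] by auto
    finally show ?thesis .
  qed
  have sw_eq: "M1 ''sw'' i 0 = (\<Sum>u\<in>S. w i u)" if "i < t" for i
    unfolding sw[OF that] using A bij S mw[OF that] by (intro sum_marked) auto
  have M2_other: "e < m \<Longrightarrow> M2 ''c'' e 0 = c e" "i < t \<Longrightarrow> M2 ''b'' i 0 = b i"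
    "m \<le> e \<Longrightarrow> M2 ''out'' e 0 = 0" for e i
    using frame1 frame2 mc mb out by simp_all
  have E': "edges (contract G S) \<subseteq> {..<m}"
    by (rule order_trans[OF edges_contract_subset E])
  have inc': "inc (contract G S) e \<noteq> {} \<and> inc (contract G S) e \<subseteq> verts (contract G S)"
    if "e < m" for e
    using inc_contract[OF S(1) inc(2)[OF that] inc(1)[OF that]] by blast
  have "\<exists>A' \<psi>'. represents n m t c b M2 A' \<psi>' (contract G S) (contract_weights w S)"
  proof (cases "S = {}")
    case True
    \<comment> \<open>No row is marked, so \<open>rep\<close> vanishes and the represented data are
      unchanged; every live hyperedge stays live because its incidence set is nonempty.\<close>
    then have "B = {}" by (simp add: B_def)
    then have "represents n m t c b M2 A \<psi> G w"
      unfolding represents_def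
      using A bij E inc av ae minc mw M2_other copy av2 ae2 inc2 w2 rep_iff mS rest_iff True
      by (simp add: subset_iff)
    then show ?thesis using True by auto
  next
    case False
    define u where "u = new_vertex S"
    have u: "u \<in> S" using new_vertex_in[OF False] by (simp add: u_def)
    \<comment> \<open>The surviving row of the contracted set. It may have stood for any vertex of
      \<open>S\<close>, so the renaming is overridden there to point to
      \<open>new_vertex S\<close>.\<close>
    define v0 where "v0 = (LEAST v. v \<in> B)"
    have "u \<in> \<psi> ` A" using u S(1) unfolding img by blast
    then have "B \<noteq> {}" using u by (auto simp: B_def)
    then have v0: "v0 \<in> B" "\<And>v. v \<in> B \<Longrightarrow> v0 \<le> v"
      unfolding v0_def by (auto intro: LeastI Least_le)
    have mrep: "M1 ''rep'' v 0 = of_bool (v = v0)" if "v < n" for v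
    proof -
      have "v \<in> B \<and> (\<forall>k<v. k \<notin> B) \<longleftrightarrow> v = v0"
        using v0 by (metis leD linorder_neqE_nat)
      then show ?thesis using rep_iff[OF that] by simp
    qed
    define A' where "A' = insert v0 (A - B)"
    define \<psi>' where "\<psi>' = \<psi>(v0 := u)"
    have \<psi>'_v0: "\<psi>' v0 = u" by (simp add: \<psi>'_def)
    have \<psi>'_other: "\<psi>' v = \<psi> v" "\<psi> v \<noteq> u" "\<psi> v \<notin> S" if "v \<in> A - B" for v
      using that v0(1) u by (auto simp: \<psi>'_def B_def)
    have v0n: "v0 < n" "v0 \<in> A" using v0 B by auto
    have A': "A' \<subseteq> {..<n}" using A B v0 by (auto simp: A'_def)
    have "bij_betw \<psi>' A' (verts (contract G S))"
    proof -
      have "\<psi> ` (A - B) = verts G - S"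
        unfolding img[symmetric] by (auto simp: B_def)
      moreover have "\<psi>' ` (A - B) = \<psi> ` (A - B)" using \<psi>'_other by (intro image_cong) auto
      ultimately have "\<psi>' ` A' = insert u (verts G - S)" by (simp add: A'_def \<psi>'_v0)
      moreover have "inj_on \<psi>' A'"
        using inj \<psi>'_other by (auto simp: A'_def inj_on_def \<psi>'_v0)
      ultimately show ?thesis by (simp add: bij_betw_def contract_simps[OF False] u_def)
    qed
    moreover have "M2 ''av'' v 0 = of_bool (v \<in> A')" if "v < n" for v
      using that v0 v0n B by (auto simp: copy av2 av mS mrep A'_def)
    moreover have "M2 ''ae'' e 0 = of_bool (e \<in> edges (contract G S))" if "e < m" for e
      using that by (simp add: copy ae2 ae rest_iff contract_simps[OF False])
    moreover have "M2 ''inc'' e v = of_bool (v \<in> A' \<and> \<psi>' v \<in> inc (contract G S) e)"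
      if "e < m" "v < n" for e v
    proof -
      have *: "M2 ''inc'' e v = of_bool (v \<in> A \<and> \<psi> v \<in> inc G e) * (1 - of_bool (v \<in> B)) +
          of_bool (v = v0) * of_bool (inc G e \<inter> S \<noteq> {})"
        using that by (simp add: copy inc2 minc mS mrep meets hit_iff)
      consider "v = v0" | "v \<in> A - B" | "v \<notin> A'" "v \<notin> A \<or> v \<in> B" "v \<noteq> v0"
        by (auto simp: A'_def)
      then show ?thesis
      proof cases
        case 1
        then show ?thesis
          unfolding * using v0 u by (auto simp: A'_def \<psi>'_v0 contract_simps[OF False] u_def)
      next
        case 2
        then have "v \<noteq> v0" using v0 by auto
        then show ?thesis
          unfolding * using 2 \<psi>'_other[OF 2] by (auto simp: A'_def contract_simps[OF False] u_def)
      qed (unfold *, auto)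
    qed
    moreover have "M2 ''w'' i v = contract_weights w S i (\<psi>' v)" if "i < t" "v \<in> A'" for i v
    proof -
      have v: "v < n" using that A' by auto
      have *: "M2 ''w'' i v = M ''w'' i v * (1 - of_bool (v = v0)) +
          of_bool (v = v0) * (\<Sum>u\<in>S. w i u)"
        using that v by (simp add: copy w2 mrep sw_eq)
      show ?thesis
      proof (cases "v = v0")
        case True
        then show ?thesis unfolding * using False by (simp add: \<psi>'_v0 contract_weights_def u_def)
      next
        case ne: False
        then have "v \<in> A - B" using that by (simp add: A'_def)
        then show ?thesis
          unfolding * using ne False \<psi>'_other[of v] mw[OF that(1), of v]
          by (simp add: contract_weights_def u_def)
      qed
    qed
    ultimately have "represents n m t c b M2 A' \<psi>' (contract G S) (contract_weights w S)"
      unfolding represents_def using A' E' inc' M2_other by blast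
    then show ?thesis by blast
  qed
  then show ?thesis by (simp add: M1_def M2_def)
qed

section \<open>Selection of the feasible vertices and the weights\<close>

text \<open>\<open>f\<close> marks the set \<open>U\<close>, \<open>S\<close> its complement among
  the live vertices, and \<open>r\<close> is the size of \<open>U\<close>. If \<open>r\<close> is 0,
  division yields harmless zeros, and the branch on \<open>r\<close> is taken before they matter.
  \<open>cx\<close> and \<open>cy\<close> count the vertices of a hyperedge in \<open>U\<close> and
  in its complement; a row of \<open>out\<close> is cleared exactly when \<open>cut G U\<close> is
  to be returned and the hyperedge does not cross. Since \<open>out\<close> is refreshed in every
  round, it is correct whenever the loop stops; in mode 1 the complement is empty and
  \<open>out\<close> lists all live hyperedges, the output of \<open>alg_H\<close>.\<close>

definition select_assigns :: "assignment list" where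
  "select_assigns =
    [(''viol'', ''n'', ''one'', ''t'',
        Conj (NLess (NVar ''mode'') (NLit 1)) (RLess (arr1 ''b'' ''k'') (arr2 ''w'' ''k'' ''i'')), RLit 1),
     (''f'', ''n'', ''one'', ''one'', Neg (is_pos (arr1 ''viol'' ''i'')), arr1 ''av'' ''i''),
     (''r'', ''one'', ''one'', ''n'', always, arr1 ''f'' ''k''),
     (''alpha'', ''m'', ''one'', ''n'', always,
        RMul (RDiv (RMul (arr1 ''ae'' ''i'')
            (RMul (arr1 ''f'' ''k'') (RSub (RLit 1) (arr2 ''inc'' ''i'' ''k''))))
          (scalar ''r'')) (arr1 ''c'' ''i'')),
     (''suf'', ''m'', ''one'', ''m'', Neg (NLess (NVar ''k'') (NVar ''i'')), arr1 ''alpha'' ''k''),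
     (''tot'', ''one'', ''one'', ''m'', always, arr1 ''alpha'' ''k''),
     (''sf'', ''t'', ''one'', ''n'', always, RMul (arr1 ''f'' ''k'') (arr2 ''w'' ''i'' ''k'')),
     (''bad'', ''one'', ''one'', ''t'', RLess (arr1 ''b'' ''k'') (arr1 ''sf'' ''k''), RLit 1),
     (''S'', ''n'', ''one'', ''one'', always, RSub (arr1 ''av'' ''i'') (arr1 ''f'' ''i'')),
     (''cx'', ''m'', ''one'', ''n'', always, RMul (arr1 ''f'' ''k'') (arr2 ''inc'' ''i'' ''k'')),
     (''cy'', ''m'', ''one'', ''n'', always, RMul (arr1 ''S'' ''k'') (arr2 ''inc'' ''i'' ''k'')),
     (''nS'', ''one'', ''one'', ''n'', always, arr1 ''S'' ''k''),
     (''out'', ''m'', ''one'', ''one'',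
        Neg (Conj (Conj (Neg (is_pos (scalar ''bad''))) (is_pos (scalar ''nS'')))
          (Neg (Conj (is_pos (arr1 ''cx'' ''i'')) (is_pos (arr1 ''cy'' ''i''))))),
        arr1 ''ae'' ''i'')]"

lemma sum_of_bool_pos_iff:
  "finite A \<Longrightarrow> 0 < (\<Sum>i\<in>A. of_bool (P i) :: real) \<longleftrightarrow> (\<exists>i\<in>A. P i)"
  by (auto simp: sum_of_bool_eq card_gt_0_iff)

lemma represents_select:
  assumes N: "sizes n m t N" and rep: "represents n m t c b M A \<psi> G w"
  defines "U \<equiv> if N ''mode'' < 1 then {v \<in> verts G. feasible_vertex t w b v} else verts G"
  defines "M' \<equiv> fold (assign_sem N) select_assigns M"
  shows "represents n m t c b M' A \<psi> G w"
    and "M' ''r'' 0 0 = card U"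
    and "\<And>e. e < m \<Longrightarrow> M' ''alpha'' e 0 =
      (if e \<in> edges G then real (card (U - inc G e)) / real (card U) * c e else 0)"
    and "\<And>e. e < m \<Longrightarrow> M' ''suf'' e 0 = (\<Sum>k\<in>{e..<m}. M' ''alpha'' k 0)"
    and "M' ''tot'' 0 0 = (\<Sum>e\<in>edges G. real (card (U - inc G e)) / real (card U) * c e)"
    and "0 < M' ''bad'' 0 0 \<longleftrightarrow> \<not> feasible t w b U"
    and "\<And>v. v < n \<Longrightarrow> M' ''S'' v 0 = of_bool (v \<in> A \<and> \<psi> v \<in> verts G - U)"
    and "{e. M' ''out'' e 0 = 1} =
      (if feasible t w b U \<and> U \<noteq> verts G then cut G U else edges G)"
proof -
  note N = N[unfolded sizes_def]
  have ssa: "single_assignment select_assigns"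
    by (simp add: select_assigns_def)
  have frame': "M' X = M X" if "X \<in> {''av'', ''ae'', ''inc'', ''w'', ''c'', ''b''}" for X
    unfolding M'_def using that
    by (intro fold_assign_sem_other) (elim insertE emptyE; simp add: select_assigns_def)
  have frame: "M' ''av'' = M ''av''" "M' ''ae'' = M ''ae''" "M' ''inc'' = M ''inc''"
    "M' ''w'' = M ''w''" "M' ''c'' = M ''c''" "M' ''b'' = M ''b''"
    by (simp_all add: frame')
  have A: "A \<subseteq> {..<n}" and bij: "bij_betw \<psi> A (verts G)" and E: "edges G \<subseteq> {..<m}"
    and av: "\<And>v. v < n \<Longrightarrow> M ''av'' v 0 = of_bool (v \<in> A)"
    and ae: "\<And>e. e < m \<Longrightarrow> M ''ae'' e 0 = of_bool (e \<in> edges G)"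
    and inc: "\<And>e. e < m \<Longrightarrow> inc G e \<noteq> {} \<and> inc G e \<subseteq> verts G"
    and minc: "\<And>e v. e < m \<Longrightarrow> v < n \<Longrightarrow> M ''inc'' e v = of_bool (v \<in> A \<and> \<psi> v \<in> inc G e)"
    and mw: "\<And>i v. i < t \<Longrightarrow> v \<in> A \<Longrightarrow> M ''w'' i v = w i (\<psi> v)"
    and mc: "\<And>e. e < m \<Longrightarrow> M ''c'' e 0 = c e" and mb: "\<And>i. i < t \<Longrightarrow> M ''b'' i 0 = b i"
    and out: "\<And>e. m \<le> e \<Longrightarrow> M ''out'' e 0 = 0"
    using rep unfolding represents_def by blast+
  have eqs: "k < length select_assigns \<Longrightarrow> assign_equation N M' (select_assigns ! k)" for k
    unfolding M'_def by (intro assign_equation_fold ssa nth_mem)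
  note [cong] = if_cong
  have viol: "M' ''viol'' v 0 =
      (\<Sum>i<t. if N ''mode'' < 1 \<and> M ''b'' i 0 < M ''w'' i v then 1 else 0)" if "v < n" for v
    using eqs[of 0] that N frame by (simp add: select_assigns_def)
  have f: "M' ''f'' v 0 = (if 0 < M' ''viol'' v 0 then 0 else M ''av'' v 0)" if "v < n" for v
    using eqs[of 1] that N frame by (simp add: select_assigns_def)
  have r: "M' ''r'' 0 0 = (\<Sum>v<n. M' ''f'' v 0)"
    using eqs[of 2] N frame by (simp add: select_assigns_def)
  have alpha: "M' ''alpha'' e 0 = (\<Sum>v<n. M ''ae'' e 0 * (M' ''f'' v 0 * (1 - M ''inc'' e v)) /
      M' ''r'' 0 0 * M ''c'' e 0)" if "e < m" for e
    using eqs[of 3] that N frame by (simp add: select_assigns_def)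
  have suf: "M' ''suf'' e 0 = (\<Sum>k<m. if \<not> k < e then M' ''alpha'' k 0 else 0)" if "e < m" for e
    using eqs[of 4] that N frame by (simp add: select_assigns_def)
  have tot: "M' ''tot'' 0 0 = (\<Sum>e<m. M' ''alpha'' e 0)"
    using eqs[of 5] N frame by (simp add: select_assigns_def)
  have sf: "M' ''sf'' i 0 = (\<Sum>v<n. M' ''f'' v 0 * M ''w'' i v)" if "i < t" for i
    using eqs[of 6] that N frame by (simp add: select_assigns_def)
  have bad: "M' ''bad'' 0 0 = (\<Sum>i<t. if M ''b'' i 0 < M' ''sf'' i 0 then 1 else 0)"
    using eqs[of 7] N frame by (simp add: select_assigns_def)
  have S: "M' ''S'' v 0 = M ''av'' v 0 - M' ''f'' v 0" if "v < n" for v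
    using eqs[of 8] that N frame by (simp add: select_assigns_def)
  have cx: "M' ''cx'' e 0 = (\<Sum>v<n. M' ''f'' v 0 * M ''inc'' e v)" if "e < m" for e
    using eqs[of 9] that N frame by (simp add: select_assigns_def)
  have cy: "M' ''cy'' e 0 = (\<Sum>v<n. M' ''S'' v 0 * M ''inc'' e v)" if "e < m" for e
    using eqs[of 10] that N frame by (simp add: select_assigns_def)
  have nS: "M' ''nS'' 0 0 = (\<Sum>v<n. M' ''S'' v 0)"
    using eqs[of 11] N frame by (simp add: select_assigns_def)
  have out': "M' ''out'' e 0 =
      (if \<not> 0 < M' ''bad'' 0 0 \<and> 0 < M' ''nS'' 0 0 \<and> \<not> (0 < M' ''cx'' e 0 \<and> 0 < M' ''cy'' e 0)
       then 0 else M ''ae'' e 0)" if "e < m" for e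
    using eqs[of 12] that N frame by (simp add: select_assigns_def)
  have out_other: "M' ''out'' e 0 = 0" if "m \<le> e" for e
  proof -
    obtain K p r where "select_assigns ! 12 = (''out'', ''m'', ''one'', K, p, r)"
      by (simp add: select_assigns_def)
    moreover have "12 < length select_assigns" by (simp add: select_assigns_def)
    ultimately have "(''out'', ''m'', ''one'', K, p, r) \<in> set select_assigns"
      by (metis nth_mem)
    from fold_assign_sem_outside[OF ssa this, of e N 0 M] have "M' ''out'' e 0 = M ''out'' e 0"
      using that N by (simp add: M'_def)
    then show ?thesis using out that by simp
  qed
  show "represents n m t c b M' A \<psi> G w"
    using rep out_other unfolding represents_def frame by blast
  have UV: "U \<subseteq> verts G" by (simp add: U_def)
  have finV: "finite (verts G)" using bij A by (meson bij_betw_finite finite_lessThan finite_subset)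
  have finU: "finite U" using UV finV by (rule finite_subset)
  have \<psi>: "\<psi> v \<in> verts G" if "v \<in> A" for v using bij that by (auto simp: bij_betw_def)
  have viol_iff: "0 < M' ''viol'' v 0 \<longleftrightarrow> \<psi> v \<notin> U" if v: "v \<in> A" for v
  proof -
    have "v < n" using v A by blast
    then have "M' ''viol'' v 0 = (\<Sum>i<t. of_bool (N ''mode'' < 1 \<and> b i < w i (\<psi> v)))"
      using v mb mw by (simp add: viol of_bool_def)
    then have "0 < M' ''viol'' v 0 \<longleftrightarrow> (\<exists>i<t. N ''mode'' < 1 \<and> b i < w i (\<psi> v))"
      by (simp only: sum_of_bool_pos_iff finite_lessThan Bex_def lessThan_iff)
    then show ?thesis
      using \<psi>[OF v] by (cases "N ''mode'' < 1") (simp_all add: U_def feasible_vertex_def not_le)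
  qed
  have f_eq: "M' ''f'' v 0 = of_bool (v \<in> A \<and> \<psi> v \<in> U)" if "v < n" for v
    using that viol_iff by (cases "v \<in> A") (simp_all add: f av)
  show S_eq: "M' ''S'' v 0 = of_bool (v \<in> A \<and> \<psi> v \<in> verts G - U)" if "v < n" for v
    using that \<psi> by (cases "v \<in> A") (simp_all add: S f_eq av)
  note sum_f = sum_marked[OF A bij UV f_eq]
  note sum_S = sum_marked[OF A bij Diff_subset S_eq]
  show r_eq: "M' ''r'' 0 0 = card U"
    using sum_f[of "\<lambda>_. 1" "\<lambda>_. 1"] by (simp add: r)
  show alpha_eq: "M' ''alpha'' e 0 =
      (if e \<in> edges G then real (card (U - inc G e)) / real (card U) * c e else 0)"
    if e: "e < m" for e
  proof -
    have "(\<Sum>v<n. M' ''f'' v 0 * (1 - M ''inc'' e v)) = (\<Sum>u\<in>U. of_bool (u \<notin> inc G e))"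
      using minc e A by (intro sum_f) auto
    also have "\<dots> = card (U - inc G e)"
    proof -
      have "U \<inter> {u. u \<notin> inc G e} = U - inc G e" by blast
      then show ?thesis using finU by (simp add: sum_of_bool_eq)
    qed
    finally have "M' ''alpha'' e 0 = M ''ae'' e 0 * card (U - inc G e) / M' ''r'' 0 0 * M ''c'' e 0"
      unfolding alpha[OF e] by (simp flip: sum_distrib_left sum_divide_distrib sum_distrib_right)
    then show ?thesis using e by (simp add: r_eq ae mc)
  qed
  show "M' ''suf'' e 0 = (\<Sum>k\<in>{e..<m}. M' ''alpha'' k 0)" if e: "e < m" for e
  proof -
    have "{k \<in> {..<m}. \<not> k < e} = {e..<m}" by auto
    then show ?thesis unfolding suf[OF e] by (simp only: sum.inter_filter[OF finite_lessThan, symmetric])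
  qed
  show "M' ''tot'' 0 0 = (\<Sum>e\<in>edges G. real (card (U - inc G e)) / real (card U) * c e)"
  proof -
    have "M' ''tot'' 0 0 =
        (\<Sum>e<m. if e \<in> edges G then real (card (U - inc G e)) / real (card U) * c e else 0)"
      unfolding tot using alpha_eq by (intro sum.cong) auto
    also have "\<dots> = (\<Sum>e\<in>edges G. real (card (U - inc G e)) / real (card U) * c e)"
      using E by (simp add: sum.inter_restrict[symmetric] Int_absorb1)
    finally show ?thesis .
  qed
  have sf_eq: "M' ''sf'' i 0 = (\<Sum>u\<in>U. w i u)" if "i < t" for i
    unfolding sf[OF that] by (rule sum_f, assumption, rule mw[OF that])
  show bad_iff: "0 < M' ''bad'' 0 0 \<longleftrightarrow> \<not> feasible t w b U"
  proof -
    have "M' ''bad'' 0 0 = (\<Sum>i<t. of_bool (b i < (\<Sum>u\<in>U. w i u)))"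
      by (simp add: bad sf_eq mb of_bool_def)
    then have "0 < M' ''bad'' 0 0 \<longleftrightarrow> (\<exists>i<t. b i < (\<Sum>u\<in>U. w i u))"
      by (simp only: sum_of_bool_pos_iff finite_lessThan Bex_def lessThan_iff)
    then show ?thesis by (simp add: feasible_def not_le)
  qed
  have cx_iff: "0 < M' ''cx'' e 0 \<longleftrightarrow> inc G e \<inter> U \<noteq> {}" if e: "e < m" for e
  proof -
    have "M' ''cx'' e 0 = (\<Sum>u\<in>U. of_bool (u \<in> inc G e))"
      unfolding cx[OF e] using minc e A by (intro sum_f) auto
    then show ?thesis using finU by (simp only: sum_of_bool_pos_iff) blast
  qed
  have cy_iff: "0 < M' ''cy'' e 0 \<longleftrightarrow> inc G e \<inter> (verts G - U) \<noteq> {}" if e: "e < m" for e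
  proof -
    have "M' ''cy'' e 0 = (\<Sum>u\<in>verts G - U. of_bool (u \<in> inc G e))"
      unfolding cy[OF e] using minc e A by (intro sum_S) auto
    then show ?thesis using finV by (simp only: sum_of_bool_pos_iff finite_Diff) blast
  qed
  have nS_iff: "0 < M' ''nS'' 0 0 \<longleftrightarrow> U \<noteq> verts G"
    using sum_S[of "\<lambda>_. 1" "\<lambda>_. 1"] finV UV by (auto simp: nS card_gt_0_iff)
  have "M' ''out'' e 0 = 1 \<longleftrightarrow>
      e \<in> (if feasible t w b U \<and> U \<noteq> verts G then cut G U else edges G)" for e
  proof (cases "e < m")
    case True
    then show ?thesis
      by (simp add: out' bad_iff nS_iff cx_iff cy_iff ae cut_def)
  next
    case False
    then have "e \<notin> edges G" using E by auto
    then show ?thesis using False by (simp add: out_other cut_def)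
  qed
  then show "{e. M' ''out'' e 0 = 1} =
      (if feasible t w b U \<and> U \<noteq> verts G then cut G U else edges G)" by blast
qed

section \<open>The program\<close>

text \<open>Executed after the infeasible vertices have been merged, so row \<open>x\<close> already
  holds the image of the drawn hyperedge; for one that was deleted, this is the new vertex
  alone.\<close>

definition load_edge :: "assignment list" where
  "load_edge = [(''S'', ''n'', ''one'', ''one'', always, RGet ''inc'' (NVar ''x'') (NVar ''i''))]"

definition init_assigns :: "assignment list" where
  "init_assigns =
    [(''av'', ''n'', ''one'', ''one'', always, RLit 1), (''ae'', ''m'', ''one'', ''one'', always, RLit 1)]"

text \<open>In mode 1 the first contraction acts on an empty \<open>S\<close> and changes nothing,
  so the same list serves both algorithms.\<close>

definition contract_drawn :: "assignment list" where
  "contract_drawn = (contract_calc @ contract_copy) @ load_edge @ (contract_calc @ contract_copy)"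

text \<open>Mode 0 runs \<^const>\<open>alg_M\<close>, mode 1 runs \<^const>\<open>alg_H\<close>, and mode 2 stops. In mode 1 all
  vertices count as feasible, which turns \<open>\<alpha>\<close> into \<open>\<beta>\<close>.\<close>

definition branch_com :: com where
  "branch_com =
    Cond (is_pos (scalar ''r''))
      (Cond (is_pos (scalar ''tot''))
        (Cond (Conj (NLess (NVar ''mode'') (NLit 1)) (Neg (is_pos (scalar ''bad''))))
          (Seq (assigns_com (contract_calc @ contract_copy)) (SetNat ''mode'' (NLit 1)))
          (Seq draw_com (assigns_com contract_drawn)))
        (SetNat ''mode'' (NLit 2)))
      (Seq (SetNat ''infeasible'' (NLit 1)) (SetNat ''mode'' (NLit 2)))"

definition main_loop :: com where
  "main_loop = While (NLess (NVar ''mode'') (NLit 2)) (Seq (assigns_com select_assigns) branch_com)"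

definition alg_M_com :: com where
  "alg_M_com = Seq (SetNat ''one'' (NLit 1)) (Seq (assigns_com init_assigns) main_loop)"

text \<open>The arrays and the renaming are hidden, since between rounds only the represented
  instance matters; the registers stay visible because \<open>mode\<close> steers the loop.\<close>

definition tracks ::
  "nat \<Rightarrow> nat \<Rightarrow> nat \<Rightarrow> (nat \<Rightarrow> real) \<Rightarrow> (nat \<Rightarrow> real) \<Rightarrow> (string \<Rightarrow> nat) \<Rightarrow>
   (nat, nat) hypergraph \<Rightarrow> (nat \<Rightarrow> nat \<Rightarrow> real) \<Rightarrow> store \<Rightarrow> bool" where
  "tracks n m t c b N G w s \<longleftrightarrow> sizes n m t N \<and>
    (\<exists>M A \<psi>. models N M s \<and> represents n m t c b M A \<psi> G w)"

lemma tracksI: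
  "sizes n m t N \<Longrightarrow> models N M s \<Longrightarrow> represents n m t c b M A \<psi> G w \<Longrightarrow> tracks n m t c b N G w s"
  unfolding tracks_def by blast

lemma represents_cong:
  assumes "\<And>X. X \<in> {''av'', ''ae'', ''inc'', ''w'', ''c'', ''b'', ''out''} \<Longrightarrow> M' X = M X"
  shows "represents n m t c b M' A \<psi> G w = represents n m t c b M A \<psi> G w"
  by (simp add: represents_def assms)

lemma assigns_bounded:
  assumes "sizes n m t N" "L = n + m + t + 1"
    and "as \<in> {select_assigns, contract_calc @ contract_copy, contract_drawn, init_assigns}"
  shows "\<forall>a\<in>set as. assign_ok a \<and> (\<forall>x\<in>assign_bounds a. N x \<le> L)"
proof -
  have "\<forall>a\<in>set as. assign_ok a \<and> (\<forall>x\<in>assign_bounds a. x \<in> {''n'', ''m'', ''t'', ''one''})"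
    using assms(3)
    by (elim insertE emptyE) (simp_all add: select_assigns_def contract_calc_def contract_copy_def
        contract_drawn_def load_edge_def init_assigns_def)
  moreover have "N x \<le> L" if "x \<in> {''n'', ''m'', ''t'', ''one''}" for x
    using that assms(1,2) by (elim insertE emptyE) (simp_all add: sizes_def)
  ultimately show ?thesis by blast
qed

lemma runs_to_bounded_assigns:
  assumes "sizes n m t N" "L = n + m + t + 1" "models N M s"
    and "as \<in> {select_assigns, contract_calc @ contract_copy, contract_drawn, init_assigns}"
  obtains s' where "exec (assigns_com as) s = return_spmf s'"
    "models N (fold (assign_sem N) as M) s'" "steps s' \<le> steps s + 450 * L ^ 3"
proof -
  \<comment> \<open>The maximum is \<open>contract_drawn\<close>: two contractions of 14 assignments
    each and one load.\<close>
  have "length as \<le> 29"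
    using assms(4) by (elim insertE emptyE) (simp_all add: select_assigns_def contract_calc_def
        contract_copy_def contract_drawn_def load_edge_def init_assigns_def)
  then have "15 * length as * L ^ 3 \<le> 435 * L ^ 3" by (intro mult_right_mono) auto
  moreover have "1 \<le> L ^ 3" using assms(2) by simp
  ultimately have bound: "15 * length as * L ^ 3 + 1 \<le> 450 * L ^ 3" by linarith
  have "runs_to (assigns_com as) s (15 * length as * L ^ 3 + 1)
      (models N (fold (assign_sem N) as M))"
    using assigns_bounded[OF assms(1,2,4)] assms(2,3) by (intro runs_to_assigns) auto
  then obtain s' where "exec (assigns_com as) s = return_spmf s'"
    "models N (fold (assign_sem N) as M) s'" "steps s' \<le> steps s + (15 * length as * L ^ 3 + 1)"
    unfolding runs_to_def by blast
  moreover note bound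
  ultimately show ?thesis by (intro that) auto
qed

lemma tracks_contract:
  assumes "sizes n m t N" "L = n + m + t + 1" "models N M s" "represents n m t c b M A \<psi> G w"
    and "S \<subseteq> verts G" "\<And>v. v < n \<Longrightarrow> M ''S'' v 0 = of_bool (v \<in> A \<and> \<psi> v \<in> S)"
  obtains s' where "exec (assigns_com (contract_calc @ contract_copy)) s = return_spmf s'"
    "tracks n m t c b N (contract G S) (contract_weights w S) s'"
    "steps s' \<le> steps s + 450 * L ^ 3"
proof -
  obtain s' where s': "exec (assigns_com (contract_calc @ contract_copy)) s = return_spmf s'"
    "models N (fold (assign_sem N) (contract_calc @ contract_copy) M) s'"
    "steps s' \<le> steps s + 450 * L ^ 3"
    by (rule runs_to_bounded_assigns[OF assms(1-3), of "contract_calc @ contract_copy"]) simp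
  obtain A' \<psi>' where "represents n m t c b (fold (assign_sem N) (contract_calc @ contract_copy) M)
      A' \<psi>' (contract G S) (contract_weights w S)"
    using represents_contract[OF assms(1,4,5,6)] by blast
  from tracksI[OF assms(1) s'(2) this] show ?thesis using that[OF s'(1) _ s'(3)] by blast
qed

lemma tracks_contract_drawn:
  assumes N: "sizes n m t N" and L: "L = n + m + t + 1" and s: "models N M s"
    and rep: "represents n m t c b M A \<psi> G w"
    and S: "S \<subseteq> verts G" "\<And>v. v < n \<Longrightarrow> M ''S'' v 0 = of_bool (v \<in> A \<and> \<psi> v \<in> S)"
    and e: "N ''x'' = e" "e < m"
  defines "G' \<equiv> contract G S" and "w' \<equiv> contract_weights w S"
  obtains s' where "exec (assigns_com contract_drawn) s = return_spmf s'"
    "tracks n m t c b N (contract G' (inc G' e)) (contract_weights w' (inc G' e)) s'"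
    "steps s' \<le> steps s + 450 * L ^ 3"
proof -
  obtain s' where s': "exec (assigns_com contract_drawn) s = return_spmf s'"
    "models N (fold (assign_sem N) contract_drawn M) s'" "steps s' \<le> steps s + 450 * L ^ 3"
    by (rule runs_to_bounded_assigns[OF N L s, of contract_drawn]) simp_all
  define M1 where "M1 = fold (assign_sem N) (contract_calc @ contract_copy) M"
  define M2 where "M2 = fold (assign_sem N) load_edge M1"
  obtain A' \<psi>' where M1: "represents n m t c b M1 A' \<psi>' G' w'"
    using represents_contract[OF N rep S] unfolding M1_def G'_def w'_def by blast
  have frame: "M2 X = M1 X" if "X \<in> {''av'', ''ae'', ''inc'', ''w'', ''c'', ''b'', ''out''}" for X
    unfolding M2_def using that
    by (intro fold_assign_sem_other) (elim insertE emptyE; simp add: load_edge_def)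
  have "represents n m t c b M2 A' \<psi>' G' w' = represents n m t c b M1 A' \<psi>' G' w'"
    by (rule represents_cong) (rule frame)
  with M1 have M2: "represents n m t c b M2 A' \<psi>' G' w'" by blast
  have inc: "inc G' e \<subseteq> verts G'" using M1 e(2) unfolding represents_def by blast
  have "M2 ''S'' v 0 = of_bool (v \<in> A' \<and> \<psi>' v \<in> inc G' e)" if "v < n" for v
  proof -
    have "M2 ''S'' v 0 = M1 ''inc'' e v"
      using N that e(1) by (simp add: M2_def load_edge_def sizes_def)
    also have "\<dots> = of_bool (v \<in> A' \<and> \<psi>' v \<in> inc G' e)"
      using M1 e(2) that unfolding represents_def by blast
    finally show ?thesis .
  qed
  from represents_contract[OF N M2 inc this] obtain A'' \<psi>'' where
    rep': "represents n m t c b (fold (assign_sem N) (contract_calc @ contract_copy) M2) A'' \<psi>''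
      (contract G' (inc G' e)) (contract_weights w' (inc G' e))" by blast
  have "fold (assign_sem N) (contract_calc @ contract_copy) M2 =
      fold (assign_sem N) contract_drawn M"
    by (simp only: contract_drawn_def M1_def M2_def fold_append comp_def)
  from tracksI[OF N s'(2) rep'[unfolded this]] show ?thesis using that[OF s'(1) _ s'(3)] by blast
qed

text \<open>One drawing round of either algorithm in continuation form: \<open>f\<close> is the
  recursive call, \<open>g\<close> the rest of the loop, and \<open>cont\<close> is the place where
  an induction hypothesis plugs in.\<close>

lemma rel_spmf_draw_step:
  assumes N: "sizes n m t N" and L: "L = n + m + t + 1" and s: "models N M s"
    and rep: "represents n m t c b M A \<psi> G w"
    and S: "S \<subseteq> verts G" "\<And>v. v < n \<Longrightarrow> M ''S'' v 0 = of_bool (v \<in> A \<and> \<psi> v \<in> S)"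
    and alpha: "\<And>e. e < m \<Longrightarrow> M ''alpha'' e 0 = (if e \<in> edges G then \<alpha> e else 0)"
    and suf: "\<And>e. e < m \<Longrightarrow> M ''suf'' e 0 = (\<Sum>k\<in>{e..<m}. M ''alpha'' k 0)"
    and \<alpha>: "\<And>e. e \<in> edges G \<Longrightarrow> 0 \<le> \<alpha> e" "0 < sum \<alpha> (edges G)"
  defines "G' \<equiv> contract G S" and "w' \<equiv> contract_weights w S"
  assumes cont: "\<And>e s'. e \<in> edges G \<Longrightarrow>
      tracks n m t c b (N(''x'' := e, ''h'' := 1)) (contract G' (inc G' e))
        (contract_weights w' (inc G' e)) s' \<Longrightarrow>
      steps s' \<le> steps s + 460 * L ^ 3 \<Longrightarrow> rel_spmf R (f e) (g s')"
  shows "rel_spmf R (bind_pmf (proportional_pmf (edges G) \<alpha>) f)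
    (bind_spmf (exec (Seq draw_com (assigns_com contract_drawn)) s) g)"
proof -
  have E: "edges G \<subseteq> {..<m}" using rep unfolding represents_def by blast
  have "rel_spmf R
    (bind_spmf (spmf_of_pmf (proportional_pmf (edges G) \<alpha>)) f)
    (bind_spmf (exec draw_com s) (\<lambda>s'. bind_spmf (exec (assigns_com contract_drawn) s') g))"
  proof (rule rel_spmf_bindI[OF rel_spmf_draw[OF E \<alpha> alpha suf s]])
    fix e s' assume e: "e \<in> edges G \<and> models (N(''x'' := e, ''h'' := 1)) M s' \<and>
      steps s' \<le> steps s + 3 * m + 3"
    let ?N = "N(''x'' := e, ''h'' := 1)"
    have em: "e < m" using e E by blast
    have N': "sizes n m t ?N" using N by (simp add: sizes_def)
    obtain s'' where s'': "exec (assigns_com contract_drawn) s' = return_spmf s''"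
      "tracks n m t c b ?N (contract G' (inc G' e)) (contract_weights w' (inc G' e)) s''"
      "steps s'' \<le> steps s' + 450 * L ^ 3"
      unfolding G'_def w'_def
      by (rule tracks_contract_drawn[OF N' L _ rep S, of s' e]) (use e em in simp_all)
    \<comment> \<open>The draw adds at most \<open>3 * m + 3\<close> steps, absorbed by the gap
      between 450 and 460.\<close>
    have "L \<le> L ^ 3" "1 \<le> L" using L by (simp_all add: power3_eq_cube)
    then have "steps s'' \<le> steps s + 460 * L ^ 3" using s''(3) e L by linarith
    then show "rel_spmf R (f e) (bind_spmf (exec (assigns_com contract_drawn) s') g)"
      using cont[of e s''] e s''(1,2) by simp
  qed
  then show ?thesis by (simp add: bind_spmf_of_pmf)
qed

section \<open>Termination of the abstract recursions\<close>

lemma proportional_pmf_cong: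
  assumes "\<And>x. x \<in> A \<Longrightarrow> f x = g x"
  shows "proportional_pmf A f = proportional_pmf A g"
  unfolding proportional_pmf_def using assms
  by (intro arg_cong[where f = embed_pmf] ext) (simp cong: sum.cong)

lemma lossless_bind_proportional_pmf:
  assumes "finite A" "\<And>x. x \<in> A \<Longrightarrow> 0 \<le> f x" "0 < sum f A"
    and "\<And>x. x \<in> A \<Longrightarrow> lossless_spmf (g x)"
  shows "lossless_spmf (bind_pmf (proportional_pmf A f) g)"
  unfolding bind_spmf_of_pmf[symmetric] lossless_bind_spmf
  using assms(4) by (simp add: set_proportional_pmf[OF assms(1-3)])

lemma sum_pos_if_not_all_0:
  fixes f :: "'a \<Rightarrow> real"
  assumes "finite A" "\<And>x. x \<in> A \<Longrightarrow> 0 \<le> f x" "\<not> (\<forall>x\<in>A. f x = 0)"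
  shows "0 < sum f A"
proof -
  have "sum f A \<noteq> 0" using assms by (subst sum_nonneg_eq_0_iff) auto
  moreover have "0 \<le> sum f A" using assms(2) by (rule sum_nonneg)
  ultimately show ?thesis by simp
qed

text \<open>The program counts the vertices outside a hyperedge, while \<open>alg_H\<close>
  subtracts cardinalities. The two agree on hyperedges of \<open>G\<close>, the only labels at which
  the weights are consulted.\<close>

lemma alg_H_eq:
  fixes G :: "('v, 'e) hypergraph" and c :: "'e \<Rightarrow> real"
  assumes G: "hypergraph G"
  defines "\<alpha> \<equiv> \<lambda>e. real (card (verts G - inc G e)) / real (card (verts G)) * c e"
  shows "alg_H G c = (if \<forall>e\<in>edges G. \<alpha> e = 0 then return_spmf (edges G)
    else bind_pmf (proportional_pmf (edges G) \<alpha>) (\<lambda>e. alg_H (contract G (inc G e)) c))"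
proof -
  let ?\<beta> = "\<lambda>e. (real (card (verts G)) - real (card (inc G e))) / real (card (verts G)) * c e"
  have "?\<beta> e = \<alpha> e" if "e \<in> edges G" for e
  proof -
    have "finite (inc G e)"
      using hypergraphD(4)[OF G that] hypergraphD(1)[OF G] by (rule finite_subset)
    then have "card (verts G - inc G e) = card (verts G) - card (inc G e)"
      using hypergraphD(4)[OF G that] by (rule card_Diff_subset)
    moreover have "card (inc G e) \<le> card (verts G)"
      using hypergraphD(1)[OF G] hypergraphD(4)[OF G that] by (rule card_mono)
    ultimately show ?thesis by (simp add: \<alpha>_def of_nat_diff)
  qed
  then have "(\<forall>e\<in>edges G. ?\<beta> e = 0) \<longleftrightarrow> (\<forall>e\<in>edges G. \<alpha> e = 0)"
    "proportional_pmf (edges G) ?\<beta> = proportional_pmf (edges G) \<alpha>"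
    by (simp_all cong: proportional_pmf_cong)
  then show ?thesis by (subst alg_H.simps) (simp only: Let_def)
qed

lemma lossless_alg_H:
  fixes G :: "('v, 'e) hypergraph"
  assumes "hypergraph G" "\<forall>e\<in>edges G. 0 < c e"
  shows "lossless_spmf (alg_H G c)"
  using assms
proof (induction "card (edges G)" arbitrary: G rule: less_induct)
  case less
  note G = less.prems(1)
  define \<alpha> where "\<alpha> = (\<lambda>e. real (card (verts G - inc G e)) / real (card (verts G)) * c e)"
  have alg: "alg_H G c = (if \<forall>e\<in>edges G. \<alpha> e = 0 then return_spmf (edges G)
      else bind_pmf (proportional_pmf (edges G) \<alpha>) (\<lambda>e. alg_H (contract G (inc G e)) c))"
    unfolding \<alpha>_def by (rule alg_H_eq[OF G])
  show ?case
  proof (cases "\<forall>e\<in>edges G. \<alpha> e = 0")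
    case True
    then show ?thesis unfolding alg by simp
  next
    case False
    have \<alpha>: "0 \<le> \<alpha> e" if "e \<in> edges G" for e using less.prems(2) that by (simp add: \<alpha>_def less_imp_le)
    have "lossless_spmf (alg_H (contract G (inc G e)) c)" if e: "e \<in> edges G" for e
    proof (rule less.hyps)
      show "card (edges (contract G (inc G e))) < card (edges G)"
        using card_edges_contract_less[OF G e, of "{}"] by simp
      show "hypergraph (contract G (inc G e))"
        using hypergraph_contract[OF G hypergraphD(4)[OF G e]] .
      show "\<forall>e'\<in>edges (contract G (inc G e)). 0 < c e'"
        using less.prems(2) by (rule ball_edges_contract)
    qed
    note lossless = this
    have pos: "0 < sum \<alpha> (edges G)"
      using sum_pos_if_not_all_0[OF hypergraphD(2)[OF G] \<alpha> False] .
    show ?thesis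
      unfolding alg if_not_P[OF False]
      by (rule lossless_bind_proportional_pmf[OF hypergraphD(2)[OF G] \<alpha> pos lossless])
  qed
qed

lemma alg_M_eq:
  fixes G :: "('v, 'e) hypergraph" and t :: nat and w :: "nat \<Rightarrow> 'v \<Rightarrow> real"
    and c :: "'e \<Rightarrow> real" and b :: "nat \<Rightarrow> real"
  defines "U \<equiv> {v \<in> verts G. feasible_vertex t w b v}"
  defines "\<alpha> \<equiv> \<lambda>e. real (card (U - inc G e)) / real (card U) * c e"
    and "G' \<equiv> contract G (verts G - U)" and "w' \<equiv> contract_weights w (verts G - U)"
  shows "alg_M G t w c b = (if U = {} then return_spmf Infeasible
      else if \<forall>e\<in>edges G. \<alpha> e = 0 then
        return_spmf (Cut (if feasible t w b U \<and> U \<noteq> verts G then cut G U else edges G))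
      else if feasible t w b U then map_spmf Cut (alg_H G' c)
      else bind_pmf (proportional_pmf (edges G) \<alpha>)
        (\<lambda>e. alg_M (contract G' (inc G' e)) t (contract_weights w' (inc G' e)) c b))"
  unfolding U_def \<alpha>_def G'_def w'_def by (subst alg_M.simps) (simp only: Let_def)

text \<open>Side conditions for invoking an induction hypothesis after a round;
  \<open>S = {}\<close> covers \<open>alg_H\<close>.\<close>

lemma drawn_contraction:
  assumes G: "hypergraph G" and c: "\<forall>e\<in>edges G. 0 < c e" and S: "S \<subseteq> verts G"
    and e: "e \<in> edges G"
  defines "G' \<equiv> contract G S"
  defines "G'' \<equiv> contract G' (inc G' e)"
  shows "hypergraph G''" "\<forall>e\<in>edges G''. 0 < c e" "card (edges G'') < card (edges G)" "verts G'' \<noteq> {}"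
proof -
  note inc = inc_contract[OF S hypergraphD(4,3)[OF G e], folded G'_def]
  show "hypergraph G''"
    unfolding G''_def G'_def by (intro hypergraph_contract G S inc(2)[unfolded G'_def])
  have "edges G'' \<subseteq> edges G"
    unfolding G''_def G'_def by (intro order_trans[OF edges_contract_subset] edges_contract_subset)
  then show "\<forall>e\<in>edges G''. 0 < c e" using c by blast
  show "card (edges G'') < card (edges G)"
    unfolding G''_def G'_def by (rule card_edges_contract_less[OF G e])
  show "verts G'' \<noteq> {}" unfolding G''_def using inc(1) by (simp add: contract_simps)
qed

lemma verts_contract_nonempty: "verts G \<noteq> {} \<Longrightarrow> verts (contract G S) \<noteq> {}"
  by (cases "S = {}") (simp_all add: contract_simps)

lemma lossless_alg_M:
  fixes G :: "('v, 'e) hypergraph"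
  assumes "hypergraph G" "\<forall>e\<in>edges G. 0 < c e"
  shows "lossless_spmf (alg_M G t w c b)"
  using assms
proof (induction "card (edges G)" arbitrary: G w rule: less_induct)
  case less
  note G = less.prems(1) and c = less.prems(2)
  define U where "U = {v \<in> verts G. feasible_vertex t w b v}"
  define \<alpha> where "\<alpha> = (\<lambda>e. real (card (U - inc G e)) / real (card U) * c e)"
  let ?G = "contract G (verts G - U)" and ?w = "contract_weights w (verts G - U)"
  have alg: "alg_M G t w c b = (if U = {} then return_spmf Infeasible
      else if \<forall>e\<in>edges G. \<alpha> e = 0 then
        return_spmf (Cut (if feasible t w b U \<and> U \<noteq> verts G then cut G U else edges G))
      else if feasible t w b U then map_spmf Cut (alg_H ?G c)
      else bind_pmf (proportional_pmf (edges G) \<alpha>)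
        (\<lambda>e. alg_M (contract ?G (inc ?G e)) t (contract_weights ?w (inc ?G e)) c b))"
    unfolding \<alpha>_def U_def by (rule alg_M_eq)
  have W: "verts G - U \<subseteq> verts G" by blast
  have H: "lossless_spmf (alg_H (contract G (verts G - U)) c)"
    by (rule lossless_alg_H[OF hypergraph_contract[OF G W] ball_edges_contract[OF c]])
  show ?case
  proof (cases "U = {} \<or> (\<forall>e\<in>edges G. \<alpha> e = 0) \<or> feasible t w b U")
    case True
    then show ?thesis using H unfolding alg by (auto simp: lossless_map_spmf)
  next
    case False
    then have U: "U \<noteq> {}" "\<not> feasible t w b U" and not0: "\<not> (\<forall>e\<in>edges G. \<alpha> e = 0)"
      by blast+
    have \<alpha>: "0 \<le> \<alpha> e" if "e \<in> edges G" for e using c that by (simp add: \<alpha>_def less_imp_le)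
    have "lossless_spmf (alg_M (contract ?G (inc ?G e)) t (contract_weights ?w (inc ?G e)) c b)"
      if e: "e \<in> edges G" for e
      by (intro less.hyps drawn_contraction[OF G c W e])
    note lossless = this
    have pos: "0 < sum \<alpha> (edges G)"
      using sum_pos_if_not_all_0[OF hypergraphD(2)[OF G] \<alpha> not0] .
    have "lossless_spmf (bind_pmf (proportional_pmf (edges G) \<alpha>)
        (\<lambda>e. alg_M (contract ?G (inc ?G e)) t (contract_weights ?w (inc ?G e)) c b))"
      by (rule lossless_bind_proportional_pmf[OF hypergraphD(2)[OF G] \<alpha> pos lossless])
    then show ?thesis
      unfolding alg if_not_P[OF U(1)] if_not_P[OF not0] if_not_P[OF U(2)] .
  qed
qed

section \<open>Simulation of the algorithms by the main loop\<close>

lemma exec_main_loop: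
  "nats s ''mode'' < 2 \<Longrightarrow> exec main_loop s =
    bind_spmf (exec (Seq (assigns_com select_assigns) branch_com) (tick s)) (exec main_loop)"
  "nats s ''mode'' = 2 \<Longrightarrow> exec main_loop s = return_spmf (tick s)"
  by (simp_all add: main_loop_def loop.simps[of _ _ s])

lemma exec_main_loop_select:
  assumes tr: "tracks n m t c b N G w s" and L: "L = n + m + t + 1" and mode: "N ''mode'' < 2"
    and U: "U = (if N ''mode'' < 1 then {v \<in> verts G. feasible_vertex t w b v} else verts G)"
    and \<alpha>: "\<alpha> = (\<lambda>e. real (card (U - inc G e)) / real (card U) * c e)"
  obtains s1 M A \<psi> where "exec main_loop s = bind_spmf (exec branch_com s1) (exec main_loop)"
    "models N M s1" "sizes n m t N" "represents n m t c b M A \<psi> G w"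
    "steps s1 \<le> steps s + (450 * L ^ 3 + 1)"
    "M ''r'' 0 0 = card U"
    "\<And>e. e < m \<Longrightarrow> M ''alpha'' e 0 = (if e \<in> edges G then \<alpha> e else 0)"
    "\<And>e. e < m \<Longrightarrow> M ''suf'' e 0 = (\<Sum>k\<in>{e..<m}. M ''alpha'' k 0)"
    "M ''tot'' 0 0 = sum \<alpha> (edges G)"
    "0 < M ''bad'' 0 0 \<longleftrightarrow> \<not> feasible t w b U"
    "\<And>v. v < n \<Longrightarrow> M ''S'' v 0 = of_bool (v \<in> A \<and> \<psi> v \<in> verts G - U)"
    "{e. M ''out'' e 0 = 1} = (if feasible t w b U \<and> U \<noteq> verts G then cut G U else edges G)"
proof -
  obtain M A \<psi> where N: "sizes n m t N" and s: "models N M s"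
    and rep: "represents n m t c b M A \<psi> G w"
    using tr unfolding tracks_def by blast
  have "models N M (tick s)" using s by simp
  then obtain s1 where s1: "exec (assigns_com select_assigns) (tick s) = return_spmf s1"
    "models N (fold (assign_sem N) select_assigns M) s1" "steps s1 \<le> steps (tick s) + 450 * L ^ 3"
    by (rule runs_to_bounded_assigns[OF N L, of _ _ select_assigns]) simp_all
  have "nats s ''mode'' < 2" using s mode by (simp add: models_def)
  then have loop: "exec main_loop s = bind_spmf (exec branch_com s1) (exec main_loop)"
    using s1(1) by (simp add: exec_main_loop)
  have "steps s1 \<le> steps s + (450 * L ^ 3 + 1)" using s1(3) by simp
  then show ?thesis
    by (rule that[OF loop s1(2) N, rotated]) (use represents_select[OF N rep, folded U] in \<open>simp_all add: \<alpha>\<close>)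
qed

lemma exec_branch_stop:
  assumes "models N M s" "0 < M ''r'' 0 0" "\<not> 0 < M ''tot'' 0 0"
  obtains s' where "bind_spmf (exec branch_com s) (exec main_loop) = return_spmf s'"
    "reals s' = M" "nats s' ''infeasible'' = N ''infeasible''" "steps s' \<le> steps s + 4"
proof -
  let ?s = "tick (tick (set_nat ''mode'' 2 (tick (tick s))))"
  have "reals s = M" "nats s ''infeasible'' = N ''infeasible''"
    using assms(1) by (simp_all add: models_def)
  then show ?thesis
    using assms(2,3) by (intro that[of ?s]) (simp_all add: branch_com_def exec_main_loop)
qed

lemma exec_branch_infeasible:
  assumes "models N M s" "\<not> 0 < M ''r'' 0 0"
  obtains s' where "bind_spmf (exec branch_com s) (exec main_loop) = return_spmf s'"
    "nats s' ''infeasible'' = 1" "steps s' \<le> steps s + 4"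
proof -
  let ?s = "tick (tick (set_nat ''mode'' 2 (tick (set_nat ''infeasible'' 1 (tick s)))))"
  have "reals s = M" using assms(1) by (simp add: models_def)
  then show ?thesis
    using assms(2) by (intro that[of ?s]) (simp_all add: branch_com_def exec_main_loop)
qed

lemma exec_branch_draw:
  assumes "models N M s" "0 < M ''r'' 0 0" "0 < M ''tot'' 0 0"
    "\<not> (N ''mode'' < 1 \<and> \<not> 0 < M ''bad'' 0 0)"
  shows "exec branch_com s =
    exec (Seq draw_com (assigns_com contract_drawn)) (tick (tick (tick s)))"
proof -
  have "reals s = M" "nats s ''mode'' = N ''mode''"
    using assms(1) by (simp_all add: models_def)
  then show ?thesis
    using assms(2-4) by (cases "N ''mode'' < 1") (simp_all add: branch_com_def)
qed

lemma exec_branch_switch: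
  assumes "models N M s" "0 < M ''r'' 0 0" "0 < M ''tot'' 0 0" "N ''mode'' < 1" "\<not> 0 < M ''bad'' 0 0"
  shows "exec branch_com s = bind_spmf
    (exec (assigns_com (contract_calc @ contract_copy)) (tick (tick (tick s))))
    (exec (SetNat ''mode'' (NLit 1)))"
proof -
  have "reals s = M" "nats s ''mode'' = N ''mode''"
    using assms(1) by (simp_all add: models_def)
  then show ?thesis
    using assms(2-5) by (simp add: branch_com_def)
qed

text \<open>A round costs at most \<open>450 * L ^ 3 + 1\<close> for the selection, three tests, and
  \<open>460 * L ^ 3\<close> for draw and contractions, hence at most \<open>K\<close>. The vertex
  set must be nonempty, since otherwise \<open>r\<close> is 0 and the program would report
  infeasibility.\<close>

lemma main_loop_alg_H:
  assumes "hypergraph G" "\<forall>e\<in>edges G. 0 < c e" "verts G \<noteq> {}"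
    and "tracks n m t c b N G w s" "N ''mode'' = 1" "N ''infeasible'' = 0"
    and "K = 1000 * (n + m + t + 1) ^ 3"
  shows "rel_spmf (\<lambda>F s'. result s' = Cut F \<and> steps s' \<le> steps s + (card (edges G) + 1) * K)
    (alg_H G c) (exec main_loop s)"
  using assms(1-6)
proof (induction "card (edges G)" arbitrary: G N w s rule: less_induct)
  case less
  note G = less.prems(1) and c = less.prems(2) and mode = less.prems(5) and inf = less.prems(6)
  define L where "L = n + m + t + 1"
  have K: "K = 1000 * L ^ 3" and L1: "1 \<le> L ^ 3" by (simp_all add: assms(7) L_def)
  define \<alpha> where "\<alpha> = (\<lambda>e. real (card (verts G - inc G e)) / real (card (verts G)) * c e)"
  have alg: "alg_H G c = (if \<forall>e\<in>edges G. \<alpha> e = 0 then return_spmf (edges G)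
      else bind_pmf (proportional_pmf (edges G) \<alpha>) (\<lambda>e. alg_H (contract G (inc G e)) c))"
    unfolding \<alpha>_def by (rule alg_H_eq[OF G])
  have mode2: "N ''mode'' < 2" using mode by simp
  have U: "verts G = (if N ''mode'' < 1 then {v \<in> verts G. feasible_vertex t w b v} else verts G)"
    using mode by simp
  obtain s1 M A \<psi> where loop: "exec main_loop s = bind_spmf (exec branch_com s1) (exec main_loop)"
    and s1: "models N M s1" "sizes n m t N" "represents n m t c b M A \<psi> G w"
    "steps s1 \<le> steps s + (450 * L ^ 3 + 1)"
    and r: "M ''r'' 0 0 = card (verts G)"
    and alpha: "\<And>e. e < m \<Longrightarrow> M ''alpha'' e 0 = (if e \<in> edges G then \<alpha> e else 0)"
    and suf: "\<And>e. e < m \<Longrightarrow> M ''suf'' e 0 = (\<Sum>k\<in>{e..<m}. M ''alpha'' k 0)"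
    and tot: "M ''tot'' 0 0 = sum \<alpha> (edges G)"
    and "0 < M ''bad'' 0 0 \<longleftrightarrow> \<not> feasible t w b (verts G)"
    and S: "\<And>v. v < n \<Longrightarrow> M ''S'' v 0 = of_bool (v \<in> A \<and> \<psi> v \<in> verts G - verts G)"
    and out: "{e. M ''out'' e 0 = 1} =
      (if feasible t w b (verts G) \<and> verts G \<noteq> verts G then cut G (verts G) else edges G)"
    by (rule exec_main_loop_select[OF less.prems(4) L_def mode2 U \<alpha>_def]) (rule that; assumption | simp)
  have r0: "0 < M ''r'' 0 0" using r less.prems(3) hypergraphD(1)[OF G] by (simp add: card_gt_0_iff)
  have \<alpha>0: "0 \<le> \<alpha> e" if "e \<in> edges G" for e using c that by (simp add: \<alpha>_def less_imp_le)
  show ?case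
  proof (cases "\<forall>e\<in>edges G. \<alpha> e = 0")
    case True
    then have "\<not> 0 < M ''tot'' 0 0" using tot by simp
    from exec_branch_stop[OF s1(1) r0 this] obtain s' where
      s': "bind_spmf (exec branch_com s1) (exec main_loop) = return_spmf s'"
      "reals s' = M" "nats s' ''infeasible'' = N ''infeasible''" "steps s' \<le> steps s1 + 4" .
    have "result s' = Cut (edges G)" using s'(2,3) inf out by (simp add: result_def)
    moreover have "steps s' \<le> steps s + K" using s'(4) s1(4) K L1 by linarith
    then have "steps s' \<le> steps s + (card (edges G) + 1) * K" by simp
    ultimately show ?thesis unfolding loop s'(1) alg using True by simp
  next
    case False
    have pos: "0 < sum \<alpha> (edges G)"
      using sum_pos_if_not_all_0[OF hypergraphD(2)[OF G] \<alpha>0 False] .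
    let ?s = "tick (tick (tick s1))"
    have branch: "exec branch_com s1 = exec (Seq draw_com (assigns_com contract_drawn)) ?s"
      using exec_branch_draw[OF s1(1) r0] tot pos mode by simp
    have "rel_spmf (\<lambda>F s'. result s' = Cut F \<and> steps s' \<le> steps s + (card (edges G) + 1) * K)
        (bind_pmf (proportional_pmf (edges G) \<alpha>) (\<lambda>e. alg_H (contract G (inc G e)) c))
        (bind_spmf (exec (Seq draw_com (assigns_com contract_drawn)) ?s) (exec main_loop))"
    proof (rule rel_spmf_draw_step[OF s1(2) L_def _ s1(3) _ S alpha suf \<alpha>0 pos])
      fix e s'
      let ?G = "contract G (verts G - verts G)" and ?w = "contract_weights w (verts G - verts G)"
      let ?N = "N(''x'' := e, ''h'' := 1)"
      assume e: "e \<in> edges G"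
        and tr: "tracks n m t c b ?N (contract ?G (inc ?G e)) (contract_weights ?w (inc ?G e)) s'"
        and s': "steps s' \<le> steps ?s + 460 * L ^ 3"
      note G' = drawn_contraction[OF G c empty_subsetI e, simplified]
      have "rel_spmf (\<lambda>F s''. result s'' = Cut F \<and>
          steps s'' \<le> steps s' + (card (edges (contract G (inc G e))) + 1) * K)
          (alg_H (contract G (inc G e)) c) (exec main_loop s')"
        by (rule less.hyps[OF G'(3,1,2,4) tr[simplified]]) (use mode inf in simp_all)
      moreover have "steps s' + (card (edges (contract G (inc G e))) + 1) * K \<le>
          steps s + (card (edges G) + 1) * K"
      proof -
        have "(card (edges (contract G (inc G e))) + 1) * K \<le> card (edges G) * K"
          using G'(3) by (intro mult_right_mono) auto
        moreover have "steps s' \<le> steps s + K" using s' s1(4) K L1 by simp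
        ultimately show ?thesis by simp
      qed
      ultimately show "rel_spmf (\<lambda>F s'. result s' = Cut F \<and>
          steps s' \<le> steps s + (card (edges G) + 1) * K)
          (alg_H (contract G (inc G e)) c) (exec main_loop s')"
        by (elim rel_spmf_mono) auto
    qed (use s1(1) in simp_all)
    then show ?thesis unfolding loop branch alg if_not_P[OF False] .
  qed
qed

text \<open>The bound has \<open>+ 2\<close> where the one for \<open>alg_H\<close> has
  \<open>+ 1\<close>, because the round that switches to mode 1 may delete no hyperedge.\<close>

lemma main_loop_alg_M:
  assumes "hypergraph G" "\<forall>e\<in>edges G. 0 < c e"
    and "tracks n m t c b N G w s" "N ''mode'' = 0" "N ''infeasible'' = 0"
    and "K = 1000 * (n + m + t + 1) ^ 3"
  shows "rel_spmf (\<lambda>F s'. result s' = F \<and> steps s' \<le> steps s + (card (edges G) + 2) * K)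
    (alg_M G t w c b) (exec main_loop s)"
  using assms(1-5)
proof (induction "card (edges G)" arbitrary: G N w s rule: less_induct)
  case less
  note G = less.prems(1) and c = less.prems(2) and mode = less.prems(4) and inf = less.prems(5)
  define L where "L = n + m + t + 1"
  have K: "K = 1000 * L ^ 3" and L1: "1 \<le> L ^ 3" by (simp_all add: assms(6) L_def)
  define U where "U = {v \<in> verts G. feasible_vertex t w b v}"
  define \<alpha> where "\<alpha> = (\<lambda>e. real (card (U - inc G e)) / real (card U) * c e)"
  let ?G = "contract G (verts G - U)" and ?w = "contract_weights w (verts G - U)"
  have alg: "alg_M G t w c b = (if U = {} then return_spmf Infeasible
      else if \<forall>e\<in>edges G. \<alpha> e = 0 then
        return_spmf (Cut (if feasible t w b U \<and> U \<noteq> verts G then cut G U else edges G))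
      else if feasible t w b U then map_spmf Cut (alg_H ?G c)
      else bind_pmf (proportional_pmf (edges G) \<alpha>)
        (\<lambda>e. alg_M (contract ?G (inc ?G e)) t (contract_weights ?w (inc ?G e)) c b))"
    unfolding \<alpha>_def U_def by (rule alg_M_eq)
  have mode2: "N ''mode'' < 2" using mode by simp
  have U: "U = (if N ''mode'' < 1 then {v \<in> verts G. feasible_vertex t w b v} else verts G)"
    using mode by (simp add: U_def)
  obtain s1 M A \<psi> where loop: "exec main_loop s = bind_spmf (exec branch_com s1) (exec main_loop)"
    and s1: "models N M s1" "sizes n m t N" "represents n m t c b M A \<psi> G w"
    "steps s1 \<le> steps s + (450 * L ^ 3 + 1)"
    and r: "M ''r'' 0 0 = card U"
    and alpha: "\<And>e. e < m \<Longrightarrow> M ''alpha'' e 0 = (if e \<in> edges G then \<alpha> e else 0)"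
    and suf: "\<And>e. e < m \<Longrightarrow> M ''suf'' e 0 = (\<Sum>k\<in>{e..<m}. M ''alpha'' k 0)"
    and tot: "M ''tot'' 0 0 = sum \<alpha> (edges G)"
    and bad: "0 < M ''bad'' 0 0 \<longleftrightarrow> \<not> feasible t w b U"
    and S: "\<And>v. v < n \<Longrightarrow> M ''S'' v 0 = of_bool (v \<in> A \<and> \<psi> v \<in> verts G - U)"
    and out: "{e. M ''out'' e 0 = 1} =
      (if feasible t w b U \<and> U \<noteq> verts G then cut G U else edges G)"
    by (rule exec_main_loop_select[OF less.prems(3) L_def mode2 U \<alpha>_def]) (rule that; assumption | simp)
  have finU: "finite U" using hypergraphD(1)[OF G] by (simp add: U_def)
  have \<alpha>0: "0 \<le> \<alpha> e" if "e \<in> edges G" for e using c that by (simp add: \<alpha>_def less_imp_le)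
  have K2: "K \<le> (card (edges G) + 2) * K" by simp
  show ?case
  proof (cases "U = {}")
    case True
    then have "\<not> 0 < M ''r'' 0 0" using r by simp
    from exec_branch_infeasible[OF s1(1) this] obtain s' where
      s': "bind_spmf (exec branch_com s1) (exec main_loop) = return_spmf s'"
      "nats s' ''infeasible'' = 1" "steps s' \<le> steps s1 + 4" .
    have "result s' = Infeasible" using s'(2) by (simp add: result_def)
    moreover have "steps s' \<le> steps s + K" using s'(3) s1(4) K L1 by linarith
    then have "steps s' \<le> steps s + (card (edges G) + 2) * K" using K2 by linarith
    ultimately show ?thesis unfolding loop s'(1) alg using True by simp
  next
    case U_ne: False
    then have r0: "0 < M ''r'' 0 0" using r finU by (simp add: card_gt_0_iff)
    show ?thesis
    proof (cases "\<forall>e\<in>edges G. \<alpha> e = 0")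
      case True
      then have "\<not> 0 < M ''tot'' 0 0" using tot by simp
      from exec_branch_stop[OF s1(1) r0 this] obtain s' where
        s': "bind_spmf (exec branch_com s1) (exec main_loop) = return_spmf s'"
        "reals s' = M" "nats s' ''infeasible'' = N ''infeasible''" "steps s' \<le> steps s1 + 4" .
      have "result s' = Cut (if feasible t w b U \<and> U \<noteq> verts G then cut G U else edges G)"
        using s'(2,3) inf out by (simp add: result_def)
      moreover have "steps s' \<le> steps s + K" using s'(4) s1(4) K L1 by linarith
      then have "steps s' \<le> steps s + (card (edges G) + 2) * K" using K2 by linarith
      ultimately show ?thesis
        unfolding loop s'(1) alg if_not_P[OF U_ne] if_P[OF True] by (simp only: rel_spmf_return_spmf1)
          (simp add: rel_spmf_return_spmf1)
    next
      case False
      have pos: "0 < sum \<alpha> (edges G)"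
        using sum_pos_if_not_all_0[OF hypergraphD(2)[OF G] \<alpha>0 False] .
      then have tot0: "0 < M ''tot'' 0 0" using tot by simp
      let ?s = "tick (tick (tick s1))"
      have s: "models N M ?s" using s1(1) by simp
      have W: "verts G - U \<subseteq> verts G" by blast
      show ?thesis
      proof (cases "feasible t w b U")
        case True
        then have branch: "exec branch_com s1 = bind_spmf
            (exec (assigns_com (contract_calc @ contract_copy)) ?s) (exec (SetNat ''mode'' (NLit 1)))"
          using exec_branch_switch[OF s1(1) r0 tot0] bad mode by simp
        obtain s2 where s2: "exec (assigns_com (contract_calc @ contract_copy)) ?s = return_spmf s2"
          "tracks n m t c b N ?G ?w s2" "steps s2 \<le> steps ?s + 450 * L ^ 3"
          by (rule tracks_contract[OF s1(2) L_def s s1(3) W S]) blast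
        let ?s3 = "tick (set_nat ''mode'' 1 s2)"
        have "tracks n m t c b (N(''mode'' := 1)) ?G ?w ?s3"
          using s2(2) models_set_nat unfolding tracks_def by (fastforce simp: sizes_def)
        moreover have "verts G \<noteq> {}" using U_ne by (auto simp: U_def)
        then have "verts ?G \<noteq> {}"
          by (rule verts_contract_nonempty)
        moreover have "\<forall>e\<in>edges ?G. 0 < c e"
          using c by (rule ball_edges_contract)
        ultimately have "rel_spmf (\<lambda>F s'. result s' = Cut F \<and>
            steps s' \<le> steps ?s3 + (card (edges ?G) + 1) * K) (alg_H ?G c) (exec main_loop ?s3)"
          using assms(6) inf
          by (intro main_loop_alg_H[OF hypergraph_contract[OF G W], where N = "N(''mode'' := 1)"]) simp_all
        moreover have "steps ?s3 + (card (edges ?G) + 1) * K \<le> steps s + (card (edges G) + 2) * K"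
        proof -
          have "card (edges ?G) \<le> card (edges G)"
            using hypergraphD(2)[OF G] edges_contract_subset by (intro card_mono)
          then have "(card (edges ?G) + 1) * K \<le> (card (edges G) + 1) * K"
            by (intro mult_right_mono) auto
          moreover have "steps ?s3 \<le> steps s + K" using s2(3) s1(4) K L1 by simp
          ultimately show ?thesis unfolding add_mult_distrib by linarith
        qed
        ultimately have "rel_spmf (\<lambda>F s'. result s' = F \<and> steps s' \<le> steps s + (card (edges G) + 2) * K)
            (map_spmf Cut (alg_H ?G c)) (exec main_loop ?s3)"
          unfolding spmf_rel_map by (elim rel_spmf_mono) auto
        then show ?thesis
          unfolding loop branch s2(1) alg if_not_P[OF U_ne] if_not_P[OF False] if_P[OF True] by simp
      next
        case infeasible: False
        have branch: "exec branch_com s1 = exec (Seq draw_com (assigns_com contract_drawn)) ?s"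
          using exec_branch_draw[OF s1(1) r0 tot0] bad infeasible by simp
        have "rel_spmf (\<lambda>F s'. result s' = F \<and> steps s' \<le> steps s + (card (edges G) + 2) * K)
            (bind_pmf (proportional_pmf (edges G) \<alpha>)
              (\<lambda>e. alg_M (contract ?G (inc ?G e)) t (contract_weights ?w (inc ?G e)) c b))
            (bind_spmf (exec (Seq draw_com (assigns_com contract_drawn)) ?s) (exec main_loop))"
        proof (rule rel_spmf_draw_step[OF s1(2) L_def s s1(3) W S alpha suf \<alpha>0 pos])
          fix e s'
          let ?G2 = "contract ?G (inc ?G e)" and ?w2 = "contract_weights ?w (inc ?G e)"
          let ?N = "N(''x'' := e, ''h'' := 1)"
          assume e: "e \<in> edges G" and tr: "tracks n m t c b ?N ?G2 ?w2 s'"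
            and s': "steps s' \<le> steps ?s + 460 * L ^ 3"
          note G' = drawn_contraction[OF G c W e]
          have "rel_spmf (\<lambda>F s''. result s'' = F \<and> steps s'' \<le> steps s' + (card (edges ?G2) + 2) * K)
              (alg_M ?G2 t ?w2 c b) (exec main_loop s')"
            by (rule less.hyps[OF G'(3,1,2) tr]) (use mode inf in simp_all)
          moreover have "steps s' + (card (edges ?G2) + 2) * K \<le> steps s + (card (edges G) + 2) * K"
          proof -
            have "(card (edges ?G2) + 2) * K \<le> (card (edges G) + 1) * K"
              using G'(3) by (intro mult_right_mono) auto
            moreover have "steps s' \<le> steps s + K" using s' s1(4) K L1 by simp
            ultimately show ?thesis by simp
          qed
          ultimately show "rel_spmf (\<lambda>F s'. result s' = F \<and>
              steps s' \<le> steps s + (card (edges G) + 2) * K)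
              (alg_M ?G2 t ?w2 c b) (exec main_loop s')"
            by (elim rel_spmf_mono) auto
        qed
        then show ?thesis
          unfolding loop branch alg if_not_P[OF U_ne] if_not_P[OF False] if_not_P[OF infeasible] .
      qed
    qed
  qed
qed

lemma exec_alg_M_com:
  fixes G :: "(nat, nat) hypergraph"
  assumes inst: "problem_instance G t w c b" and VE: "verts G = {..<n}" "edges G = {..<m}" and n: "2 \<le> n"
  shows "rel_spmf (\<lambda>F s'. result s' = F \<and> steps s' \<le> 1000 * (n + m + t + 1) ^ 4)
    (alg_M G t w c b) (exec alg_M_com (input_store G t w c b))"
proof -
  define L where "L = n + m + t + 1"
  define K where "K = 1000 * L ^ 3"
  have G: "hypergraph G" and c: "\<forall>e\<in>edges G. 0 < c e" using inst by (auto simp: problem_instance_def)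
  let ?s0 = "input_store G t w c b"
  define s where "s = tick (set_nat ''one'' 1 ?s0)"
  define N where "N = nats s"
  have N: "sizes n m t N" "N ''mode'' = 0" "N ''infeasible'' = 0"
    by (simp_all add: N_def s_def sizes_def input_store_def VE)
  have s: "models N (reals ?s0) s" by (simp add: models_def N_def s_def)
  obtain s1 where s1: "exec (assigns_com init_assigns) s = return_spmf s1"
    "models N (fold (assign_sem N) init_assigns (reals ?s0)) s1" "steps s1 \<le> steps s + 450 * L ^ 3"
    by (rule runs_to_bounded_assigns[OF N(1) L_def s, of init_assigns]) simp_all
  let ?M = "fold (assign_sem N) init_assigns (reals ?s0)"
  have "represents n m t c b ?M {..<n} id G w"
    using hypergraphD(3,4)[OF G] N(1)
    by (simp add: represents_def init_assigns_def input_store_def VE sizes_def)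
  then have tr: "tracks n m t c b N G w s1" using N(1) s1(2) unfolding tracks_def by blast
  have "rel_spmf (\<lambda>F s'. result s' = F \<and> steps s' \<le> steps s1 + (card (edges G) + 2) * K)
      (alg_M G t w c b) (exec main_loop s1)"
    by (rule main_loop_alg_M[OF G c tr N(2,3)]) (simp add: K_def L_def)
  moreover have "steps s1 + (card (edges G) + 2) * K \<le> 1000 * L ^ 4"
  proof -
    have "1 \<le> L ^ 3" by (simp add: L_def)
    then have "steps s1 \<le> K"
      using s1(3) by (simp add: s_def input_store_def K_def)
    then have "steps s1 + (card (edges G) + 2) * K \<le> (m + 3) * K" by (simp add: VE algebra_simps)
    \<comment> \<open>Here n >= 2 gives m + 3 <= L, so initialization and all rounds fit into L
      rounds.\<close>
    also have "\<dots> \<le> L * K" using n by (intro mult_right_mono) (auto simp: L_def)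
    also have "\<dots> = 1000 * L ^ 4" by (simp add: K_def power_numeral_reduce)
    finally show ?thesis .
  qed
  ultimately have "rel_spmf (\<lambda>F s'. result s' = F \<and> steps s' \<le> 1000 * L ^ 4)
      (alg_M G t w c b) (exec main_loop s1)"
    by (elim rel_spmf_mono) auto
  moreover have "exec alg_M_com ?s0 = exec main_loop s1"
    using s1(1) by (simp add: alg_M_com_def s_def)
  ultimately show ?thesis by (simp add: L_def)
qed

text \<open>All three requirements come from one coupling: equal weights transfer losslessness from
  \<open>alg_M\<close>, mapping by \<open>result\<close> turns the relation into equality of
  distributions, and the step bound holds on the support. \<open>[:1, 1:]\<close> is the polynomial
  1 + X, evaluated at n + m + t.\<close>

lemma implements_alg_M_com: "implements_alg_M alg_M_com (poly (smult 1000 ([:1, 1:] ^ 4)))"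
  unfolding implements_alg_M_def
proof (intro allI impI)
  fix G :: "(nat, nat) hypergraph" and n m t w c b
  assume "problem_instance G t w c b \<and> verts G = {..<n} \<and> edges G = {..<m} \<and> 2 \<le> n"
  then have inst: "problem_instance G t w c b" and VE: "verts G = {..<n}" "edges G = {..<m}"
    and n: "2 \<le> n" by auto
  let ?p = "alg_M G t w c b" and ?q = "exec alg_M_com (input_store G t w c b)"
  note rel = exec_alg_M_com[OF inst VE n]
  have "lossless_spmf ?p"
    using inst by (intro lossless_alg_M) (auto simp: problem_instance_def)
  then have "lossless_spmf ?q"
    using rel_spmf_weightD[OF rel] by (simp add: lossless_spmf_def)
  moreover have "rel_spmf (=) ?p (map_spmf result ?q)"
    unfolding spmf_rel_map using rel by (elim rel_spmf_mono) auto
  then have "map_spmf result ?q = ?p" by (simp add: spmf_rel_eq)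
  moreover have "\<forall>s\<in>set_spmf ?q. steps s \<le> 1000 * (n + m + t + 1) ^ 4"
  proof
    fix s assume "s \<in> set_spmf ?q"
    then show "steps s \<le> 1000 * (n + m + t + 1) ^ 4"
      using rel by (elim rel_spmfE) auto
  qed
  ultimately show "lossless_spmf ?q \<and> map_spmf result ?q = ?p \<and>
      (\<forall>s\<in>set_spmf ?q. steps s \<le> poly (smult 1000 ([:1, 1:] ^ 4)) (n + m + t))"
    by (simp add: add.commute)
qed

theorem theorem11:
  "(\<forall>(G :: ('v, 'e) hypergraph) n t w c b F.
      problem_instance G t w c b \<and> card (verts G) = n \<and> 2 \<le> n \<and> node_budgeted_min_cut G t w c b F \<longrightarrow>
      spmf (alg_M G t w c b) (Cut F) \<ge> Q n) \<and>
   (\<exists>C (p :: nat poly). implements_alg_M C (poly p))"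
proof (intro conjI allI impI)
  fix G :: "('v, 'e) hypergraph" and n t w c b F
  assume A: "problem_instance G t w c b \<and> card (verts G) = n \<and> 2 \<le> n \<and>
    node_budgeted_min_cut G t w c b F"
  then have "Q (card (verts G)) \<le> spmf (alg_M G t w c b) (Cut F)"
    by (intro alg_M_min_cut) simp_all
  then show "Q n \<le> spmf (alg_M G t w c b) (Cut F)" using A by simp
next
  show "\<exists>C (p :: nat poly). implements_alg_M C (poly p)"
    by (intro exI) (rule implements_alg_M_com)
qed

end
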